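(* Let $\mathcal F=\{f_i(\underline x)=A_i\underline x+t_i\}_{i=1}^N$, $A_i=\begin{pmatrix} b&0\\ d_i&a\end{pmatrix}$, $t_i=(t_{i,1},t_{i,2})^T$, be a diagonally homogeneous TGL IFS on $[0,1]^2$ with attractor $\Lambda$ and $M$ columns. Assume: (i) $\mathcal F$ has uniform vertical fibres (each column contains the same number of maps); (ii) the projection of $\Lambda$ to the $x$-axis is the whole interval $[0,1]$ (i.e. $1/b=M$); (iii) $$a<\min\left\{b^{\frac{\log N}{\log M}},\ \frac{b\,d_*}{2+d_*}\right\},\qquad d_*:=\min_{1\le m\le M,\ \mathcal P_m\neq\emptyset}\ \min_{(k,\ell)\in\mathcal P_m}|d_k-d_\ell| .$$ Let $\widehat{\mathcal F}=\{F_i(\widehat{\underline x})=\widehat A_i\widehat{\underline x}+\widehat t_i\}_{i=1}^N$ be a self-affine IFS on $[0,1]^3$ with $$\widehat A_i=\begin{pmatrix} b&0&0\\ d_i&a&0\\ u_i&v_i&\lambda_i\end{pmatrix},\qquad \widehat t_i=\begin{pmatrix}t_{i,1}\\t_{i,2}\\t_{i,3}\end{pmatrix},$$ where $u_i,v_i,t_{i,3}\in\mathbb R$ and $0<|\lambda_i|<a<b<1$ for all $i$, such that $F_i([0,1]^3)\subset[0,1]^3$ for all $i\in\{1,\dots,N\}$ and $F_i([0,1]^3)\cap F_j([0,1]^3)$ has empty interior for all $i\ne j$. Let $\widehat\Lambda$ be its attractor, and for $\mathbf p=(1/N,\dots,1/N)$ let $\widehat\nu_{\mathbf p}=\widehat\Pi_*(\mathbf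 p^{\mathbb N})$. Then $$\dim_{\rm H}\widehat\nu_{\mathbf p}=\dim_{\rm H}\widehat\Lambda=\dim_{\rm B}\widehat\Lambda=\dim_{\rm Aff}\widehat\Lambda=1+\frac{\log(Nb)}{-\log a} .$$
   Context: Diagonally homogeneous TGL IFS: maps $f_i$ as in the claim, $i\in[N]=\{1,\dots,N\}$, with $0<a<b<1$, $d_i\in\mathbb R$, $t_{i,1},t_{i,2}\ge0$, such that: $[N]$ is partitioned into $M>1$ nonempty consecutive blocks $\mathcal I_1,\dots,\mathcal I_M$ (columns), with $t_{k,1}=t_{\ell,1}=:c_m$ for all $k,\ell\in\mathcal I_m$; $a|\mathcal I_m|\le1$ for every $m$; the columns are non-overlapping, $c_m+b\le c_{m+1}$ for $m=1,\dots,M-1$ and $c_M+b\le1$; $f_i([0,1]^2)\subset[0,1]^2$ for all $i$; and the smallest and largest fixed points of the maps $h_m(x)=bx+c_m$, $m=1,\dots,M$, are $0$ and $1$. $\mathcal P_m$ is the set of pairs $(k,\ell)$ with $k,\ell\in\mathcal I_m$, $k\ne\ell$, such that the interiors of $f_k([0,1]^2)$ and $f_\ell([0,1]^2)$ intersect. If all $\mathcal P_m$ are empty, $d_*=+\infty$ and $bd_*/(2+d_* )$ is read as $b$. $\widehat\Pi:\{1,\dots,N\}^{\mathbb N}\to\widehat\Lambda$ is the natural projection $\widehat\Pi(\mathbf i)=\lim_nF_{i_1}\circ\dots\circ F_{i_n}(\underline0)$. Affinity dimension: for a $3\times3$ matrix $A$ with singular values $\alpha_1\ge\alpha_2\ge\alpha_3>0$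 let $\varphi^t(A)=\alpha_1^t$ for $0\le t\le1$, $\alpha_1\alpha_2^{t-1}$ for $1\le t\le2$, $\alpha_1\alpha_2\alpha_3^{t-2}$ for $2\le t\le3$, and $(\alpha_1\alpha_2\alpha_3)^{t/3}$ for $t>3$. Then $\dim_{\rm Aff}\widehat\Lambda=\inf\{t\ge 0:\sum_{n\ge1}\sum_{(i_1,\dots,i_n)\in[N]^n}\varphi^t(\widehat A_{i_1}\cdots\widehat A_{i_n})<\infty\}$. *)

theory Defs
  imports "HOL-Probability.Probability"
begin

section \<open>Hausdorff and box dimension\<close>

(* Contribution of U to the s-dimensional Hausdorff sum, with the usual conventions
   diam({})^s = 0 and diam(U)^0 = 1 for nonempty U (note that 0 powr 0 = 0). *)
definition diam_pow :: "real \<Rightarrow> 'a::metric_space set \<Rightarrow> ennreal" where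
  "diam_pow s U = (if U = {} then 0 else if s = 0 then 1 else ennreal (diameter U powr s))"

(* The library's diameter is meaningless on unbounded sets, hence the boundedness requirement
   in all covers below. *)
definition hausdorff_premeasure :: "real \<Rightarrow> real \<Rightarrow> 'a::metric_space set \<Rightarrow> ennreal" where
  "hausdorff_premeasure s \<delta> E =
     (INF U\<in>{U :: nat \<Rightarrow> 'a set. E \<subseteq> (\<Union>i. U i) \<and> (\<forall>i. bounded (U i) \<and> diameter (U i) \<le> \<delta>)}.
        \<Sum>i. diam_pow s (U i))"

definition hausdorff_measure :: "real \<Rightarrow> 'a::metric_space set \<Rightarrow> ennreal" where
  "hausdorff_measure s E = (SUP \<delta>\<in>{0<..}. hausdorff_premeasure s \<delta> E)"

definition hausdorff_dim :: "'a::metric_space set \<Rightarrow> ereal" where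
  "hausdorff_dim E = (INF s\<in>{s. 0 \<le> s \<and> hausdorff_measure s E = 0}. ereal s)"

(* The lower Hausdorff dimension of a measure. *)
definition measure_hausdorff_dim :: "'a::metric_space measure \<Rightarrow> ereal" where
  "measure_hausdorff_dim \<mu> = (INF E\<in>{E \<in> sets \<mu>. emeasure \<mu> E > 0}. hausdorff_dim E)"

(* Intended for totally bounded E, where a finite cover exists for every delta > 0. *)
definition covering_number :: "real \<Rightarrow> 'a::metric_space set \<Rightarrow> nat" where
  "covering_number \<delta> E =
     (LEAST n. \<exists>C. finite C \<and> card C = n \<and> E \<subseteq> \<Union>C \<and> (\<forall>U\<in>C. bounded U \<and> diameter U \<le> \<delta>))"

definition lower_box_dim :: "'a::metric_space set \<Rightarrow> ereal" where
  "lower_box_dim E =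
     Liminf (at_right 0) (\<lambda>\<delta>. ereal (ln (real (covering_number \<delta> E)) / (- ln \<delta>)))"

definition upper_box_dim :: "'a::metric_space set \<Rightarrow> ereal" where
  "upper_box_dim E =
     Limsup (at_right 0) (\<lambda>\<delta>. ereal (ln (real (covering_number \<delta> E)) / (- ln \<delta>)))"

section \<open>Affinity dimension\<close>

(* The squares of the singular values are the roots, with multiplicity, of the
   characteristic polynomial of A^T A. *)
definition is_singular_values :: "real^3^3 \<Rightarrow> real \<times> real \<times> real \<Rightarrow> bool" where
  "is_singular_values A = (\<lambda>(\<alpha>1, \<alpha>2, \<alpha>3). \<alpha>1 \<ge> \<alpha>2 \<and> \<alpha>2 \<ge> \<alpha>3 \<and> \<alpha>3 \<ge> 0 \<and>
     (\<forall>x. det (mat x - transpose A ** A) = (x - \<alpha>1\<^sup>2) * (x - \<alpha>2\<^sup>2) * (x - \<alpha>3\<^sup>2)))"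

definition singular_values :: "real^3^3 \<Rightarrow> real \<times> real \<times> real" where
  "singular_values A = (THE \<alpha>. is_singular_values A \<alpha>)"

definition singular_value_fun :: "real \<Rightarrow> real^3^3 \<Rightarrow> real" where
  "singular_value_fun t A = (case singular_values A of (\<alpha>1, \<alpha>2, \<alpha>3) \<Rightarrow>
     if t \<le> 1 then \<alpha>1 powr t
     else if t \<le> 2 then \<alpha>1 * \<alpha>2 powr (t - 1)
     else if t \<le> 3 then \<alpha>1 * \<alpha>2 * \<alpha>3 powr (t - 2)
     else (\<alpha>1 * \<alpha>2 * \<alpha>3) powr (t / 3))"

definition matrix_word :: "('i \<Rightarrow> real^'n^'n) \<Rightarrow> 'i list \<Rightarrow> real^'n^'n" where
  "matrix_word A w = foldr (\<lambda>i B. A i ** B) w (mat 1)"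

definition affinity_dim :: "'i set \<Rightarrow> ('i \<Rightarrow> real^3^3) \<Rightarrow> ereal" where
  "affinity_dim J A =
     (INF t\<in>{t. 0 \<le> t \<and> summable (\<lambda>n. \<Sum>w\<in>{w. length w = Suc n \<and> set w \<subseteq> J}.
                                      singular_value_fun t (matrix_word A w))}. ereal t)"

section \<open>Iterated function systems\<close>

definition is_attractor :: "'i set \<Rightarrow> ('i \<Rightarrow> 'a::topological_space \<Rightarrow> 'a) \<Rightarrow> 'a set \<Rightarrow> bool" where
  "is_attractor J f X \<longleftrightarrow> compact X \<and> X \<noteq> {} \<and> X = (\<Union>i\<in>J. f i ` X)"

(* The first letter of w is w 0. *)
definition natural_projection ::
    "('i \<Rightarrow> 'a::{t2_space,zero} \<Rightarrow> 'a) \<Rightarrow> (nat \<Rightarrow> 'i) \<Rightarrow> 'a" where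
  "natural_projection f w = lim (\<lambda>n. foldr f (map w [0..<n]) 0)"

definition bernoulli_measure :: "nat \<Rightarrow> (nat \<Rightarrow> real) \<Rightarrow> (nat \<Rightarrow> nat) measure" where
  "bernoulli_measure N p = (\<Pi>\<^sub>M n\<in>UNIV. point_measure {1..N} (\<lambda>i. ennreal (p i)))"

definition self_affine_measure ::
    "nat \<Rightarrow> (nat \<Rightarrow> real) \<Rightarrow> (nat \<Rightarrow> 'a::{t2_space,zero} \<Rightarrow> 'a) \<Rightarrow> 'a measure" where
  "self_affine_measure N p f = distr (bernoulli_measure N p) borel (natural_projection f)"

section \<open>Diagonally homogeneous TGL systems and their three-dimensional extensions\<close>

definition plane_mat :: "real \<Rightarrow> real \<Rightarrow> real \<Rightarrow> real^2^2" where
  "plane_mat a b d = vector [vector [b, 0], vector [d, a]]"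

definition plane_map ::
    "real \<Rightarrow> real \<Rightarrow> (nat \<Rightarrow> real) \<Rightarrow> (nat \<Rightarrow> real) \<Rightarrow> (nat \<Rightarrow> real) \<Rightarrow> nat \<Rightarrow> real^2 \<Rightarrow> real^2" where
  "plane_map a b d t1 t2 i x = plane_mat a b (d i) *v x + vector [t1 i, t2 i]"

definition space_mat :: "real \<Rightarrow> real \<Rightarrow> real \<Rightarrow> real \<Rightarrow> real \<Rightarrow> real \<Rightarrow> real^3^3" where
  "space_mat a b d u v l = vector [vector [b, 0, 0], vector [d, a, 0], vector [u, v, l]]"

definition space_map ::
    "real \<Rightarrow> real \<Rightarrow> (nat \<Rightarrow> real) \<Rightarrow> (nat \<Rightarrow> real) \<Rightarrow> (nat \<Rightarrow> real) \<Rightarrow> (nat \<Rightarrow> real) \<Rightarrow>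
     (nat \<Rightarrow> real) \<Rightarrow> (nat \<Rightarrow> real) \<Rightarrow> (nat \<Rightarrow> real) \<Rightarrow> nat \<Rightarrow> real^3 \<Rightarrow> real^3" where
  "space_map a b d u v l t1 t2 t3 i x =
     space_mat a b (d i) (u i) (v i) (l i) *v x + vector [t1 i, t2 i, t3 i]"

definition overlap_pairs :: "(nat \<Rightarrow> real^2 \<Rightarrow> real^2) \<Rightarrow> nat set \<Rightarrow> (nat \<times> nat) set" where
  "overlap_pairs f J = {(k, l). k \<in> J \<and> l \<in> J \<and> k \<noteq> l \<and>
     interior (f k ` cbox 0 1) \<inter> interior (f l ` cbox 0 1) \<noteq> {}}"

(* All index sets are finite, so the infima are minima; an infimum over the empty set
   is infinity in ereal. *)
definition d_star ::
    "nat \<Rightarrow> (nat \<Rightarrow> nat set) \<Rightarrow> (nat \<Rightarrow> real^2 \<Rightarrow> real^2) \<Rightarrow> (nat \<Rightarrow> real) \<Rightarrow> ereal" where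
  "d_star M \<I> f d =
     (INF m\<in>{m\<in>{1..M}. overlap_pairs f (\<I> m) \<noteq> {}}.
        INF (k, l)\<in>overlap_pairs f (\<I> m). ereal \<bar>d k - d l\<bar>)"

definition overlap_bound :: "real \<Rightarrow> ereal \<Rightarrow> real" where
  "overlap_bound b D =
     (if D = \<infinity> then b else b * real_of_ereal D / (2 + real_of_ereal D))"

(* \<I> m is the set of indices of the maps in column m, and c m the left endpoint of
   this column. *)
locale diag_homogeneous_TGL =
  fixes N M :: nat and \<I> :: "nat \<Rightarrow> nat set" and c :: "nat \<Rightarrow> real"
    and a b :: real and d t1 t2 :: "nat \<Rightarrow> real"
  assumes ab: "0 < a" "a < b" "b < 1"
    and translations_nonneg: "\<And>i. i \<in> {1..N} \<Longrightarrow> t1 i \<ge> 0 \<and> t2 i \<ge> 0"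
    and M_gt_1: "M > 1"
    and columns_cover: "(\<Union>m\<in>{1..M}. \<I> m) = {1..N}"
    and columns_nonempty: "\<And>m. m \<in> {1..M} \<Longrightarrow> \<I> m \<noteq> {}"
    and columns_consecutive:
      "\<And>m m' k l. m \<in> {1..M} \<Longrightarrow> m' \<in> {1..M} \<Longrightarrow> m < m' \<Longrightarrow> k \<in> \<I> m \<Longrightarrow> l \<in> \<I> m' \<Longrightarrow> k < l"
    and column_translation: "\<And>m k. m \<in> {1..M} \<Longrightarrow> k \<in> \<I> m \<Longrightarrow> t1 k = c m"
    and column_height: "\<And>m. m \<in> {1..M} \<Longrightarrow> a * real (card (\<I> m)) \<le> 1"
    and columns_nonoverlapping: "\<And>m. m \<in> {1..<M} \<Longrightarrow> c m + b \<le> c (Suc m)"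
    and last_column: "c M + b \<le> 1"
    and square_invariant: "\<And>i. i \<in> {1..N} \<Longrightarrow> plane_map a b d t1 t2 i ` cbox 0 1 \<subseteq> cbox 0 1"
    and min_fixed_point: "Min {x. \<exists>m\<in>{1..M}. b * x + c m = x} = 0"
    and max_fixed_point: "Max {x. \<exists>m\<in>{1..M}. b * x + c m = x} = 1"

definition uniform_vertical_fibres :: "nat \<Rightarrow> (nat \<Rightarrow> nat set) \<Rightarrow> bool" where
  "uniform_vertical_fibres M \<I> \<longleftrightarrow> (\<forall>m\<in>{1..M}. \<forall>m'\<in>{1..M}. card (\<I> m) = card (\<I> m'))"

end

theory Submission
  imports Defs
begin

text \<open>
Write \<open>K = N / M\<close> for the number of maps in a column and \<open>D = 1 + ln (N b) / (- ln a)\<close>.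
Since the columns tile the unit interval, \<open>b = 1 / M\<close> and \<open>N b = K\<close>, so that
\<open>a powr D = a / K\<close>; and the first half of the bound on \<open>a\<close> says exactly that \<open>a N < 1\<close>.

\<^bold>\<open>Upper bounds.\<close> The matrix of a word of length \<open>n\<close> is lower triangular, and because
\<open>\<bar>lam i\<bar> < a < b\<close> the entries of each column are at most of the order of its diagonal entry
(lemma \<open>shear_bounds\<close>). Hence its first singular value is comparable to \<open>b ^ n\<close>, the product of
the first two is comparable to \<open>(a b) ^ n\<close>, and the affinity dimension is \<open>D\<close>
(lemma \<open>affinity_dim_eq\<close>). The same bounds show that each of the \<open>N ^ n\<close> cylinders is covered by
about \<open>(b / a) ^ n\<close> sets of diameter comparable to \<open>a ^ n\<close>, which gives upper box dimension at most \<open>D\<close>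
(lemma \<open>attractor_covers\<close>). In between, Hausdorff dimension is at most lower box dimension, and the
dimension of the measure is at most that of the attractor, which carries it.

\<^bold>\<open>Lower bound.\<close> It remains to see that the uniform measure has dimension at least \<open>D\<close>, and this
can be read off from its projection to the plane. Partition the plane at level \<open>n\<close> into cells of width
\<open>b ^ p\<close>, comparable to \<open>a ^ n\<close>, and height \<open>a ^ n\<close>, and assign a code to a cell according
to its first \<open>p\<close> letters (definition \<open>cell\<close>). If two independent codes fall into the same cell with
probability \<open>O ((a powr D) ^ n)\<close>, then Markov's inequality, the Borel-Cantelli lemma and the mass
distribution principle bound the dimension from below
(lemma \<open>measure_hausdorff_dim_ge_correlation\<close>).

The probability is estimated by splitting two words with the same columns at the first place where
they differ. The image of the square under a word is a strip of vertical thickness \<open>a ^ n\<close> along the graph of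
an affine function over a column of width \<open>b ^ n\<close>. If the first letters differ, then either the two
first-level strips have disjoint interiors, and the bottoms of the two strips are at least \<open>a ^ n\<close> apart
everywhere; or they overlap, and the bound on \<open>a\<close> in terms of \<open>d\<^sub>*\<close> makes their
slopes differ by at least a positive constant, so that the strips meet only over a fraction of order
\<open>(a / b) ^ n\<close> of the column (lemma \<open>split_pair_disjoint_or_transversal\<close>).
A common first letter costs a factor \<open>1 / N\<close> and otherwise reproduces the problem one level down.
Summing over the length \<open>n - k\<close> of the common prefix produces the geometric series
\<open>\<Sum>k\<le>n. (a N) ^ k\<close>, and this converges because \<open>a N < 1\<close>
(lemmas \<open>close_count_bound_sum\<close> and \<open>same_cell_fraction\<close>).
\<close>

section \<open>Hausdorff dimension and box counting\<close>

text \<open>Hausdorff sums run over sequences, and a finite cover becomes one by appending empty sets, which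
contribute nothing.\<close>

lemma hausdorff_premeasure_le_finite_cover:
  fixes E :: "'a::metric_space set"
  assumes "finite C" "E \<subseteq> \<Union>C" "\<And>U. U \<in> C \<Longrightarrow> bounded U \<and> diameter U \<le> \<delta>"
    and "0 \<le> \<delta>" "\<delta> \<le> \<delta>0" "0 < t"
  shows "hausdorff_premeasure t \<delta>0 E \<le> ennreal (real (card C) * \<delta> powr t)"
proof -
  obtain e where e: "bij_betw e {..<card C} C"
    using ex_bij_betw_nat_finite[OF assms(1)] by (auto simp: atLeast0LessThan)
  define U where "U = (\<lambda>i. if i < card C then e i else {})"
  have eC: "e i \<in> C" if "i < card C" for i
    using e that by (auto simp: bij_betw_def)
  have cover: "E \<subseteq> (\<Union>i. U i)"
  proof
    fix x assume "x \<in> E"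
    then obtain V where V: "V \<in> C" "x \<in> V" using assms(2) by blast
    then obtain i where "i < card C" "e i = V"
      using e by (metis bij_betw_imp_surj_on imageE lessThan_iff)
    then show "x \<in> (\<Union>i. U i)" using V by (auto simp: U_def)
  qed
  have bd: "bounded (U i) \<and> diameter (U i) \<le> \<delta>0" for i
    using assms(3)[OF eC, of i] assms(4,5) by (auto simp: U_def)
  have "hausdorff_premeasure t \<delta>0 E \<le> (\<Sum>i. diam_pow t (U i))"
    unfolding hausdorff_premeasure_def using cover bd by (intro INF_lower) auto
  also have "\<dots> = (\<Sum>i<card C. diam_pow t (U i))"
    by (rule suminf_finite) (auto simp: U_def diam_pow_def)
  also have "\<dots> \<le> (\<Sum>i<card C. ennreal (\<delta> powr t))"
  proof (rule sum_mono)
    fix i assume "i \<in> {..<card C}"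
    then have "diameter (U i) \<le> \<delta>" "bounded (U i)" using assms(3)[OF eC, of i] by (auto simp: U_def)
    then show "diam_pow t (U i) \<le> ennreal (\<delta> powr t)"
      using \<open>0 < t\<close> diameter_ge_0[of "U i"]
      by (auto simp: diam_pow_def intro!: ennreal_leI powr_mono2)
  qed
  also have "\<dots> = ennreal (real (card C) * \<delta> powr t)"
    by (simp add: ennreal_mult ennreal_of_nat_eq_real_of_nat)
  finally show ?thesis .
qed

lemma covering_number_attained:
  fixes E :: "'a::metric_space set"
  assumes "finite C" "E \<subseteq> \<Union>C" "\<And>U. U \<in> C \<Longrightarrow> bounded U \<and> diameter U \<le> \<delta>"
  shows "\<exists>C. finite C \<and> card C = covering_number \<delta> E \<and> E \<subseteq> \<Union>C \<and> (\<forall>U\<in>C. bounded U \<and> diameter U \<le> \<delta>)"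
  unfolding covering_number_def by (rule LeastI_ex) (use assms in blast)

lemma covering_number_le:
  fixes E :: "'a::metric_space set"
  assumes "finite C" "E \<subseteq> \<Union>C" "\<And>U. U \<in> C \<Longrightarrow> bounded U \<and> diameter U \<le> \<delta>"
  shows "covering_number \<delta> E \<le> card C"
  unfolding covering_number_def by (rule Least_le) (use assms in blast)

lemma ln_nat_nonneg: "0 \<le> ln (real n)"
  by (cases n) auto

text \<open>If the box-counting quotient is below \<open>s\<close> at arbitrarily small scales \<open>\<delta>\<close>, then a cover by
\<open>\<delta> powr (- s)\<close> sets of diameter \<open>\<delta>\<close> has Hausdorff sum \<open>\<delta> powr (t - s)\<close> for the exponent
\<open>t > s\<close>, so the \<open>t\<close>-dimensional measure vanishes.\<close>

lemma hausdorff_dim_le_lower_box_dim: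
  fixes E :: "'a::metric_space set"
  assumes tb: "\<And>\<delta>. 0 < \<delta> \<Longrightarrow> \<exists>C. finite C \<and> E \<subseteq> \<Union>C \<and> (\<forall>U\<in>C. bounded U \<and> diameter U \<le> \<delta>)"
  shows "hausdorff_dim E \<le> lower_box_dim E"
proof (rule ccontr)
  let ?q = "\<lambda>\<delta>. ln (real (covering_number \<delta> E)) / (- ln \<delta>)"
  assume "\<not> ?thesis"
  then have "lower_box_dim E < hausdorff_dim E" by simp
  then obtain s where s: "lower_box_dim E < ereal s" "ereal s < hausdorff_dim E"
    using ereal_dense2 by blast
  obtain t where t: "ereal s < ereal t" "ereal t < hausdorff_dim E"
    using ereal_dense2[OF s(2)] by blast
  have st: "s < t" using t by simp
  have freq: "\<exists>\<^sub>F \<delta> in at_right 0. ?q \<delta> < s"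
  proof (rule ccontr)
    assume "\<not> (\<exists>\<^sub>F \<delta> in at_right 0. ?q \<delta> < s)"
    then have "\<forall>\<^sub>F \<delta> in at_right 0. ereal s \<le> ereal (?q \<delta>)"
      by (simp add: not_frequently not_less)
    then have "ereal s \<le> lower_box_dim E"
      unfolding lower_box_dim_def by (rule Liminf_bounded)
    then show False using s(1) by simp
  qed
  have small: "\<exists>\<delta>. P \<delta> \<and> ?q \<delta> < s" if "\<forall>\<^sub>F \<delta> in at_right 0. P \<delta>" for P
    using frequently_eventually_conj[OF freq that] frequently_ex by fastforce
  have ev01: "\<forall>\<^sub>F \<delta> in at_right (0::real). 0 < \<delta> \<and> \<delta> < 1"
    unfolding eventually_at_right_field by (intro exI[of _ 1]) auto
  have "0 < s"
  proof -
    obtain \<delta> where "0 < \<delta>" "\<delta> < 1" "?q \<delta> < s" using small[OF ev01] by blast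
    moreover have "0 \<le> ?q \<delta>" using \<open>0 < \<delta>\<close> \<open>\<delta> < 1\<close> ln_nat_nonneg
      by (intro divide_nonneg_nonneg) auto
    ultimately show ?thesis by linarith
  qed
  have pre0: "hausdorff_premeasure t \<delta>0 E \<le> ennreal \<epsilon>" if "0 < \<delta>0" "0 < \<epsilon>" for \<delta>0 \<epsilon>
  proof -
    \<comment> \<open>This is where \<open>\<delta> powr (t - s)\<close> falls below \<open>\<epsilon>\<close>.\<close>
    have ev: "\<forall>\<^sub>F \<delta> in at_right 0. \<delta> < \<epsilon> powr (1 / (t - s))"
      unfolding eventually_at_right_field using \<open>0 < \<epsilon>\<close>
      by (intro exI[of _ "\<epsilon> powr (1 / (t - s))"]) auto
    have ev': "\<forall>\<^sub>F \<delta> in at_right 0. \<delta> < \<delta>0"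
      unfolding eventually_at_right_field using \<open>0 < \<delta>0\<close> by (intro exI[of _ \<delta>0]) auto
    obtain \<delta> where d: "0 < \<delta>" "\<delta> < 1" "\<delta> < \<epsilon> powr (1 / (t - s))" "\<delta> < \<delta>0" "?q \<delta> < s"
      using small[OF eventually_conj[OF ev01 eventually_conj[OF ev ev']]] by blast
    have "\<delta> powr (t - s) < (\<epsilon> powr (1 / (t - s))) powr (t - s)"
      using d(1,3) st by (intro powr_less_mono2) auto
    then have d\<epsilon>: "\<delta> powr (t - s) < \<epsilon>" using st \<open>0 < \<epsilon>\<close> by (simp add: powr_powr)
    obtain C where C: "finite C" "card C = covering_number \<delta> E" "E \<subseteq> \<Union>C"
      "\<forall>U\<in>C. bounded U \<and> diameter U \<le> \<delta>"
    proof -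
      obtain C where "finite C" "E \<subseteq> \<Union>C" "\<forall>U\<in>C. bounded U \<and> diameter U \<le> \<delta>"
        using tb[OF d(1)] by blast
      from covering_number_attained[OF this(1,2) this(3)[rule_format]] show ?thesis using that by blast
    qed
    have "ln (real (card C)) \<le> s * (- ln \<delta>)"
      using d(1,2,5) C(2) pos_divide_less_eq[of "- ln \<delta>" "ln (real (card C))" s] by simp
    then have "real (card C) \<le> \<delta> powr (- s)"
      using d(1) exp_le_cancel_iff[of "ln (real (card C))" "- (s * ln \<delta>)"]
      by (cases "card C = 0") (simp_all add: powr_def)
    then have "real (card C) * \<delta> powr t \<le> \<delta> powr (- s) * \<delta> powr t"
      by (intro mult_right_mono) auto
    also have "\<dots> = \<delta> powr (t - s)" by (simp flip: powr_add)
    finally have "real (card C) * \<delta> powr t \<le> \<epsilon>" using d\<epsilon> by simp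
    moreover have "hausdorff_premeasure t \<delta>0 E \<le> ennreal (real (card C) * \<delta> powr t)"
      using C d st \<open>0 < s\<close> by (intro hausdorff_premeasure_le_finite_cover) auto
    ultimately show ?thesis by (meson ennreal_leI order_trans)
  qed
  have "hausdorff_premeasure t \<delta>0 E \<le> 0" if "0 < \<delta>0" for \<delta>0
    by (rule ennreal_le_epsilon) (use pre0[OF that] in simp)
  then have "hausdorff_measure t E = 0" unfolding hausdorff_measure_def by simp
  then have "hausdorff_dim E \<le> ereal t"
    unfolding hausdorff_dim_def using \<open>0 < s\<close> st by (intro INF_lower) auto
  then show False using t(2) by simp
qed

lemma lower_box_dim_le_upper_box_dim: "lower_box_dim E \<le> upper_box_dim E"
  unfolding lower_box_dim_def upper_box_dim_def by (rule Liminf_le_Limsup) simp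

text \<open>Covers along the geometric sequence of scales \<open>c * \<rho> ^ n\<close> suffice: passing to the next smaller such scale
changes the logarithm of the covering number by a bounded amount only, here collected in \<open>H\<close>.\<close>

lemma upper_box_dim_le_covers:
  fixes E :: "'a::metric_space set"
  assumes \<rho>: "0 < \<rho>" "\<rho> < 1" and R: "1 \<le> R" and A: "1 \<le> A" and c: "0 < c"
    and cov: "\<And>n. \<exists>C. finite C \<and> real (card C) \<le> A * R ^ n \<and> E \<subseteq> \<Union>C \<and>
                (\<forall>U\<in>C. bounded U \<and> diameter U \<le> c * \<rho> ^ n)"
  shows "upper_box_dim E \<le> ereal (ln R / (- ln \<rho>))"
proof -
  let ?D = "ln R / (- ln \<rho>)"
  define H where "H = ln A + (1 + \<bar>ln c\<bar> / (- ln \<rho>)) * ln R"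
  have ln\<rho>: "ln \<rho> < 0" using \<rho> by simp
  have bound: "ln (real (covering_number \<delta> E)) \<le> H + ?D * (- ln \<delta>)" if \<delta>: "0 < \<delta>" "\<delta> < 1" for \<delta>
  proof -
    \<comment> \<open>The first level whose scale \<open>c * \<rho> ^ n\<close> is at most \<open>\<delta>\<close>.\<close>
    define n where "n = nat \<lceil>(ln c - ln \<delta>) / (- ln \<rho>)\<rceil>"
    have n1: "(ln c - ln \<delta>) / (- ln \<rho>) \<le> real n" unfolding n_def by linarith
    have "ln c - ln \<delta> \<le> real n * (- ln \<rho>)"
      using n1 ln\<rho> pos_divide_le_eq[of "- ln \<rho>" "ln c - ln \<delta>" "real n"] by linarith
    then have "ln (c * \<rho> ^ n) \<le> ln \<delta>" using c \<rho> by (simp add: ln_mult ln_realpow)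
    then have n2: "c * \<rho> ^ n \<le> \<delta>" using c \<rho> \<delta> by simp
    have "(ln c - ln \<delta>) / (- ln \<rho>) \<le> (\<bar>ln c\<bar> - ln \<delta>) / (- ln \<rho>)"
      using ln\<rho> by (intro divide_right_mono) auto
    moreover have "ln \<delta> \<le> 0" using \<delta> by simp
    then have "0 \<le> (\<bar>ln c\<bar> - ln \<delta>) / (- ln \<rho>)" using ln\<rho> by (intro divide_nonneg_nonneg) auto
    ultimately have n3: "real n \<le> 1 + (\<bar>ln c\<bar> - ln \<delta>) / (- ln \<rho>)" unfolding n_def by linarith
    obtain C where C: "finite C" "real (card C) \<le> A * R ^ n" "E \<subseteq> \<Union>C"
       "\<forall>U\<in>C. bounded U \<and> diameter U \<le> c * \<rho> ^ n" using cov by blast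
    have "covering_number \<delta> E \<le> card C"
      using C n2 by (intro covering_number_le) force+
    then have le: "real (covering_number \<delta> E) \<le> A * R ^ n" using C(2) by linarith
    have "ln (real (covering_number \<delta> E)) \<le> ln (A * R ^ n)"
    proof (cases "covering_number \<delta> E = 0")
      case True
      have "1 * 1 \<le> A * R ^ n" using A R by (intro mult_mono one_le_power) auto
      then show ?thesis using True by simp
    next
      case False
      have "0 < A * R ^ n" using A R by (intro mult_pos_pos) auto
      then show ?thesis using le False by simp
    qed
    also have "\<dots> = ln A + real n * ln R" using A R by (simp add: ln_mult ln_realpow)
    also have "\<dots> \<le> ln A + (1 + (\<bar>ln c\<bar> - ln \<delta>) / (- ln \<rho>)) * ln R"
      using n3 R by (intro add_left_mono mult_right_mono) auto
    also have "\<dots> = H + ?D * (- ln \<delta>)" using ln\<rho> unfolding H_def by (simp add: field_simps)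
    finally show ?thesis .
  qed
  have ev01: "\<forall>\<^sub>F \<delta> in at_right (0::real). 0 < \<delta> \<and> \<delta> < 1"
    unfolding eventually_at_right_field by (intro exI[of _ 1]) auto
  have "upper_box_dim E \<le> Limsup (at_right 0) (\<lambda>\<delta>. ereal (H / (- ln \<delta>) + ?D))"
    unfolding upper_box_dim_def
  proof (rule Limsup_mono, rule eventually_mono[OF ev01])
    fix \<delta> :: real assume d: "0 < \<delta> \<and> \<delta> < 1"
    then have "ln \<delta> < 0" by simp
    have "ln (real (covering_number \<delta> E)) / (- ln \<delta>) \<le> (H + ?D * (- ln \<delta>)) / (- ln \<delta>)"
      using bound[of \<delta>] d \<open>ln \<delta> < 0\<close> by (intro divide_right_mono) auto
    also have "\<dots> = H / (- ln \<delta>) + ?D" using \<open>ln \<delta> < 0\<close> by (simp add: add_divide_distrib)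
    finally show "ereal (ln (real (covering_number \<delta> E)) / (- ln \<delta>)) \<le> ereal (H / (- ln \<delta>) + ?D)"
      by simp
  qed
  also have "\<dots> = ereal ?D"
  proof (rule lim_imp_Limsup)
    have "((\<lambda>\<delta>. H / (- ln \<delta>)) \<longlongrightarrow> 0) (at_right 0)"
      by (intro tendsto_divide_0[OF tendsto_const] filterlim_at_top_imp_at_infinity
          filterlim_uminus_at_bot[THEN iffD1] ln_at_0)
    from tendsto_add[OF this tendsto_const[of ?D]]
    show "((\<lambda>\<delta>. ereal (H / (- ln \<delta>) + ?D)) \<longlongrightarrow> ereal ?D) (at_right 0)" by simp
  qed simp
  finally show ?thesis .
qed

section \<open>Lower bound for the dimension of a measure\<close>

text \<open>A correlation estimate bounds the lower Hausdorff dimension of a measure. The integral in \<open>corr\<close> is the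
probability that two independent points share a cell of level \<open>n\<close>, that is, the sum of the squares of the
masses of the cells. By Markov's inequality, points in cells heavier than \<open>\<rho> powr (t * n)\<close>, for some
\<open>t < D\<close>, have summable probability, so by the Borel-Cantelli lemma a set of positive measure lies in light cells from
some level \<open>k\<close> on. Since a set of diameter \<open>\<rho> ^ n\<close> meets at most \<open>B\<close> cells, its intersection
with those points has mass at most \<open>B * \<rho> powr (t * n)\<close>, and the mass distribution principle applies.\<close>

lemma measure_hausdorff_dim_ge_correlation:
  fixes \<pi> :: "'w \<Rightarrow> 'a::metric_space" and g :: "nat \<Rightarrow> 'w \<Rightarrow> 'c::countable"
  assumes P: "prob_space P" and meas: "\<pi> \<in> measurable P borel"
    and gm: "\<And>n. g n \<in> measurable P (count_space UNIV)"
    and \<rho>: "0 < \<rho>" "\<rho> < 1"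
    and corr: "\<And>n. (\<integral>\<omega>. measure P {\<omega>' \<in> space P. g n \<omega>' = g n \<omega>} \<partial>P) \<le> C * (\<rho> powr D) ^ n"
    and few: "\<And>n U. bounded U \<Longrightarrow> diameter U \<le> \<rho> ^ n \<Longrightarrow>
        finite (g n ` (\<pi> -` U \<inter> space P)) \<and> card (g n ` (\<pi> -` U \<inter> space P)) \<le> B"
  shows "ereal D \<le> measure_hausdorff_dim (distr P borel \<pi>)"
proof -
  interpret prob_space P by fact
  define h where "h n \<omega> = prob {\<omega>' \<in> space P. g n \<omega>' = g n \<omega>}" for n \<omega>
  have hm: "h n \<in> borel_measurable P" for n
  proof -
    have "(\<lambda>c. prob {\<omega>' \<in> space P. g n \<omega>' = c}) \<circ> g n \<in> borel_measurable P"
      by (rule measurable_comp[OF gm]) simp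
    then show ?thesis by (simp add: h_def[abs_def] comp_def)
  qed
  have h01: "0 \<le> h n \<omega>" "h n \<omega> \<le> 1" for n \<omega> by (auto simp: h_def)
  have hint: "integrable P (h n)" for n
    by (rule integrable_const_bound[of _ 1]) (use hm h01 in auto)
  have "ereal D \<le> ereal s"
    if E: "E \<in> sets borel" "emeasure (distr P borel \<pi>) E > 0"
      and s: "0 \<le> s" "hausdorff_measure s E = 0" for E s
  proof (rule ccontr)
    assume "\<not> ereal D \<le> ereal s"
    then have sD: "s < D" by simp
    define t where "t = (s + D) / 2"
    have t: "s < t" "t < D" "0 < t" using sD s unfolding t_def by auto
    define r where "r = \<rho> powr t"
    have r: "0 < r" "r < 1"
      using \<rho> t powr_less_mono2[of t \<rho> 1] by (auto simp: r_def)
    have rn: "r ^ n = (\<rho> ^ n) powr t" for n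
      using \<rho> by (simp add: r_def powr_powr powr_realpow[symmetric] mult.commute)
    define Bad where "Bad n = {\<omega> \<in> space P. r ^ n \<le> h n \<omega>}" for n
    have Bad_sets: "Bad n \<in> sets P" for n unfolding Bad_def using hm by measurable
    define q where "q = \<rho> powr (D - t)"
    have q: "0 < q" "q < 1" using \<rho> t powr_less_mono2[of "D - t" \<rho> 1] by (auto simp: q_def)
    have qr: "\<rho> powr D = q * r" using \<rho> by (simp add: q_def r_def flip: powr_add)
    have Bad_le: "prob (Bad n) \<le> C * q ^ n" for n
    proof -
      have "prob (Bad n) \<le> (\<integral>\<omega>. h n \<omega> \<partial>P) / r ^ n"
        unfolding Bad_def
        using integral_Markov_inequality_measure[OF hint[of n], where A = "space P" and c = "r ^ n"] h01 r by simp
      also have "\<dots> \<le> C * (\<rho> powr D) ^ n / r ^ n"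
        using corr[of n] r by (intro divide_right_mono) (auto simp: h_def)
      also have "\<dots> = C * q ^ n" using r by (simp add: qr power_mult_distrib)
      finally show ?thesis .
    qed
    have "summable (\<lambda>n. prob (Bad n))"
    proof (rule summable_comparison_test')
      show "summable (\<lambda>n. C * q ^ n)" using q by (intro summable_mult summable_geometric) auto
      show "norm (prob (Bad n)) \<le> C * q ^ n" if "n \<ge> 0" for n using Bad_le by simp
    qed
    then have AEgood: "AE \<omega> in P. \<forall>\<^sub>F n in sequentially. \<omega> \<in> space P - Bad n"
      using Bad_sets by (intro borel_cantelli_AE1) (auto simp: less_top[symmetric])
    define A where "A = \<pi> -` E \<inter> space P"
    have Asets: "A \<in> sets P" using meas E unfolding A_def by measurable
    have Apos: "emeasure P A > 0" using E meas by (simp add: emeasure_distr A_def)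
    define G where "G k = A \<inter> (\<Inter>n\<in>{k..}. space P - Bad n)" for k
    have Gsets: "G k \<in> sets P" for k
      unfolding G_def using Asets Bad_sets by (intro sets.Int sets.countable_INT') auto
    obtain k where k: "emeasure P (G k) > 0"
    proof (rule ccontr)
      assume "\<not> thesis"
      then have "emeasure P (G k) = 0" for k using that by (metis not_gr_zero)
      then have "(\<Union>k. G k) \<in> null_sets P" using Gsets by (intro null_sets_UN) auto
      then have "AE \<omega> in P. \<omega> \<notin> (\<Union>k. G k)" by (rule AE_not_in)
      with AEgood have "AE \<omega> in P. \<omega> \<notin> A"
      proof eventually_elim
        case (elim \<omega>)
        then obtain k where "\<forall>n\<ge>k. \<omega> \<in> space P - Bad n" by (auto simp: eventually_sequentially)
        then show ?case using elim(2) by (auto simp: G_def)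
      qed
      then have "A \<in> null_sets P" using Asets AE_iff_null_sets by blast
      then show False using Apos by auto
    qed
    have cell: "prob (G k \<inter> \<pi> -` V) \<le> real B * r ^ n"
      if V: "bounded V" "diameter V \<le> \<rho> ^ n" "V \<in> sets borel" and n: "k \<le> n" for V n
    proof -
      let ?I = "g n ` (\<pi> -` V \<inter> space P \<inter> G k)"
      let ?I' = "g n ` (\<pi> -` V \<inter> space P)"
      have fin: "finite ?I" "card ?I \<le> B"
      proof -
        have "?I \<subseteq> ?I'" by auto
        then show "finite ?I" using few[OF V(1,2)] finite_subset by blast
        have "card ?I \<le> card ?I'" using few[OF V(1,2)] \<open>?I \<subseteq> ?I'\<close> by (intro card_mono) auto
        then show "card ?I \<le> B" using few[OF V(1,2)] by simp
      qed
      have cs: "{\<omega>' \<in> space P. g n \<omega>' = c} \<in> sets P" for c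
      proof -
        have "g n -` {c} \<inter> space P \<in> sets P" using measurable_sets[OF gm, of "{c}"] by simp
        moreover have "g n -` {c} \<inter> space P = {\<omega>' \<in> space P. g n \<omega>' = c}" by auto
        ultimately show ?thesis by simp
      qed
      have "prob (G k \<inter> \<pi> -` V) \<le> prob (\<Union>c\<in>?I. {\<omega>' \<in> space P. g n \<omega>' = c})"
        using cs fin by (intro finite_measure_mono sets.finite_UN) (auto simp: G_def A_def)
      also have "\<dots> \<le> (\<Sum>c\<in>?I. prob {\<omega>' \<in> space P. g n \<omega>' = c})"
        using cs fin by (intro finite_measure_subadditive_finite) auto
      also have "\<dots> \<le> (\<Sum>c\<in>?I. r ^ n)"
      proof (rule sum_mono)
        fix c assume "c \<in> ?I"
        then obtain \<omega> where w: "\<omega> \<in> G k" "c = g n \<omega>" "\<omega> \<in> space P" by auto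
        then have "\<omega> \<notin> Bad n" using n by (auto simp: G_def)
        then show "prob {\<omega>' \<in> space P. g n \<omega>' = c} \<le> r ^ n" using w by (simp add: Bad_def h_def)
      qed
      also have "\<dots> = real (card ?I) * r ^ n" by simp
      also have "\<dots> \<le> real B * r ^ n" using fin r by (intro mult_right_mono) auto
      finally show ?thesis .
    qed
    \<comment> \<open>The factor \<open>1 / r\<close> compensates the passage to the next scale \<open>\<rho> ^ n\<close>, and 1 is added for positivity.\<close>
    define K where "K = real B / r + 1"
    have K: "K > 0" using r by (simp add: K_def add_nonneg_pos)
    \<comment> \<open>Passing to the closure keeps the diameter and makes the set measurable.\<close>
    have frost: "emeasure P (G k \<inter> \<pi> -` closure U) \<le> ennreal K * diam_pow s U"
      if U: "bounded U" "diameter U \<le> \<rho> ^ k" for U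
    proof (cases "U = {}")
      case False
      let ?V = "closure U" and ?\<delta> = "diameter U"
      have V: "bounded ?V" "diameter ?V = ?\<delta>" "?V \<in> sets borel"
        using U by (auto simp: diameter_closure)
      have d0: "0 \<le> ?\<delta>" using U by (simp add: diameter_ge_0)
      have d1: "?\<delta> \<le> 1" using U(2) \<rho> power_le_one[of \<rho> k] by linarith
      have "prob (G k \<inter> \<pi> -` ?V) \<le> K * ?\<delta> powr t"
      proof (cases "?\<delta> = 0")
        case True
        have "prob (G k \<inter> \<pi> -` ?V) \<le> 0"
        proof (rule tendsto_lowerbound)
          show "(\<lambda>n. real B * r ^ n) \<longlonglongrightarrow> 0"
            using tendsto_mult_right_zero[OF LIMSEQ_power_zero[of r]] r by simp
          show "\<forall>\<^sub>F n in sequentially. prob (G k \<inter> \<pi> -` ?V) \<le> real B * r ^ n"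
            unfolding eventually_sequentially
            using cell[OF V(1) _ V(3)] V(2) True \<rho> by (intro exI[of _ k]) auto
        qed simp
        then show ?thesis using True by simp
      next
        case False
        then have "0 < ?\<delta>" using d0 by simp
        then obtain m where "\<rho> ^ m < ?\<delta>" using \<rho> real_arch_pow_inv by blast
        \<comment> \<open>The level \<open>m - 1\<close> is the finest one whose scale still bounds the diameter.\<close>
        define m where "m = (LEAST m. \<rho> ^ m < ?\<delta>)"
        have m: "\<rho> ^ m < ?\<delta>" unfolding m_def by (rule LeastI) fact
        have "m > k"
        proof (rule ccontr)
          assume "\<not> m > k"
          then have "\<rho> ^ k \<le> \<rho> ^ m" using \<rho> by (intro power_decreasing) auto
          then show False using m U by simp
        qed
        then obtain n where n: "m = Suc n" "k \<le> n" by (metis less_imp_Suc_add le_add1)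
        have "\<not> \<rho> ^ n < ?\<delta>" using not_less_Least[of n "\<lambda>m. \<rho> ^ m < ?\<delta>"] n m_def by simp
        then have "prob (G k \<inter> \<pi> -` ?V) \<le> real B * r ^ n" using cell[OF V(1) _ V(3)] V(2) n by simp
        also have "\<dots> = real B / r * (\<rho> ^ m) powr t" unfolding rn[symmetric] n using r by simp
        also have "\<dots> \<le> real B / r * ?\<delta> powr t"
          using m \<rho> t r by (intro mult_left_mono powr_mono2) auto
        also have "\<dots> \<le> K * ?\<delta> powr t" by (intro mult_right_mono) (auto simp: K_def)
        finally show ?thesis .
      qed
      then have "emeasure P (G k \<inter> \<pi> -` ?V) \<le> ennreal (K * ?\<delta> powr t)"
        by (simp add: emeasure_eq_measure ennreal_leI)
      also have "\<dots> = ennreal K * ennreal (?\<delta> powr t)" using K by (simp add: ennreal_mult)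
      also have "\<dots> \<le> ennreal K * diam_pow s U"
      proof (rule mult_left_mono)
        show "ennreal (?\<delta> powr t) \<le> diam_pow s U"
        proof (cases "s = 0")
          case True
          have "?\<delta> powr t \<le> 1" using d0 d1 t powr_mono2[of t ?\<delta> 1] by simp
          then show ?thesis using True False by (simp add: diam_pow_def)
        next
          case False
          have "?\<delta> powr t \<le> ?\<delta> powr s" using d0 d1 t by (cases "?\<delta> = 0") (auto intro: powr_mono')
          then show ?thesis using False \<open>U \<noteq> {}\<close> by (simp add: diam_pow_def ennreal_leI)
        qed
      qed simp
      finally show ?thesis .
    qed (simp add: diam_pow_def)
    have "hausdorff_premeasure s (\<rho> ^ k) E \<le> hausdorff_measure s E"
      unfolding hausdorff_measure_def using \<rho> by (intro SUP_upper) auto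
    then have pre: "hausdorff_premeasure s (\<rho> ^ k) E = 0" using s by simp
    define p where "p = prob (G k)"
    have p: "p > 0" using k by (simp add: p_def emeasure_eq_measure)
    have "hausdorff_premeasure s (\<rho> ^ k) E < ennreal (p / (2 * K))" using pre p K by simp
    then obtain U :: "nat \<Rightarrow> 'a set" where U: "E \<subseteq> (\<Union>i. U i)" "\<And>i. bounded (U i) \<and> diameter (U i) \<le> \<rho> ^ k"
      "(\<Sum>i. diam_pow s (U i)) < ennreal (p / (2 * K))"
      unfolding hausdorff_premeasure_def INF_less_iff by blast
    have Vs: "G k \<inter> \<pi> -` closure (U i) \<in> sets P" for i
    proof -
      have "\<pi> -` closure (U i) \<inter> space P \<in> sets P" using meas by measurable
      then have "G k \<inter> (\<pi> -` closure (U i) \<inter> space P) \<in> sets P" using Gsets by blast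
      moreover have "G k \<inter> (\<pi> -` closure (U i) \<inter> space P) = G k \<inter> \<pi> -` closure (U i)"
        using sets.sets_into_space[OF Gsets[of k]] by auto
      ultimately show ?thesis by simp
    qed
    have "G k \<subseteq> (\<Union>i. G k \<inter> \<pi> -` closure (U i))"
    proof
      fix \<omega> assume w: "\<omega> \<in> G k"
      then have "\<pi> \<omega> \<in> E" by (auto simp: G_def A_def)
      then obtain i where "\<pi> \<omega> \<in> U i" using U(1) by blast
      then have "\<pi> \<omega> \<in> closure (U i)" using closure_subset by blast
      then show "\<omega> \<in> (\<Union>i. G k \<inter> \<pi> -` closure (U i))" using w by blast
    qed
    then have "emeasure P (G k) \<le> emeasure P (\<Union>i. G k \<inter> \<pi> -` closure (U i))"
      using Vs by (intro emeasure_mono sets.countable_UN) auto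
    also have "\<dots> \<le> (\<Sum>i. emeasure P (G k \<inter> \<pi> -` closure (U i)))"
      using Vs by (intro emeasure_subadditive_countably) auto
    also have "\<dots> \<le> (\<Sum>i. ennreal K * diam_pow s (U i))"
      using U(2) frost by (intro suminf_le) auto
    also have "\<dots> = ennreal K * (\<Sum>i. diam_pow s (U i))" by simp
    also have "\<dots> \<le> ennreal K * ennreal (p / (2 * K))"
      using U(3) by (intro mult_left_mono) auto
    also have "\<dots> = ennreal (p / 2)" using K p by (simp flip: ennreal_mult)
    finally show False using p by (simp add: p_def emeasure_eq_measure)
  qed
  then show ?thesis
    unfolding measure_hausdorff_dim_def hausdorff_dim_def
    by (intro INF_greatest) auto
qed

section \<open>Singular values of three-by-three matrices\<close>

definition minor2 :: "real^3^3 \<Rightarrow> 3 \<Rightarrow> 3 \<Rightarrow> 3 \<Rightarrow> 3 \<Rightarrow> real" where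
  "minor2 A i j k l = A$i$k * A$j$l - A$i$l * A$j$k"

definition sum_sq_entries :: "real^3^3 \<Rightarrow> real" where
  "sum_sq_entries A = (\<Sum>i\<in>UNIV. \<Sum>j\<in>UNIV. (A$i$j)\<^sup>2)"

text \<open>The sum of the squares of all entries of the second compound matrix; by the Cauchy-Binet formula this is the second
coefficient of the characteristic polynomial of \<open>transpose A ** A\<close>.\<close>

definition sum_sq_minors :: "real^3^3 \<Rightarrow> real" where
  "sum_sq_minors A = (\<Sum>(i, j)\<in>{(1,2),(1,3),(2,3)}. \<Sum>(k, l)\<in>{(1,2),(1,3),(2,3)}. (minor2 A i j k l)\<^sup>2)"

lemma charpoly3:
  fixes S :: "'a::comm_ring_1^3^3"
  shows "det (mat x - S) = x^3 - (S$1$1 + S$2$2 + S$3$3) * x^2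
     + (S$1$1 * S$2$2 - S$1$2 * S$2$1 + S$1$1 * S$3$3 - S$1$3 * S$3$1 + S$2$2 * S$3$3 - S$2$3 * S$3$2) * x
     - det S"
  unfolding det_3 by (simp add: mat_def power2_eq_square power3_eq_cube algebra_simps)

lemma charpoly_gram:
  fixes A :: "real^3^3"
  shows "det (mat x - transpose A ** A)
    = x^3 - sum_sq_entries A * x^2 + sum_sq_minors A * x - (det A)\<^sup>2"
proof -
  have 1: "det (transpose A ** A) = (det A)\<^sup>2"
    by (simp add: det_mul power2_eq_square)
  let ?S = "transpose A ** A"
  have e: "?S$i$j = A$1$i * A$1$j + A$2$i * A$2$j + A$3$i * A$3$j" for i j
    by (simp add: matrix_matrix_mult_def transpose_def sum_3)
  have 2: "?S$1$1 + ?S$2$2 + ?S$3$3 = sum_sq_entries A"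
    unfolding e by (simp add: sum_sq_entries_def sum_3 power2_eq_square)
  have 3: "?S$1$1 * ?S$2$2 - ?S$1$2 * ?S$2$1 + ?S$1$1 * ?S$3$3 - ?S$1$3 * ?S$3$1
      + ?S$2$2 * ?S$3$3 - ?S$2$3 * ?S$3$2 = sum_sq_minors A"
    unfolding e by (simp add: sum_sq_minors_def minor2_def power2_eq_square algebra_simps)
  show ?thesis unfolding charpoly3 1 2 3 ..
qed

text \<open>For a complex eigenvector \<open>x + \<i> y\<close>, symmetry makes \<open>(S x) \<bullet> y = x \<bullet> (S y)\<close>, in which everything
cancels except the imaginary part of the eigenvalue times \<open>x \<bullet> x + y \<bullet> y\<close>.\<close>

lemma symmetric_eigenvalue_real:
  fixes S :: "real^3^3"
  assumes sym: "transpose S = S"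
    and root: "det (mat z - (\<chi> i j. complex_of_real (S$i$j))) = 0"
  shows "Im z = 0"
proof -
  let ?T = "mat z - (\<chi> i j. complex_of_real (S$i$j))"
  have "\<not> invertible ?T" using root by (simp add: invertible_det_nz)
  then obtain v where v: "?T *v v = 0" "v \<noteq> 0"
    by (auto simp: invertible_left_inverse matrix_left_invertible_ker)
  define x where "x = (\<chi> i. Re (v$i))"
  define y where "y = (\<chi> i. Im (v$i))"
  have comp: "(\<Sum>j\<in>UNIV. complex_of_real (S$i$j) * v$j) = z * v$i" for i
  proof -
    have "(?T *v v)$i = 0" using v by simp
    then have "z * v$i - (\<Sum>j\<in>UNIV. complex_of_real (S$i$j) * v$j) = 0"
      by (simp add: matrix_vector_mult_def mat_def left_diff_distrib sum_subtractf if_distrib[of "\<lambda>x. x * _"]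
          cong: if_cong)
    then show ?thesis by simp
  qed
  have Sx: "(S *v x)$i = Re z * x$i - Im z * y$i" for i
    using arg_cong[OF comp[of i], of Re] by (simp add: matrix_vector_mult_def x_def y_def)
  have Sy: "(S *v y)$i = Re z * y$i + Im z * x$i" for i
    using arg_cong[OF comp[of i], of Im] by (simp add: matrix_vector_mult_def x_def y_def)
  have "(S *v x) \<bullet> y = x \<bullet> (S *v y)"
    using dot_lmul_matrix[of x S y] sym by (metis transpose_matrix_vector)
  then have "Im z * (x \<bullet> x + y \<bullet> y) = 0"
    by (simp add: inner_vec_def Sx Sy sum_3 algebra_simps)
  moreover have "x \<bullet> x + y \<bullet> y \<noteq> 0"
  proof
    assume "x \<bullet> x + y \<bullet> y = 0"
    then have "x = 0" "y = 0"
      by (metis add_nonneg_eq_0_iff inner_eq_zero_iff inner_ge_zero)+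
    then have "v$i = 0" for i
    proof -
      have "x$i = 0" "y$i = 0" using \<open>x = 0\<close> \<open>y = 0\<close> by simp_all
      then show ?thesis by (simp add: x_def y_def complex_eq_iff)
    qed
    then show False using v by (simp add: vec_eq_iff)
  qed
  ultimately show ?thesis by simp
qed

lemma sum_sq_nonneg: "0 \<le> sum_sq_entries A" "0 \<le> sum_sq_minors A"
  unfolding sum_sq_entries_def sum_sq_minors_def by (auto intro!: sum_nonneg)

text \<open>The cubic has a real root by the intermediate value theorem. The remaining quadratic factor cannot have a negative
discriminant, since its non-real root would be an eigenvalue of a symmetric matrix. No root is negative, because
the coefficients alternate in sign.\<close>

lemma gram_charpoly_splits:
  fixes A :: "real^3^3"
  shows "\<exists>p q r. p \<ge> q \<and> q \<ge> r \<and> r \<ge> 0 \<and>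
    (\<forall>x. det (mat x - transpose A ** A) = (x - p) * (x - q) * (x - r))"
proof -
  define e1 e2 e3 where "e1 = sum_sq_entries A" and "e2 = sum_sq_minors A" and "e3 = (det A)\<^sup>2"
  define f where "f x = x^3 - e1 * x^2 + e2 * x - e3" for x :: real
  have f: "det (mat x - transpose A ** A) = f x" for x
    by (simp add: charpoly_gram f_def e1_def e2_def e3_def)
  have e: "0 \<le> e1" "0 \<le> e2" "0 \<le> e3" using sum_sq_nonneg by (auto simp: e1_def e2_def e3_def)
  have root_nonneg: "0 \<le> x" if "f x = 0" for x
  proof (rule ccontr)
    assume "\<not> 0 \<le> x"
    then have "x < 0" by simp
    then have "x^3 < 0" "e1 * x^2 \<ge> 0" "e2 * x \<le> 0" using e by (auto simp: mult_nonneg_nonpos)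
    then show False using that e unfolding f_def by linarith
  qed
  obtain r where r: "f r = 0"
  proof -
    \<comment> \<open>Here \<open>f ?X\<close> is at least \<open>?X\<^sup>2 * (1 + e3) - e3\<close>, which is positive.\<close>
    let ?X = "1 + e1 + e3"
    have "?X^2 \<ge> 1" using e by simp
    then have "?X^2 * (1 + e3) \<ge> 1 + e3" using e mult_right_mono[of 1 "?X^2" "1 + e3"] by simp
    moreover have "f ?X = ?X^2 * (1 + e3) + e2 * ?X - e3"
      by (simp add: f_def power2_eq_square power3_eq_cube algebra_simps)
    moreover have "e2 * ?X \<ge> 0" using e by simp
    moreover have "0 \<le> y + w - e3" if "1 + e3 \<le> y" "0 \<le> w" for y w :: real
      using that by linarith
    ultimately have "0 \<le> f ?X" by metis
    moreover have "f 0 \<le> 0" using e by (simp add: f_def)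
    moreover have "continuous_on {0..?X} f" unfolding f_def by (intro continuous_intros)
    ultimately show ?thesis using IVT'[of f 0 0 ?X] e that by auto
  qed
  define s where "s = e1 - r"
  define q where "q = e2 - r * s"
  have e3: "e3 = r * q" using r by (simp add: f_def s_def q_def power2_eq_square power3_eq_cube algebra_simps)
  have fac: "f x = (x - r) * (x^2 - s * x + q)" for x
    unfolding f_def e3 by (simp add: s_def q_def power2_eq_square power3_eq_cube algebra_simps)
  have disc: "0 \<le> s^2 - 4 * q"
  proof (rule ccontr)
    assume neg: "\<not> 0 \<le> s^2 - 4 * q"
    define z where "z = Complex (s / 2) (sqrt (4 * q - s^2) / 2)"
    have z: "z^2 - of_real s * z + of_real q = 0"
    proof -
      have "(sqrt (4 * q - s^2))^2 = 4 * q - s^2" using neg by simp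
      then show ?thesis
        by (simp add: z_def complex_eq_iff power2_eq_square field_simps)
    qed
    have "det (mat z - (\<chi> i j. complex_of_real ((transpose A ** A)$i$j)))
        = z^3 - of_real e1 * z^2 + of_real e2 * z - of_real e3"
    proof -
      let ?S = "transpose A ** A" and ?C = "\<chi> i j. complex_of_real ((transpose A ** A)$i$j)"
      have eq: "x^3 - (?S$1$1 + ?S$2$2 + ?S$3$3) * x^2
     + (?S$1$1 * ?S$2$2 - ?S$1$2 * ?S$2$1 + ?S$1$1 * ?S$3$3 - ?S$1$3 * ?S$3$1 + ?S$2$2 * ?S$3$3 - ?S$2$3 * ?S$3$2) * x
     - det ?S = x^3 - e1 * x^2 + e2 * x - e3" for x
        using f[of x] unfolding charpoly3 f_def .
      have d: "det ?S = e3" using eq[of 0] by simp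
      have t: "?S$1$1 + ?S$2$2 + ?S$3$3 = e1"
        using eq[of 1] eq[of "-1"] d by simp
      have m: "?S$1$1 * ?S$2$2 - ?S$1$2 * ?S$2$1 + ?S$1$1 * ?S$3$3 - ?S$1$3 * ?S$3$1 + ?S$2$2 * ?S$3$3 - ?S$2$3 * ?S$3$2 = e2"
        using eq[of 1] t d by simp
      have "det ?C = of_real (det ?S)" unfolding det_3 by simp
      then show ?thesis
        unfolding charpoly3 d[symmetric] t[symmetric] m[symmetric] by simp
    qed
    also have "\<dots> = (z - of_real r) * (z^2 - of_real s * z + of_real q)"
      unfolding e3 by (simp add: s_def q_def power2_eq_square power3_eq_cube algebra_simps)
    also have "\<dots> = 0" using z by simp
    finally have "Im z = 0"
      by (intro symmetric_eigenvalue_real[of "transpose A ** A"]) (auto simp: matrix_transpose_mul)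
    then show False using neg by (simp add: z_def)
  qed
  define x1 where "x1 = (s + sqrt (s^2 - 4 * q)) / 2"
  define x2 where "x2 = (s - sqrt (s^2 - 4 * q)) / 2"
  have "(sqrt (s^2 - 4 * q))^2 = s^2 - 4 * q" using disc by simp
  then have quad: "x^2 - s * x + q = (x - x1) * (x - x2)" for x
    by (simp add: x1_def x2_def power2_eq_square field_simps)
  have x12: "x1 \<ge> x2" using disc by (simp add: x1_def x2_def)
  have f3: "f x = (x - r) * (x - x1) * (x - x2)" for x unfolding fac quad by simp
  have "0 \<le> r" "0 \<le> x1" "0 \<le> x2" using root_nonneg f3 by auto
  consider "r \<ge> x1" | "x1 \<ge> r" "r \<ge> x2" | "x2 \<ge> r" by linarith
  then show ?thesis
  proof cases
    case 1 then show ?thesis unfolding f f3 using x12 \<open>0 \<le> x2\<close> by blast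
  next
    case 2 then show ?thesis unfolding f f3 using \<open>0 \<le> x2\<close>
      by (intro exI[of _ x1] exI[of _ r] exI[of _ x2]) (auto simp: ac_simps)
  next
    case 3 then show ?thesis unfolding f f3 using \<open>0 \<le> r\<close> x12
      by (intro exI[of _ x1] exI[of _ x2] exI[of _ r]) (auto simp: ac_simps)
  qed
qed

lemma cubic_coeffs:
  fixes p q r :: real
  assumes "\<And>x. x^3 - e1 * x^2 + e2 * x - e3 = (x - p) * (x - q) * (x - r)"
  shows "e1 = p + q + r" "e2 = p * q + p * r + q * r" "e3 = p * q * r"
proof -
  show 3: "e3 = p * q * r" using assms[of 0] by simp
  have 1: "1 - e1 + e2 - e3 = (1 - p) * (1 - q) * (1 - r)" using assms[of 1] by simp
  have 2: "- 1 - e1 - e2 - e3 = (-1 - p) * (-1 - q) * (-1 - r)" using assms[of "-1"] by simp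
  show "e1 = p + q + r" using 1 2 3 by (simp add: algebra_simps)
  then show "e2 = p * q + p * r + q * r" using 1 3 by (simp add: algebra_simps)
qed

text \<open>The largest and the smallest root are determined by the zero set, the middle one by the sum of the roots.\<close>

lemma sorted_cubic_roots_unique:
  fixes p q r p' q' r' :: real
  assumes eq: "\<And>x. (x - p) * (x - q) * (x - r) = (x - p') * (x - q') * (x - r')"
    and "p \<ge> q" "q \<ge> r" "p' \<ge> q'" "q' \<ge> r'"
  shows "p = p' \<and> q = q' \<and> r = r'"
proof -
  have "p = p' \<or> p = q' \<or> p = r'" using eq[of p] by auto
  moreover have "p' = p \<or> p' = q \<or> p' = r" using eq[of p'] by auto
  ultimately have p: "p = p'" using assms by auto
  have "r = p' \<or> r = q' \<or> r = r'" using eq[of r] by auto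
  moreover have "r' = p \<or> r' = q \<or> r' = r" using eq[of r'] by auto
  ultimately have r: "r = r'" using assms by auto
  have "p + q + r = p' + q' + r'"
    by (rule cubic_coeffs(1)[of "p + q + r" "p * q + p * r + q * r" "p * q * r"], subst eq[symmetric])
       (simp add: power2_eq_square power3_eq_cube algebra_simps)
  then show ?thesis using p r by simp
qed

text \<open>The definite description denotes: square roots of the roots of the characteristic polynomial exist by
\<open>gram_charpoly_splits\<close> and are unique once sorted.\<close>

lemma is_singular_values_singular_values: "is_singular_values A (singular_values A)"
proof -
  obtain p q r where pqr: "p \<ge> q" "q \<ge> r" "r \<ge> 0"
     "\<And>x. det (mat x - transpose A ** A) = (x - p) * (x - q) * (x - r)"
    using gram_charpoly_splits[of A] by blast
  have ex: "is_singular_values A (sqrt p, sqrt q, sqrt r)"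
    using pqr by (simp add: is_singular_values_def)
  have "\<beta> = (sqrt p, sqrt q, sqrt r)" if "is_singular_values A \<beta>" for \<beta>
  proof -
    obtain x y z where b: "\<beta> = (x, y, z)" by (cases \<beta>)
    have *: "x \<ge> y" "y \<ge> z" "z \<ge> 0"
      "\<And>t. (t - p) * (t - q) * (t - r) = (t - x\<^sup>2) * (t - y\<^sup>2) * (t - z\<^sup>2)"
      using that pqr by (auto simp: b is_singular_values_def)
    have "p = x\<^sup>2 \<and> q = y\<^sup>2 \<and> r = z\<^sup>2"
      using * pqr by (intro sorted_cubic_roots_unique) (auto intro: power_mono)
    then show ?thesis using * by (simp add: b)
  qed
  then show ?thesis unfolding singular_values_def by (intro theI[of "is_singular_values A", OF ex]) auto
qed

text \<open>The squares of the singular values are the roots of the characteristic polynomial of the Gram matrix, so their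
elementary symmetric functions are its coefficients. As the roots are sorted, the largest of the three summands is
at least a third of the whole.\<close>

lemma singular_values_bounds:
  assumes sv: "singular_values A = (\<alpha>1, \<alpha>2, \<alpha>3)"
  shows "0 \<le> \<alpha>1" "0 \<le> \<alpha>2"
    "\<alpha>1\<^sup>2 \<le> sum_sq_entries A" "sum_sq_entries A \<le> 3 * \<alpha>1\<^sup>2"
    "(\<alpha>1 * \<alpha>2)\<^sup>2 \<le> sum_sq_minors A" "sum_sq_minors A \<le> 3 * (\<alpha>1 * \<alpha>2)\<^sup>2"
proof -
  have s: "\<alpha>1 \<ge> \<alpha>2" "\<alpha>2 \<ge> \<alpha>3" "\<alpha>3 \<ge> 0"
    "\<And>x. det (mat x - transpose A ** A) = (x - \<alpha>1\<^sup>2) * (x - \<alpha>2\<^sup>2) * (x - \<alpha>3\<^sup>2)"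
    using is_singular_values_singular_values[of A] sv by (auto simp: is_singular_values_def)
  show "0 \<le> \<alpha>1" "0 \<le> \<alpha>2" using s by auto
  note c = cubic_coeffs[OF s(4)[unfolded charpoly_gram]]
  have sq: "\<alpha>3\<^sup>2 \<le> \<alpha>2\<^sup>2" "\<alpha>2\<^sup>2 \<le> \<alpha>1\<^sup>2" using s by (auto intro: power_mono)
  show "\<alpha>1\<^sup>2 \<le> sum_sq_entries A" "sum_sq_entries A \<le> 3 * \<alpha>1\<^sup>2" using sq c(1) by auto
  have m: "\<alpha>1\<^sup>2 * \<alpha>3\<^sup>2 \<le> \<alpha>1\<^sup>2 * \<alpha>2\<^sup>2" "\<alpha>2\<^sup>2 * \<alpha>3\<^sup>2 \<le> \<alpha>1\<^sup>2 * \<alpha>2\<^sup>2"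
    "0 \<le> \<alpha>1\<^sup>2 * \<alpha>3\<^sup>2" "0 \<le> \<alpha>2\<^sup>2 * \<alpha>3\<^sup>2"
    using sq by (auto intro!: mult_mono mult_nonneg_nonneg)
  show "(\<alpha>1 * \<alpha>2)\<^sup>2 \<le> sum_sq_minors A" "sum_sq_minors A \<le> 3 * (\<alpha>1 * \<alpha>2)\<^sup>2"
    using m c(2) by (auto simp: power_mult_distrib)
qed

section \<open>Affinity dimension from two-sided singular value bounds\<close>

lemma powr_interpolate: "0 < x \<Longrightarrow> x powr (2 - t) * x powr (t - 1) = (x::real)"
  by (simp flip: powr_add)

text \<open>Between dimensions 1 and 2 the singular value function is the geometric interpolation of the norm and of the norm
on the exterior square.\<close>

lemma singular_value_fun_between_1_2:
  assumes sv: "singular_values A = (\<alpha>1, \<alpha>2, \<alpha>3)" and t: "1 < t" "t \<le> 2"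
    and pos: "0 < \<alpha>1" "0 < \<alpha>1 * \<alpha>2"
  shows "singular_value_fun t A = \<alpha>1 powr (2 - t) * (\<alpha>1 * \<alpha>2) powr (t - 1)"
proof -
  have "0 < \<alpha>2" using pos by (simp add: zero_less_mult_iff)
  then have "\<alpha>1 powr (2 - t) * (\<alpha>1 * \<alpha>2) powr (t - 1) = \<alpha>1 * \<alpha>2 powr (t - 1)"
    using pos powr_interpolate[of \<alpha>1 t] by (simp add: powr_mult)
  then show ?thesis using sv t pos by (simp add: singular_value_fun_def)
qed

text \<open>Up to constants the sum over the words of length \<open>n\<close> is \<open>(N * b * a powr (t - 1)) ^ n\<close> for
\<open>1 < t \<le> 2\<close>, so the critical exponent is where the base equals 1. The inequalities \<open>1 \<le> N * b\<close> and
\<open>N * a < 1\<close> place this exponent in \<open>[1, 2)\<close>.\<close>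

lemma affinity_dim_eq_of_singular_value_bounds:
  fixes A :: "'i \<Rightarrow> real^3^3"
  assumes J: "finite J" "card J = N" and a: "0 < a" "a < 1" and b: "0 < b" "b < 1"
    and Nb: "1 \<le> real N * b" and Na: "real N * a < 1" and c: "0 < c"
    and bd: "\<And>w \<alpha>1 \<alpha>2 \<alpha>3. set w \<subseteq> J \<Longrightarrow> singular_values (matrix_word A w) = (\<alpha>1, \<alpha>2, \<alpha>3) \<Longrightarrow>
        c * b ^ length w \<le> \<alpha>1 \<and> \<alpha>1 \<le> C * b ^ length w \<and>
        c * (b * a) ^ length w \<le> \<alpha>1 * \<alpha>2 \<and> \<alpha>1 * \<alpha>2 \<le> C * (b * a) ^ length w"
  shows "affinity_dim J A = ereal (1 + ln (real N * b) / (- ln a))"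
proof -
  define D where "D = 1 + ln (real N * b) / (- ln a)"
  define L where "L m = {w. length w = m \<and> set w \<subseteq> J}" for m
  define S where "S t m = (\<Sum>w\<in>L m. singular_value_fun t (matrix_word A w))" for t m
  have lna: "0 < - ln a" using a by simp
  have Npos: "0 < real N" using Nb b by (cases "N = 0") auto
  have D1: "1 \<le> D"
    using divide_nonneg_pos[OF ln_ge_zero[OF Nb] lna] by (simp add: D_def)
  have D2: "D < 2"
  proof -
    have "real N * b * a < 1 * 1" using Na b a Npos mult_strict_mono[of "real N * a" 1 b 1] by (simp add: ac_simps)
    then have "ln (real N * b * a) < 0" using Npos a b by simp
    then have "ln (real N * b) < - ln a" using Npos a b by (simp add: ln_mult)
    then have "ln (real N * b) / (- ln a) < 1"
      using pos_divide_less_eq[OF lna, of "ln (real N * b)" 1] by linarith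
    then show ?thesis unfolding D_def by linarith
  qed
  have L_alt: "L m = {w. set w \<subseteq> J \<and> length w = m}" for m by (auto simp: L_def)
  have cardL: "real (card (L m)) = real N ^ m" for m
    using J by (simp add: L_alt card_lists_length_eq)
  have svs: "\<exists>\<alpha>1 \<alpha>2 \<alpha>3. singular_values (matrix_word A w) = (\<alpha>1, \<alpha>2, \<alpha>3) \<and>
     c * b ^ m \<le> \<alpha>1 \<and> \<alpha>1 \<le> C * b ^ m \<and> c * (b * a) ^ m \<le> \<alpha>1 * \<alpha>2 \<and> \<alpha>1 * \<alpha>2 \<le> C * (b * a) ^ m
     \<and> 0 < \<alpha>1 \<and> 0 < \<alpha>1 * \<alpha>2" if w: "w \<in> L m" for w m
  proof -
    obtain \<alpha>1 \<alpha>2 \<alpha>3 where s: "singular_values (matrix_word A w) = (\<alpha>1, \<alpha>2, \<alpha>3)" using prod_cases3 by blast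
    have "0 < c * b ^ m" "0 < c * (b * a) ^ m" using a b c by auto
    then show ?thesis using bd[OF _ s] s w unfolding L_def by force
  qed
  define q where "q t = real N * b * a powr (t - 1)" for t
  have qpow: "real N ^ m * (x * b ^ m) powr (2 - t) * (x * (b * a) ^ m) powr (t - 1) = x * q t ^ m"
    if "0 < x" for x t m
  proof -
    have "(x * b ^ m) powr (2 - t) * (x * (b * a) ^ m) powr (t - 1)
        = (x powr (2 - t) * x powr (t - 1)) * ((b ^ m) powr (2 - t) * (b ^ m) powr (t - 1)) * (a ^ m) powr (t - 1)"
      using that a b by (simp add: powr_mult power_mult_distrib)
    also have "\<dots> = x * b ^ m * (a ^ m) powr (t - 1)"
      using powr_interpolate[OF that] powr_interpolate[of "b ^ m"] b by simp
    also have "(a ^ m) powr (t - 1) = (a powr (t - 1)) ^ m"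
      using a by (simp add: powr_powr mult.commute flip: powr_realpow)
    finally show ?thesis by (simp add: q_def power_mult_distrib)
  qed
  have lnq: "ln (q t) = (D - t) * (- ln a)" for t
  proof -
    have "ln (q t) = ln (real N * b) + (t - 1) * ln a"
      using Npos a b by (simp add: q_def ln_mult)
    moreover have "ln (real N * b) / (- ln a) * (- ln a) = ln (real N * b)" using lna by simp
    ultimately show ?thesis unfolding D_def by (simp add: algebra_simps)
  qed
  have qpos: "0 < q t" for t using Npos a b by (simp add: q_def)
  have ge1: "D \<le> t" if t: "0 \<le> t" "summable (\<lambda>n. S t (Suc n))" for t
  proof (rule ccontr)
    assume "\<not> D \<le> t"
    then have tD: "t < D" by simp
    have "\<exists>\<epsilon>>0. \<forall>m. \<epsilon> \<le> S t m"
    proof (cases "t \<le> 1")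
      case True
      \<comment> \<open>For \<open>t \<le> 1\<close> it suffices that \<open>b powr t \<ge> b\<close> and \<open>N * b \<ge> 1\<close>.\<close>
      have "c powr t \<le> S t m" for m
      proof -
        have "c powr t * 1 \<le> c powr t * (real N * b) ^ m"
          using Nb by (intro mult_left_mono one_le_power) auto
        also have "\<dots> = (\<Sum>w\<in>L m. c powr t * b ^ m)" by (simp add: cardL power_mult_distrib)
        also have "\<dots> \<le> S t m" unfolding S_def
        proof (rule sum_mono)
          fix w assume "w \<in> L m"
          then obtain \<alpha>1 \<alpha>2 \<alpha>3 where s: "singular_values (matrix_word A w) = (\<alpha>1, \<alpha>2, \<alpha>3)" "c * b ^ m \<le> \<alpha>1"
            using svs by blast
          have "(b ^ m) powr 1 \<le> (b ^ m) powr t"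
            using True b by (intro powr_mono') (auto simp: power_le_one)
          then have "c powr t * b ^ m \<le> c powr t * (b ^ m) powr t" using b by (intro mult_left_mono) auto
          also have "\<dots> = (c * b ^ m) powr t" using b c by (simp add: powr_mult)
          also have "\<dots> \<le> \<alpha>1 powr t" using s b c t by (intro powr_mono2) auto
          finally show "c powr t * b ^ m \<le> singular_value_fun t (matrix_word A w)"
            using s True by (simp add: singular_value_fun_def)
        qed
        finally show ?thesis by simp
      qed
      then show ?thesis using c by (intro exI[of _ "c powr t"]) auto
    next
      case False
      have "0 \<le> ln (q t)" unfolding lnq using tD lna by (intro mult_nonneg_nonneg) auto
      then have q1: "1 \<le> q t" using qpos[of t] by simp
      have "c \<le> S t m" for m
      proof -
        have "c \<le> c * q t ^ m" using c q1 one_le_power[OF q1, of m] by simp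
        also have "\<dots> = (\<Sum>w\<in>L m. (c * b ^ m) powr (2 - t) * (c * (b * a) ^ m) powr (t - 1))"
          using qpow[OF c, of m t] by (simp add: cardL)
        also have "\<dots> \<le> S t m" unfolding S_def
        proof (rule sum_mono)
          fix w assume "w \<in> L m"
          then obtain \<alpha>1 \<alpha>2 \<alpha>3 where s: "singular_values (matrix_word A w) = (\<alpha>1, \<alpha>2, \<alpha>3)" "c * b ^ m \<le> \<alpha>1"
            "c * (b * a) ^ m \<le> \<alpha>1 * \<alpha>2" "0 < \<alpha>1" "0 < \<alpha>1 * \<alpha>2"
            using svs by blast
          have t2: "1 < t" "t \<le> 2" using False tD D2 by auto
          show "(c * b ^ m) powr (2 - t) * (c * (b * a) ^ m) powr (t - 1) \<le> singular_value_fun t (matrix_word A w)"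
            unfolding singular_value_fun_between_1_2[OF s(1) t2 s(4,5)]
            using s t2 a b c by (intro mult_mono[OF powr_mono2 powr_mono2]) auto
        qed
        finally show ?thesis .
      qed
      then show ?thesis using c by blast
    qed
    then obtain \<epsilon> where e: "\<epsilon> > 0" "\<And>m. \<epsilon> \<le> S t m" by blast
    have "(\<lambda>n. S t (Suc n)) \<longlonglongrightarrow> 0" using t(2) by (rule summable_LIMSEQ_zero)
    then have "\<epsilon> \<le> 0" by (rule LIMSEQ_le_const) (use e in auto)
    then show False using e by simp
  qed
  have summ: "summable (\<lambda>n. S t (Suc n))" if t: "D < t" "t \<le> 2" for t
  proof -
    have t2: "1 < t" "t \<le> 2" using t D1 by auto
    have "ln (q t) < 0" unfolding lnq using t lna by (intro mult_neg_pos) auto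
    then have q1: "q t < 1" using qpos[of t] by simp
    have "L 0 = {[]}" by (auto simp: L_def)
    then have Cpos: "0 < C" using svs[of "[]" 0] by force
    have le: "S t m \<le> C * q t ^ m" and ge: "0 \<le> S t m" for m
    proof -
      have *: "0 \<le> singular_value_fun t (matrix_word A w) \<and> singular_value_fun t (matrix_word A w)
          \<le> (C * b ^ m) powr (2 - t) * (C * (b * a) ^ m) powr (t - 1)" if "w \<in> L m" for w
      proof -
        obtain \<alpha>1 \<alpha>2 \<alpha>3 where s: "singular_values (matrix_word A w) = (\<alpha>1, \<alpha>2, \<alpha>3)" "\<alpha>1 \<le> C * b ^ m"
            "\<alpha>1 * \<alpha>2 \<le> C * (b * a) ^ m" "0 < \<alpha>1" "0 < \<alpha>1 * \<alpha>2"
          using svs[OF \<open>w \<in> L m\<close>] by blast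
        show ?thesis
          unfolding singular_value_fun_between_1_2[OF s(1) t2 s(4,5)]
          using s t2 a b by (intro conjI mult_mono[OF powr_mono2 powr_mono2]) auto
      qed
      show "0 \<le> S t m" unfolding S_def using * by (intro sum_nonneg) auto
      have "S t m \<le> (\<Sum>w\<in>L m. (C * b ^ m) powr (2 - t) * (C * (b * a) ^ m) powr (t - 1))"
        unfolding S_def using * by (intro sum_mono) auto
      also have "\<dots> = C * q t ^ m" using qpow[OF Cpos, of m t] by (simp add: cardL)
      finally show "S t m \<le> C * q t ^ m" .
    qed
    show ?thesis
    proof (rule summable_comparison_test')
      show "summable (\<lambda>n. C * q t ^ Suc n)"
        using q1 qpos[of t] by (intro summable_mult) (simp add: summable_Suc_iff)
      show "norm (S t (Suc n)) \<le> C * q t ^ Suc n" if "n \<ge> 0" for n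
        using le[of "Suc n"] ge[of "Suc n"] by simp
    qed
  qed
  have aff: "affinity_dim J A = (INF t\<in>{t. 0 \<le> t \<and> summable (\<lambda>n. S t (Suc n))}. ereal t)"
    by (simp add: affinity_dim_def S_def L_def)
  show ?thesis unfolding aff D_def[symmetric]
  proof (rule antisym)
    show "(INF t\<in>{t. 0 \<le> t \<and> summable (\<lambda>n. S t (Suc n))}. ereal t) \<le> ereal D"
    proof (rule dense_ge)
      fix z assume z: "ereal D < z"
      obtain t where t: "D < t" "t \<le> 2" "ereal t \<le> z"
      proof (cases z)
        case (real r)
        then show ?thesis using z D2 that[of "min r 2"] by auto
      next
        case PInf then show ?thesis using that[of 2] D2 by simp
      qed (use z in auto)
      have "(INF t\<in>{t. 0 \<le> t \<and> summable (\<lambda>n. S t (Suc n))}. ereal t) \<le> ereal t"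
        using summ[OF t(1,2)] t D1 by (intro INF_lower) auto
      then show "(INF t\<in>{t. 0 \<le> t \<and> summable (\<lambda>n. S t (Suc n))}. ereal t) \<le> z" using t(3) by simp
    qed
    show "ereal D \<le> (INF t\<in>{t. 0 \<le> t \<and> summable (\<lambda>n. S t (Suc n))}. ereal t)"
      using ge1 by (intro INF_greatest) auto
  qed
qed

section \<open>Counting pairs of meeting strips\<close>

text \<open>An interval of length at most \<open>2 * \<epsilon> / \<gamma>\<close> contains at most one integer more than its length.\<close>

lemma card_nat_affine_window:
  fixes \<alpha> \<beta> \<gamma> \<epsilon> :: real
  assumes \<gamma>: "0 < \<gamma>" "\<gamma> \<le> \<bar>\<beta>\<bar>" and \<epsilon>: "0 < \<epsilon>"
  shows "finite {r::nat. \<bar>\<alpha> + \<beta> * real r\<bar> < \<epsilon>} \<and>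
    real (card {r::nat. \<bar>\<alpha> + \<beta> * real r\<bar> < \<epsilon>}) \<le> 1 + 2 * \<epsilon> / \<gamma>"
proof (cases "{r::nat. \<bar>\<alpha> + \<beta> * real r\<bar> < \<epsilon>} = {}")
  case True
  then show ?thesis using \<gamma> \<epsilon> by simp
next
  case False
  let ?S = "{r::nat. \<bar>\<alpha> + \<beta> * real r\<bar> < \<epsilon>}"
  define m where "m = (LEAST r. r \<in> ?S)"
  have "\<exists>r. r \<in> ?S" using False by blast
  then have m: "m \<in> ?S" unfolding m_def by (rule LeastI_ex)
  define k where "k = nat \<lfloor>2 * \<epsilon> / \<gamma>\<rfloor>"
  have sub: "?S \<subseteq> {m..m + k}"
  proof
    fix r assume r: "r \<in> ?S"
    then have "m \<le> r" unfolding m_def by (rule Least_le)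
    have "\<gamma> * real (r - m) \<le> \<bar>\<beta>\<bar> * real (r - m)" using \<gamma> by (intro mult_right_mono) auto
    also have "\<dots> = \<bar>(\<alpha> + \<beta> * real r) - (\<alpha> + \<beta> * real m)\<bar>"
      using \<open>m \<le> r\<close> by (simp add: of_nat_diff abs_mult flip: right_diff_distrib)
    also have "\<dots> \<le> 2 * \<epsilon>" using r m by auto
    finally have "real (r - m) \<le> 2 * \<epsilon> / \<gamma>" using \<gamma> by (simp add: field_simps)
    then have "r - m \<le> k" unfolding k_def by (simp add: le_nat_floor)
    then show "r \<in> {m..m + k}" using \<open>m \<le> r\<close> by auto
  qed
  have "card ?S \<le> card {m..m + k}" using sub by (intro card_mono) auto
  also have "\<dots> = k + 1" by simp
  finally have "real (card ?S) \<le> real k + 1" by linarith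
  moreover have "real k \<le> 2 * \<epsilon> / \<gamma>" using \<gamma> \<epsilon> by (simp add: k_def)
  ultimately show ?thesis using finite_subset[OF sub] by simp
qed

lemma mixed_radix_div: "r < m \<Longrightarrow> (q * m + r) div m = (q::nat)"
  by (rule div_nat_eqI) (simp_all add: algebra_simps)

text \<open>The planar data: \<open>N = M * K\<close> maps \<open>(x, y) \<mapsto> (b * x + b * col i, d i * x + a * y + s i)\<close> in \<open>M\<close> columns,
numbered from 0, that tile the unit interval. The assumption \<open>strip\<close> says that the unit square is mapped into
itself. The two alternatives in \<open>transversal\<close> are disjointness of the interiors of two first-level
parallelograms in one column, and a gap between their shears; the number \<open>2 * a / (b - a)\<close> is what the deeper
letters of two words can contribute to the difference of the slopes (lemma \<open>slope_bound\<close>).\<close>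

locale transversal_columns =
  fixes N M K :: nat and col :: "nat \<Rightarrow> nat" and a b \<kappa> :: real and d s :: "nat \<Rightarrow> real"
  assumes ab: "0 < a" "a < b" "b < 1"
    and Mb: "real M * b = 1"
    and N_eq: "N = M * K"
    and col: "\<And>i. i \<in> {1..N} \<Longrightarrow> col i < M"
    and fibre: "\<And>m. m < M \<Longrightarrow> card {i \<in> {1..N}. col i = m} = K"
    and aN: "a * real N < 1"
    and strip: "\<And>i x. i \<in> {1..N} \<Longrightarrow> 0 \<le> x \<Longrightarrow> x \<le> 1 \<Longrightarrow> 0 \<le> d i * x + s i \<and> d i * x + s i + a \<le> 1"
    and \<kappa>: "0 < \<kappa>"
    and transversal: "\<And>i j. i \<in> {1..N} \<Longrightarrow> j \<in> {1..N} \<Longrightarrow> i \<noteq> j \<Longrightarrow> col i = col j \<Longrightarrow>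
       (\<forall>x. 0 \<le> x \<longrightarrow> x \<le> 1 \<longrightarrow> a \<le> \<bar>(d i - d j) * x + (s i - s j)\<bar>) \<or>
       2 * a / (b - a) + \<kappa> \<le> \<bar>d i - d j\<bar>"
begin

definition words :: "nat \<Rightarrow> nat list set" where
  "words n = {w. set w \<subseteq> {1..N} \<and> length w = n}"

text \<open>The columns of a word are the base \<open>M\<close> digits of its column index, most significant digit first; hence words of one length have
the same index exactly if they run through the same columns.\<close>

fun column_index :: "nat list \<Rightarrow> nat" where
  "column_index [] = 0"
| "column_index (i # w) = col i * M ^ length w + column_index w"

definition left_end :: "nat list \<Rightarrow> real" where
  "left_end w = b ^ length w * real (column_index w)"

text \<open>The composition along \<open>w\<close> maps \<open>(x, y)\<close> to
\<open>(left_end w + b ^ length w * x, elevation w x + a ^ length w * y)\<close>, where \<open>elevation w\<close> is affine with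
derivative \<open>slope w\<close>. So \<open>elevation w\<close> is the lower edge of the strip of \<open>w\<close>, with its base rescaled to
the unit interval.\<close>

fun slope :: "nat list \<Rightarrow> real" where
  "slope [] = 0"
| "slope (i # w) = d i * b ^ length w + a * slope w"

fun elevation :: "nat list \<Rightarrow> real \<Rightarrow> real" where
  "elevation [] x = 0"
| "elevation (i # w) x = d i * (left_end w + b ^ length w * x) + s i + a * elevation w x"

lemma b_pos: "0 < b" using ab by simp

lemma M_pos: "0 < M" using Mb by (cases "M = 0") auto

lemma bM_power: "b ^ n * real M ^ n = 1"
  using Mb by (simp add: mult.commute flip: power_mult_distrib)

lemma finite_words: "finite (words n)" and card_words: "card (words n) = N ^ n"
  by (simp_all add: words_def finite_lists_length_eq card_lists_length_eq)

lemma words_Suc: "words (Suc n) = (\<lambda>(i, w). i # w) ` ({1..N} \<times> words n)"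
proof (intro set_eqI iffI)
  fix w assume "w \<in> words (Suc n)"
  then show "w \<in> (\<lambda>(i, w). i # w) ` ({1..N} \<times> words n)"
    by (cases w) (auto simp: words_def)
qed (auto simp: words_def)

lemma words_0 [simp]: "words 0 = {[]}"
  by (auto simp: words_def)

lemma left_end_Nil [simp]: "left_end [] = 0"
  by (simp add: left_end_def)

lemma left_end_Cons: "left_end (i # w) = b * left_end w + b * real (col i)"
  using bM_power[of "length w"] by (simp add: left_end_def algebra_simps)

lemma column_index_less: "set w \<subseteq> {1..N} \<Longrightarrow> column_index w < M ^ length w"
proof (induction w)
  case (Cons i w)
  then have "col i + 1 \<le> M" using col[of i] by auto
  then have "(col i + 1) * M ^ length w \<le> M * M ^ length w" by (rule mult_right_mono) simp
  then show ?case using Cons by (simp add: algebra_simps)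
qed simp

lemma column_index_append:
  "column_index (w @ v) = column_index w * M ^ length v + column_index v"
  by (induction w) (auto simp: power_add algebra_simps)

text \<open>The last \<open>length v\<close> digits are the remainder modulo \<open>M ^ length v\<close>.\<close>

lemma column_index_append_eq_iff:
  assumes "set v \<subseteq> {1..N}" "set v' \<subseteq> {1..N}" "length v = length v'"
  shows "column_index (w @ v) = column_index (w' @ v') \<longleftrightarrow>
    column_index w = column_index w' \<and> column_index v = column_index v'"
proof
  assume "column_index (w @ v) = column_index (w' @ v')"
  then have eq: "column_index w * M ^ length v' + column_index v
      = column_index w' * M ^ length v' + column_index v'"
    using assms by (simp add: column_index_append)
  have less: "column_index v < M ^ length v'" "column_index v' < M ^ length v'"
    using column_index_less assms by metis+
  then have "(column_index w * M ^ length v' + column_index v) div M ^ length v' = column_index w"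
    "(column_index w' * M ^ length v' + column_index v') div M ^ length v' = column_index w'"
    by (auto intro!: mixed_radix_div)
  then show "column_index w = column_index w' \<and> column_index v = column_index v'" using eq by simp
qed (use assms in \<open>simp add: column_index_append\<close>)

lemma column_index_Cons_eq_iff:
  assumes "set v \<subseteq> {1..N}" "set v' \<subseteq> {1..N}" "length v = length v'"
  shows "column_index (i # v) = column_index (i' # v') \<longleftrightarrow>
    col i = col i' \<and> column_index v = column_index v'"
  using column_index_append_eq_iff[OF assms, of "[i]" "[i']"] by simp

lemma card_column_index_fibre: "card {w \<in> words e. column_index w = \<rho>} \<le> K ^ e"
proof (induction e arbitrary: \<rho>)
  case 0
  have "card {w \<in> words 0. column_index w = \<rho>} \<le> card {[]::nat list}" by (intro card_mono) auto
  then show ?case by simp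
next
  case (Suc e)
  let ?I = "{i \<in> {1..N}. col i = \<rho> div M ^ e}" and ?R = "{w \<in> words e. column_index w = \<rho> mod M ^ e}"
  have "{w \<in> words (Suc e). column_index w = \<rho>} \<subseteq> (\<lambda>(i, w). i # w) ` (?I \<times> ?R)"
  proof
    fix w assume w: "w \<in> {w \<in> words (Suc e). column_index w = \<rho>}"
    then obtain i u where iu: "w = i # u" "i \<in> {1..N}" "u \<in> words e" by (auto simp: words_Suc)
    have "column_index u < M ^ e" using column_index_less iu by (auto simp: words_def)
    moreover have "length u = e" using iu by (simp add: words_def)
    then have "\<rho> = col i * M ^ e + column_index u" using w iu by simp
    ultimately have "\<rho> div M ^ e = col i" "\<rho> mod M ^ e = column_index u"
      using mixed_radix_div[of "column_index u" "M ^ e" "col i"] by simp_all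
    then show "w \<in> (\<lambda>(i, w). i # w) ` (?I \<times> ?R)" using iu by auto
  qed
  moreover have fin: "finite (?I \<times> ?R)" using finite_words by auto
  ultimately have "card {w \<in> words (Suc e). column_index w = \<rho>} \<le> card (?I \<times> ?R)"
    using card_mono[OF finite_imageI[OF fin]] card_image_le[OF fin] order_trans by blast
  also have "\<dots> \<le> K * K ^ e"
  proof -
    have "card ?I \<le> K"
    proof (cases "\<rho> div M ^ e < M")
      case False
      then have "?I = {}" using col by force
      then show ?thesis by (simp only: card.empty)
    next
      case True
      show ?thesis by (simp only: fibre[OF True] order_refl)
    qed
    then show ?thesis unfolding card_cartesian_product using Suc by (intro mult_mono) auto
  qed
  finally show ?case by simp
qed

definition column_pairs :: "nat \<Rightarrow> (nat list \<times> nat list) set" where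
  "column_pairs e = {(v, v') \<in> words e \<times> words e. column_index v = column_index v'}"

lemma finite_column_pairs: "finite (column_pairs e)"
  by (rule finite_subset[of _ "words e \<times> words e"]) (auto simp: column_pairs_def finite_words)

text \<open>Each column index is attained by at most \<open>K ^ e\<close> words, hence by at most \<open>(K ^ e)\<^sup>2\<close> pairs.\<close>

lemma card_column_pairs_over:
  assumes "finite S"
  shows "card {(v, v') \<in> column_pairs e. column_index v \<in> S} \<le> card S * (K ^ e) ^ 2"
proof -
  let ?F = "\<lambda>\<rho>. {w \<in> words e. column_index w = \<rho>}"
  have "{(v, v') \<in> column_pairs e. column_index v \<in> S} \<subseteq> (\<Union>\<rho>\<in>S. ?F \<rho> \<times> ?F \<rho>)"
    by (auto simp: column_pairs_def)
  then have "card {(v, v') \<in> column_pairs e. column_index v \<in> S} \<le> card (\<Union>\<rho>\<in>S. ?F \<rho> \<times> ?F \<rho>)"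
    using assms finite_words by (intro card_mono) auto
  also have "\<dots> \<le> (\<Sum>\<rho>\<in>S. card (?F \<rho> \<times> ?F \<rho>))" by (rule card_UN_le[OF assms])
  also have "\<dots> \<le> (\<Sum>\<rho>\<in>S. (K ^ e) ^ 2)"
    unfolding card_cartesian_product power2_eq_square
    by (intro sum_mono mult_mono card_column_index_fibre) auto
  finally show ?thesis by simp
qed

lemma card_column_pairs: "card (column_pairs e) \<le> M ^ e * (K ^ e) ^ 2"
proof -
  have "column_pairs e = {(v, v') \<in> column_pairs e. column_index v \<in> {..<M ^ e}}"
    using column_index_less by (auto simp: column_pairs_def words_def)
  then show ?thesis using card_column_pairs_over[of "{..<M ^ e}" e] by simp
qed

lemma left_end_bounds:
  assumes "set w \<subseteq> {1..N}" "0 \<le> x" "x \<le> 1"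
  shows "0 \<le> left_end w + b ^ length w * x" "left_end w + b ^ length w * x \<le> 1"
proof -
  show "0 \<le> left_end w + b ^ length w * x" using assms b_pos by (simp add: left_end_def)
  have "column_index w + 1 \<le> M ^ length w" using column_index_less[OF assms(1)] by simp
  then have "real (column_index w) + 1 \<le> real M ^ length w"
    by (metis of_nat_1 of_nat_add of_nat_le_iff of_nat_power)
  then have "b ^ length w * (real (column_index w) + x) \<le> b ^ length w * real M ^ length w"
    using assms b_pos by (intro mult_left_mono) auto
  then show "left_end w + b ^ length w * x \<le> 1"
    unfolding bM_power by (simp add: left_end_def algebra_simps)
qed

text \<open>The strip lies inside the unit square and is \<open>a ^ length w\<close> thick, which leaves this much room for its lower edge.\<close>

lemma elevation_bounds:
  assumes "set w \<subseteq> {1..N}" "0 \<le> x" "x \<le> 1"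
  shows "0 \<le> elevation w x \<and> elevation w x \<le> 1 - a ^ length w"
  using assms(1)
proof (induction w)
  case (Cons i w)
  have i: "i \<in> {1..N}" and w: "set w \<subseteq> {1..N}" using Cons.prems by auto
  have IH: "0 \<le> elevation w x" "elevation w x \<le> 1 - a ^ length w" using Cons.IH w by auto
  have "0 \<le> a * elevation w x" "a * elevation w x \<le> a * (1 - a ^ length w)"
    using IH ab by (auto intro: mult_left_mono)
  then show ?case
    using strip[OF i left_end_bounds[OF w assms(2,3)]] by (simp add: algebra_simps)
qed simp

lemma abs_d_le: "i \<in> {1..N} \<Longrightarrow> \<bar>d i\<bar> \<le> 1"
  using strip[of i 0] strip[of i 1] ab by auto

lemma slope_bound: "set w \<subseteq> {1..N} \<Longrightarrow> \<bar>slope w\<bar> \<le> b ^ length w / (b - a)"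
proof (induction w)
  case (Cons i w)
  let ?B = "b ^ length w"
  have "\<bar>slope (i # w)\<bar> \<le> \<bar>d i\<bar> * ?B + a * \<bar>slope w\<bar>"
    using ab abs_triangle_ineq[of "d i * ?B" "a * slope w"] by (simp add: abs_mult)
  also have "\<dots> \<le> 1 * ?B + a * (?B / (b - a))"
    using Cons abs_d_le[of i] ab by (intro add_mono mult_mono) auto
  also have "\<dots> = b ^ length (i # w) / (b - a)" using ab by (simp add: field_simps)
  finally show ?case .
qed (use ab in simp)

lemma elevation_affine: "elevation w x = elevation w 0 + slope w * x"
  by (induction w) (auto simp: algebra_simps)

text \<open>Pairs of words with the same columns whose strips, of vertical thickness \<open>a ^ n\<close>, overlap above the point with
rescaled abscissa \<open>x\<close>. The inequality is strict, so that strips that merely touch are not counted: in a stack of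
touching parallelograms there is no transversality.\<close>

definition close_pairs :: "nat \<Rightarrow> real \<Rightarrow> (nat list \<times> nat list) set" where
  "close_pairs n x = {(w, w') \<in> column_pairs n. \<bar>elevation w x - elevation w' x\<bar> < a ^ n}"

text \<open>The pairs in which the words differ from the first letter on; the remaining ones reduce to shorter words.\<close>

definition split_close_pairs :: "nat \<Rightarrow> real \<Rightarrow> (nat list \<times> nat list) set" where
  "split_close_pairs n x = {(w, w') \<in> close_pairs n x. hd w \<noteq> hd w'}"

lemma finite_close_pairs: "finite (close_pairs n x)" "finite (split_close_pairs n x)"
  by (rule finite_subset[OF _ finite_column_pairs], auto simp: close_pairs_def split_close_pairs_def)+

lemma left_end_eq: "length w = length w' \<Longrightarrow> column_index w = column_index w' \<Longrightarrow> left_end w = left_end w'"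
  by (simp add: left_end_def)

lemma card_close_pairs_Suc:
  "card (close_pairs (Suc n) x) \<le> N * card (close_pairs n x) + card (split_close_pairs (Suc n) x)"
proof -
  let ?C = "(\<lambda>(i, (w, w')). (i # w, i # w')) ` ({1..N} \<times> close_pairs n x)"
  have "close_pairs (Suc n) x \<subseteq> ?C \<union> split_close_pairs (Suc n) x"
  proof
    fix p assume p: "p \<in> close_pairs (Suc n) x"
    obtain i w j w' where eq: "p = (i # w, j # w')" and mem: "i \<in> {1..N}" "j \<in> {1..N}" "w \<in> words n" "w' \<in> words n"
      using p by (auto simp: close_pairs_def column_pairs_def words_Suc)
    show "p \<in> ?C \<union> split_close_pairs (Suc n) x"
    proof (cases "i = j")
      case True
      have ci: "column_index w = column_index w'"
        using p mem column_index_Cons_eq_iff[of w w' i j]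
        unfolding eq close_pairs_def column_pairs_def words_def by auto
      have "left_end w = left_end w'" using ci mem by (intro left_end_eq) (auto simp: words_def)
      then have "\<bar>a * elevation w x - a * elevation w' x\<bar> < a ^ Suc n"
        using p mem True unfolding eq close_pairs_def words_def by simp
      then have "\<bar>elevation w x - elevation w' x\<bar> < a ^ n"
        using ab by (simp add: abs_mult flip: right_diff_distrib)
      then have "(w, w') \<in> close_pairs n x" using mem ci by (simp add: close_pairs_def column_pairs_def)
      then show ?thesis using True mem unfolding eq by force
    next
      case False
      then show ?thesis using p unfolding eq split_close_pairs_def by auto
    qed
  qed
  then have "card (close_pairs (Suc n) x) \<le> card (?C \<union> split_close_pairs (Suc n) x)"
    using finite_close_pairs by (intro card_mono) auto
  also have "\<dots> \<le> card ?C + card (split_close_pairs (Suc n) x)" by (rule card_Un_le)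
  also have "card ?C \<le> card ({1..N} \<times> close_pairs n x)"
    using finite_close_pairs by (intro card_image_le) auto
  finally show ?thesis by (simp add: card_cartesian_product)
qed

text \<open>Both alternatives for the first letters are inherited by all words that start with them. If the first-level strips
have disjoint interiors, so do the strips nested in them. If the shears differ by at least
\<open>2 * a / (b - a) + \<kappa>\<close>, then the later letters cannot compensate more than \<open>2 * a / (b - a)\<close> of this.\<close>

lemma split_pair_disjoint_or_transversal:
  assumes "(w, w') \<in> column_pairs (Suc n)" "hd w \<noteq> hd w'"
  shows "(\<forall>x. 0 \<le> x \<longrightarrow> x \<le> 1 \<longrightarrow> a ^ Suc n \<le> \<bar>elevation w x - elevation w' x\<bar>) \<or>
    \<kappa> * b ^ n \<le> \<bar>slope w - slope w'\<bar>"
proof -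
  obtain i u j u' where eq: "w = i # u" "w' = j # u'"
    and mem: "i \<in> {1..N}" "j \<in> {1..N}" "u \<in> words n" "u' \<in> words n"
    using assms by (auto simp: column_pairs_def words_Suc)
  have u: "set u \<subseteq> {1..N}" "length u = n" "set u' \<subseteq> {1..N}" "length u' = n"
    using mem by (auto simp: words_def)
  have ci: "col i = col j" "column_index u = column_index u'"
    using assms u column_index_Cons_eq_iff[of u u' i j] unfolding eq column_pairs_def by auto
  have le: "left_end u' = left_end u" using ci u by (intro left_end_eq) auto
  have "i \<noteq> j" using assms(2) by (simp add: eq)
  from transversal[OF mem(1,2) this ci(1)] show ?thesis
  proof
    assume dis: "\<forall>x. 0 \<le> x \<longrightarrow> x \<le> 1 \<longrightarrow> a \<le> \<bar>(d i - d j) * x + (s i - s j)\<bar>"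
    have "a ^ Suc n \<le> \<bar>elevation w x - elevation w' x\<bar>" if x: "0 \<le> x" "x \<le> 1" for x
    proof -
      let ?\<xi> = "left_end u + b ^ n * x"
      have \<xi>: "0 \<le> ?\<xi>" "?\<xi> \<le> 1" using left_end_bounds[OF u(1) x] u(2) by auto
      have "\<bar>elevation u x - elevation u' x\<bar> \<le> 1 - a ^ n"
        using elevation_bounds[OF u(1) x] elevation_bounds[OF u(3) x] u by auto
      then have "a * \<bar>elevation u x - elevation u' x\<bar> \<le> a * (1 - a ^ n)" using ab by (intro mult_left_mono) auto
      then have "\<bar>a * (elevation u x - elevation u' x)\<bar> \<le> a - a ^ Suc n"
        unfolding abs_mult right_diff_distrib[of a 1] using ab by simp
      moreover have "a \<le> \<bar>(d i - d j) * ?\<xi> + (s i - s j)\<bar>" using dis \<xi> by blast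
      moreover have "elevation w x - elevation w' x
          = ((d i - d j) * ?\<xi> + (s i - s j)) + a * (elevation u x - elevation u' x)"
        using u by (simp add: eq le algebra_simps)
      ultimately show ?thesis by linarith
    qed
    then show ?thesis by blast
  next
    assume tr: "2 * a / (b - a) + \<kappa> \<le> \<bar>d i - d j\<bar>"
    let ?B = "b ^ n"
    have "\<bar>slope u - slope u'\<bar> \<le> 2 * (?B / (b - a))"
      using slope_bound[OF u(1)] slope_bound[OF u(3)] u by auto
    then have "a * \<bar>slope u - slope u'\<bar> \<le> a * (2 * (?B / (b - a)))" using ab by (intro mult_left_mono) auto
    then have 1: "\<bar>a * (slope u - slope u')\<bar> \<le> 2 * a / (b - a) * ?B" using ab by (simp add: abs_mult ac_simps)
    have "(2 * a / (b - a) + \<kappa>) * ?B \<le> \<bar>d i - d j\<bar> * ?B" using tr b_pos by (intro mult_right_mono) auto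
    then have 2: "2 * a / (b - a) * ?B + \<kappa> * ?B \<le> \<bar>(d i - d j) * ?B\<bar>" using b_pos by (simp add: abs_mult distrib_right)
    have 3: "slope w - slope w' = (d i - d j) * ?B + a * (slope u - slope u')"
      using u by (simp add: eq algebra_simps)
    have "\<kappa> * ?B \<le> \<bar>x + y\<bar>" if "\<bar>y\<bar> \<le> z" "z + \<kappa> * ?B \<le> \<bar>x\<bar>" for x y z
      using that by linarith
    from this[OF 1 2] have "\<kappa> * ?B \<le> \<bar>slope w - slope w'\<bar>" unfolding 3 .
    then show ?thesis by blast
  qed
qed

text \<open>For fixed \<open>(w, w')\<close> in the transversal case, the overlap is decided by an affine function of the integer
\<open>column_index v\<close> whose derivative is at least \<open>\<kappa> * b ^ (Suc n + e)\<close> in absolute value; so it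
occurs for at most \<open>1 + 2 * a ^ Suc n / (\<kappa> * b ^ (Suc n + e))\<close> columns, each carrying at most
\<open>(K ^ e)\<^sup>2\<close> pairs.\<close>

lemma sum_card_split_close_pairs:
  "real (\<Sum>(v, v')\<in>column_pairs e. card (split_close_pairs (Suc n) (left_end v)))
    \<le> real (M ^ Suc n * (K ^ Suc n)\<^sup>2 * (K ^ e)\<^sup>2) * (1 + 2 / \<kappa> * a ^ Suc n / b ^ (Suc n + e))"
proof -
  let ?Q = "{(w, w') \<in> column_pairs (Suc n). hd w \<noteq> hd w'}"
  let ?close = "\<lambda>(w, w') v. \<bar>elevation w (left_end v) - elevation w' (left_end v)\<bar> < a ^ Suc n"
  have finQ: "finite ?Q" by (rule finite_subset[OF _ finite_column_pairs[of "Suc n"]]) auto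
  define R where "R = 1 + 2 / \<kappa> * a ^ Suc n / b ^ (Suc n + e)"
  have R: "1 \<le> R" using \<kappa> ab by (simp add: R_def)
  have each: "real (card {(v, v') \<in> column_pairs e. ?close q v}) \<le> real ((K ^ e)\<^sup>2) * R" if qQ: "q \<in> ?Q" for q
  proof -
    obtain w w' where q: "q = (w, w')" "(w, w') \<in> column_pairs (Suc n)" "hd w \<noteq> hd w'" using qQ by blast
    from split_pair_disjoint_or_transversal[OF q(2,3)] show ?thesis
    proof
      assume dis: "\<forall>x. 0 \<le> x \<longrightarrow> x \<le> 1 \<longrightarrow> a ^ Suc n \<le> \<bar>elevation w x - elevation w' x\<bar>"
      have "{(v, v') \<in> column_pairs e. ?close q v} = {}"
      proof -
        have "a ^ Suc n \<le> \<bar>elevation w (left_end v) - elevation w' (left_end v)\<bar>" if "v \<in> words e" for v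
          using dis left_end_bounds[of v 0] that by (auto simp: words_def)
        then show ?thesis unfolding q by (fastforce simp: column_pairs_def)
      qed
      then have "card {(v, v') \<in> column_pairs e. ?close q v} = 0" by (simp only: card.empty)
      then show ?thesis using R by simp
    next
      assume tr: "\<kappa> * b ^ n \<le> \<bar>slope w - slope w'\<bar>"
      let ?\<alpha> = "elevation w 0 - elevation w' 0" and ?\<beta> = "(slope w - slope w') * b ^ e"
      let ?\<gamma> = "\<kappa> * b ^ (Suc n + e)"
      let ?S = "{r::nat. \<bar>?\<alpha> + ?\<beta> * real r\<bar> < a ^ Suc n}"
      have "\<kappa> * b ^ Suc n \<le> \<kappa> * b ^ n" using \<kappa> ab by (intro mult_left_mono power_decreasing) auto
      then have "\<kappa> * b ^ Suc n * b ^ e \<le> \<bar>slope w - slope w'\<bar> * b ^ e"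
        using tr b_pos by (intro mult_right_mono) auto
      then have \<gamma>: "?\<gamma> \<le> \<bar>?\<beta>\<bar>" using b_pos by (simp add: abs_mult power_add ac_simps)
      have S: "finite ?S" "real (card ?S) \<le> 1 + 2 * a ^ Suc n / ?\<gamma>"
        using card_nat_affine_window[OF _ \<gamma>, of "a ^ Suc n" ?\<alpha>] \<kappa> ab by auto
      have "?close q v \<longleftrightarrow> column_index v \<in> ?S" if "v \<in> words e" for v
      proof -
        have "left_end v = b ^ e * real (column_index v)" using that by (simp add: left_end_def words_def)
        then have "elevation w (left_end v) - elevation w' (left_end v) = ?\<alpha> + ?\<beta> * real (column_index v)"
          using elevation_affine[of w "left_end v"] elevation_affine[of w' "left_end v"] by (simp add: algebra_simps)
        then show ?thesis by (simp add: q)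
      qed
      then have "{(v, v') \<in> column_pairs e. ?close q v} = {(v, v') \<in> column_pairs e. column_index v \<in> ?S}"
        unfolding column_pairs_def by blast
      then have "card {(v, v') \<in> column_pairs e. ?close q v} \<le> card ?S * (K ^ e)\<^sup>2"
        using card_column_pairs_over[OF S(1), of e] by (simp only:)
      then have "real (card {(v, v') \<in> column_pairs e. ?close q v}) \<le> real (card ?S) * real ((K ^ e)\<^sup>2)"
        by (simp only: of_nat_mult[symmetric] of_nat_le_iff)
      also have "\<dots> \<le> (1 + 2 * a ^ Suc n / ?\<gamma>) * real ((K ^ e)\<^sup>2)" by (rule mult_right_mono[OF S(2)]) simp
      also have "\<dots> = real ((K ^ e)\<^sup>2) * R" by (simp add: R_def)
      finally show ?thesis .
    qed
  qed
  \<comment> \<open>Double counting: sum over the heads \<open>(w, w')\<close> instead of the tails \<open>(v, v')\<close>.\<close>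
  have "(\<Sum>(v, v')\<in>column_pairs e. card (split_close_pairs (Suc n) (left_end v)))
      = (\<Sum>z\<in>column_pairs e. card {q \<in> ?Q. ?close q (fst z)})"
  proof (rule sum.cong[OF refl])
    fix z assume "z \<in> column_pairs e"
    obtain v v' where z: "z = (v, v')" by (cases z)
    have "split_close_pairs (Suc n) (left_end v) = {q \<in> ?Q. ?close q v}"
      by (auto simp: split_close_pairs_def close_pairs_def)
    then show "(case z of (v, v') \<Rightarrow> card (split_close_pairs (Suc n) (left_end v))) = card {q \<in> ?Q. ?close q (fst z)}"
      by (simp add: z)
  qed
  also have "\<dots> = (\<Sum>q\<in>?Q. card {z \<in> column_pairs e. ?close q (fst z)})"
    by (rule sum_multicount_gen[OF finite_column_pairs finQ]) simp
  finally have "real (\<Sum>(v, v')\<in>column_pairs e. card (split_close_pairs (Suc n) (left_end v)))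
      = (\<Sum>q\<in>?Q. real (card {z \<in> column_pairs e. ?close q (fst z)}))" by simp
  also have "\<dots> \<le> (\<Sum>q\<in>?Q. real ((K ^ e)\<^sup>2) * R)"
  proof (rule sum_mono)
    fix q assume "q \<in> ?Q"
    have "{z \<in> column_pairs e. ?close q (fst z)} = {(v, v') \<in> column_pairs e. ?close q v}" by auto
    then show "real (card {z \<in> column_pairs e. ?close q (fst z)}) \<le> real ((K ^ e)\<^sup>2) * R"
      using each[OF \<open>q \<in> ?Q\<close>] by (simp only:)
  qed
  also have "\<dots> = real (card ?Q) * (real ((K ^ e)\<^sup>2) * R)" by simp
  also have "\<dots> \<le> real (M ^ Suc n * (K ^ Suc n)\<^sup>2) * (real ((K ^ e)\<^sup>2) * R)"
  proof (intro mult_right_mono)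
    have "card ?Q \<le> card (column_pairs (Suc n))" using finite_column_pairs by (intro card_mono) auto
    then have "card ?Q \<le> M ^ Suc n * (K ^ Suc n)\<^sup>2" using card_column_pairs[of "Suc n"] by linarith
    then show "real (card ?Q) \<le> real (M ^ Suc n * (K ^ Suc n)\<^sup>2)" by (rule of_nat_mono)
  qed (use R in auto)
  finally show ?thesis unfolding R_def by (simp add: ac_simps)
qed

end

section \<open>Correlation of cells\<close>

lemma card_le_of_pairwise_near:
  fixes I :: "(int \<times> int) set"
  assumes "\<And>p q. p \<in> I \<Longrightarrow> q \<in> I \<Longrightarrow> \<bar>fst p - fst q\<bar> \<le> int L \<and> \<bar>snd p - snd q\<bar> \<le> int L"
  shows "finite I \<and> card I \<le> (2 * L + 1)\<^sup>2"
proof (cases "I = {}")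
  case False
  then obtain p where p: "p \<in> I" by blast
  let ?R = "{fst p - int L..fst p + int L} \<times> {snd p - int L..snd p + int L}"
  have sub: "I \<subseteq> ?R"
  proof
    fix q assume "q \<in> I"
    from assms[OF this p] show "q \<in> ?R" by (cases q) auto
  qed
  have "card {x - int L..x + int L} = 2 * L + 1" for x
    unfolding card_atLeastAtMost_int by (simp add: nat_eq_iff)
  then have "card ?R = (2 * L + 1)\<^sup>2"
    by (simp only: card_cartesian_product power2_eq_square)
  then show ?thesis using sub finite_subset[OF sub] card_mono[OF _ sub] by simp
qed simp

context transversal_columns
begin

text \<open>The number of pairs \<open>(w @ v, w' @ v')\<close> with the same columns for which the strips of the heads, of length
\<open>n\<close>, overlap above the left end of the column given by the tails, of length \<open>e\<close>.\<close>

definition close_count :: "nat \<Rightarrow> nat \<Rightarrow> nat" where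
  "close_count n e = (\<Sum>(v, v')\<in>column_pairs e. card (close_pairs n (left_end v)))"

lemma close_count_0: "close_count 0 e = card (column_pairs e)"
proof -
  have "close_pairs 0 x = {([], [])}" for x
    by (auto simp: close_pairs_def column_pairs_def)
  then show ?thesis by (simp add: close_count_def)
qed

lemma close_count_Suc:
  "close_count (Suc n) e \<le> N * close_count n e
     + (\<Sum>(v, v')\<in>column_pairs e. card (split_close_pairs (Suc n) (left_end v)))"
proof -
  have "close_count (Suc n) e \<le> (\<Sum>z\<in>column_pairs e.
      N * card (close_pairs n (left_end (fst z))) + card (split_close_pairs (Suc n) (left_end (fst z))))"
    unfolding close_count_def case_prod_unfold by (intro sum_mono card_close_pairs_Suc)
  then show ?thesis
    by (simp add: close_count_def case_prod_unfold sum.distrib sum_distrib_left)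
qed

lemma N_pos: "0 < K \<Longrightarrow> 0 < N" using N_eq M_pos by simp

lemma real_K: "real K = real N * b"
  using Mb by (simp add: N_eq mult.commute mult.left_commute)

text \<open>The left-hand side bounds the pairs \<open>(w @ v, w' @ v')\<close> with the same columns in which the tails lie in one given
column. Out of all pairs, these are a fraction \<open>b ^ m\<close> for the heads and \<open>b ^ e\<close> for each of the two tails.\<close>

lemma pair_normalisation:
  "real (M ^ m * (K ^ m)\<^sup>2 * (K ^ e)\<^sup>2) = real N ^ (2 * m + 2 * e) * b ^ (m + 2 * e)"
proof -
  have "real (M ^ m * (K ^ m)\<^sup>2 * (K ^ e)\<^sup>2)
      = (b ^ m * real M ^ m) * (real N ^ (2 * m + 2 * e) * b ^ (m + 2 * e))"
    by (simp add: real_K power_mult_distrib power_add mult_2 power2_eq_square power_mult algebra_simps)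
  then show ?thesis by (simp add: bM_power)
qed

lemma power_le_shift: "b ^ (Suc n + e) \<le> a ^ Suc n \<Longrightarrow> b ^ (n + e) \<le> a ^ n"
proof -
  assume *: "b ^ (Suc n + e) \<le> a ^ Suc n"
  have "a ^ Suc n \<le> b * a ^ n" using ab by (auto intro: mult_right_mono)
  then have "b * b ^ (n + e) \<le> b * a ^ n" using * by simp
  then show ?thesis using b_pos by simp
qed

text \<open>The recursion \<open>close_count_Suc\<close> at a fixed difference \<open>e\<close> between the depths in the two directions. Because
\<open>a < b\<close>, the relation \<open>b ^ (n + e) \<le> a ^ n\<close> passes to smaller \<open>n\<close>; it makes the summand 1 in
the number of columns as small as the main term.\<close>

lemma close_count_bound_sum:
  "b ^ (n + e) \<le> a ^ n \<Longrightarrow>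
   real (close_count n e) \<le> b ^ e * real N ^ (2 * e + n) * (1 + (1 + 2 / \<kappa>) * (\<Sum>k<n. (a * real N) ^ Suc k))"
proof (induction n)
  case 0
  have "real (card (column_pairs e)) \<le> real (M ^ 0 * (K ^ 0)\<^sup>2 * (K ^ e)\<^sup>2) * real M ^ e"
    using of_nat_mono[OF card_column_pairs[of e]] by (simp add: mult.commute)
  also have "\<dots> = real N ^ (2 * e) * (b ^ e * (b ^ e * real M ^ e))"
    unfolding pair_normalisation by (simp add: mult_2 power_add)
  also have "\<dots> = b ^ e * real N ^ (2 * e)" unfolding bM_power by simp
  finally show ?case by (simp add: close_count_0)
next
  case (Suc n)
  let ?m = "Suc n"
  let ?S = "\<lambda>n. 1 + (1 + 2 / \<kappa>) * (\<Sum>k<n. (a * real N) ^ Suc k)"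
  let ?T = "real (\<Sum>(v, v')\<in>column_pairs e. card (split_close_pairs (Suc n) (left_end v)))"
  have IH: "real (close_count n e) \<le> b ^ e * real N ^ (2 * e + n) * ?S n"
    using Suc.IH power_le_shift[OF Suc.prems] .
  have "?T \<le> real N ^ (2 * ?m + 2 * e) * b ^ (?m + 2 * e) * (1 + 2 / \<kappa> * a ^ ?m / b ^ (?m + e))"
    using sum_card_split_close_pairs[of n e] unfolding pair_normalisation .
  also have "\<dots> = real N ^ (2 * ?m + 2 * e) * b ^ e * (b ^ (?m + e) + 2 / \<kappa> * a ^ ?m)"
  proof -
    have "b ^ (?m + 2 * e) = b ^ e * b ^ (?m + e)" by (simp add: mult_2 power_add)
    moreover have "b ^ (?m + e) * (1 + 2 / \<kappa> * a ^ ?m / b ^ (?m + e)) = b ^ (?m + e) + 2 / \<kappa> * a ^ ?m"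
      using b_pos by (simp add: distrib_left)
    ultimately show ?thesis by (metis mult.assoc)
  qed
  also have "\<dots> \<le> real N ^ (2 * ?m + 2 * e) * b ^ e * (a ^ ?m + 2 / \<kappa> * a ^ ?m)"
    using Suc.prems b_pos by (intro mult_left_mono add_right_mono) auto
  also have "\<dots> = b ^ e * real N ^ (2 * e + ?m) * ((1 + 2 / \<kappa>) * (a * real N) ^ ?m)"
  proof -
    have "2 * ?m + 2 * e = (2 * e + ?m) + ?m" by simp
    then have N: "real N ^ (2 * ?m + 2 * e) = real N ^ (2 * e + ?m) * real N ^ ?m"
      by (simp only: power_add)
    have "P * Q * B * (A + k * A) = B * P * ((1 + k) * (A * Q))" for P Q B A k :: real
      by (simp add: algebra_simps)
    then show ?thesis unfolding N power_mult_distrib .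
  qed
  finally have T: "?T \<le> b ^ e * real N ^ (2 * e + ?m) * ((1 + 2 / \<kappa>) * (a * real N) ^ ?m)" .
  have "real (close_count ?m e) \<le> real N * real (close_count n e) + ?T"
    using of_nat_mono[OF close_count_Suc[of n e], where 'a = real] by simp
  also have "\<dots> \<le> real N * (b ^ e * real N ^ (2 * e + n) * ?S n)
      + b ^ e * real N ^ (2 * e + ?m) * ((1 + 2 / \<kappa>) * (a * real N) ^ ?m)"
    using IH T by (intro add_mono mult_left_mono) auto
  also have "\<dots> = b ^ e * real N ^ (2 * e + ?m) * (?S n + (1 + 2 / \<kappa>) * (a * real N) ^ ?m)"
  proof -
    have "real N ^ (2 * e + ?m) = real N * real N ^ (2 * e + n)" by simp
    moreover have "x * (B * P * S) + B * (x * P) * T = B * (x * P) * (S + T)" for x B P S T :: real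
      by (simp add: algebra_simps)
    ultimately show ?thesis by (simp only:)
  qed
  also have "?S n + (1 + 2 / \<kappa>) * (a * real N) ^ ?m = ?S ?m" by (simp add: distrib_left)
  finally show ?case .
qed

text \<open>The bound of \<open>close_count_bound_sum\<close> with the geometric series summed.\<close>

definition pair_const :: real where
  "pair_const = 1 + (1 + 2 / \<kappa>) / (1 - a * real N)"

lemma close_count_bound:
  assumes "b ^ (n + e) \<le> a ^ n"
  shows "real (close_count n e) \<le> b ^ e * real N ^ (2 * e + n) * pair_const"
proof -
  let ?x = "a * real N"
  have x: "0 \<le> ?x" "?x < 1" using aN ab by auto
  have "(\<Sum>k<n. ?x ^ Suc k) \<le> (\<Sum>k<n. ?x ^ k)"
    using x by (intro sum_mono) (simp add: mult_left_le_one_le)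
  also have "\<dots> \<le> 1 / (1 - ?x)" using x by (simp add: sum_gp_strict divide_right_mono)
  finally have "(1 + 2 / \<kappa>) * (\<Sum>k<n. ?x ^ Suc k) \<le> (1 + 2 / \<kappa>) * (1 / (1 - ?x))"
    using \<kappa> by (intro mult_left_mono) auto
  then have "1 + (1 + 2 / \<kappa>) * (\<Sum>k<n. ?x ^ Suc k) \<le> pair_const" by (simp add: pair_const_def)
  then have "b ^ e * real N ^ (2 * e + n) * (1 + (1 + 2 / \<kappa>) * (\<Sum>k<n. ?x ^ Suc k))
      \<le> b ^ e * real N ^ (2 * e + n) * pair_const"
    using b_pos by (intro mult_left_mono) auto
  then show ?thesis using close_count_bound_sum[OF assms] by linarith
qed

text \<open>An approximate square of side \<open>a ^ n\<close>, given a word of length \<open>p\<close> with \<open>b ^ p\<close> comparable to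
\<open>a ^ n\<close>. Horizontally it is the column of the whole word; vertically, the height of the lower edge of the strip of the first
\<open>n\<close> letters above the left end of this column, in units of \<open>a ^ n\<close>.\<close>

definition cell :: "nat \<Rightarrow> nat list \<Rightarrow> int \<times> int" where
  "cell n w = (int (column_index w), \<lfloor>elevation (take n w) (left_end (drop n w)) / a ^ n\<rfloor>)"

text \<open>Two heights in the same half-open interval of length \<open>a ^ n\<close> differ by strictly less than \<open>a ^ n\<close>, so
the strips overlap.\<close>

lemma card_same_cell_le:
  "card {(w, w') \<in> words (n + e) \<times> words (n + e). cell n w = cell n w'} \<le> close_count n e"
proof -
  let ?A = "{(w, w') \<in> words (n + e) \<times> words (n + e). cell n w = cell n w'}"
  let ?B = "SIGMA z:column_pairs e. close_pairs n (left_end (fst z))"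
  let ?f = "\<lambda>(w, w'). ((drop n w, drop n w'), (take n w, take n w'))"
  have "inj_on ?f ?A" by (auto simp: inj_on_def) (metis append_take_drop_id)+
  moreover have "?f ` ?A \<subseteq> ?B"
  proof (clarsimp)
    fix w w' assume w: "w \<in> words (n + e)" "w' \<in> words (n + e)" "cell n w = cell n w'"
    let ?v = "drop n w" and ?v' = "drop n w'" and ?u = "take n w" and ?u' = "take n w'"
    have mem: "?v \<in> words e" "?v' \<in> words e" "?u \<in> words n" "?u' \<in> words n"
      using w by (auto simp: words_def dest: in_set_takeD in_set_dropD)
    have "column_index (?u @ ?v) = column_index (?u' @ ?v')" using w by (simp add: cell_def)
    then have ci: "column_index ?u = column_index ?u'" "column_index ?v = column_index ?v'"
      using column_index_append_eq_iff[of ?v ?v' ?u ?u'] mem by (auto simp: words_def)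
    then have le: "left_end ?v' = left_end ?v" using mem by (intro left_end_eq) (auto simp: words_def)
    let ?h = "elevation ?u (left_end ?v)" and ?h' = "elevation ?u' (left_end ?v)"
    have "\<lfloor>?h / a ^ n\<rfloor> = \<lfloor>?h' / a ^ n\<rfloor>" using w le by (simp add: cell_def)
    then have "\<bar>?h / a ^ n - ?h' / a ^ n\<bar> < 1" by linarith
    then have "\<bar>?h - ?h'\<bar> / a ^ n < 1" using ab by (simp add: abs_divide flip: diff_divide_distrib)
    then have "\<bar>?h - ?h'\<bar> < a ^ n" using ab by simp
    then show "(?v, ?v') \<in> column_pairs e \<and> (?u, ?u') \<in> close_pairs n (left_end ?v)"
      using ci mem by (simp add: column_pairs_def close_pairs_def)
  qed
  moreover have "finite ?B" using finite_column_pairs finite_close_pairs by (intro finite_SigmaI) auto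
  ultimately have "card ?A \<le> card ?B" by (metis (no_types, lifting) card_inj_on_le)
  also have "\<dots> = close_count n e"
    using finite_column_pairs finite_close_pairs by (simp add: close_count_def case_prod_unfold)
  finally show ?thesis .
qed

text \<open>The probability that two independent uniform words of length \<open>p\<close> share a cell. The factor
\<open>b ^ e / N ^ n\<close> from the count equals \<open>b ^ p / K ^ n\<close>.\<close>

lemma same_cell_fraction:
  assumes p: "b ^ p \<le> a ^ n" "n \<le> p" and K: "0 < K"
  shows "real (card {(w, w') \<in> words p \<times> words p. cell n w = cell n w'}) / (real N ^ p)\<^sup>2
    \<le> pair_const * (a / real K) ^ n"
proof -
  obtain e where e: "p = n + e" using p(2) le_Suc_ex by blast
  have Np: "0 < real N" using N_pos K by simp
  have "real (card {(w, w') \<in> words p \<times> words p. cell n w = cell n w'}) \<le> real (close_count n e)"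
    using card_same_cell_le[of n e] by (simp add: e)
  also have "\<dots> \<le> b ^ e * real N ^ (2 * e + n) * pair_const"
    using p unfolding e by (intro close_count_bound)
  finally have "real (card {(w, w') \<in> words p \<times> words p. cell n w = cell n w'}) / (real N ^ p)\<^sup>2
      \<le> b ^ e * real N ^ (2 * e + n) * pair_const / (real N ^ p)\<^sup>2"
    by (intro divide_right_mono) auto
  also have "\<dots> = pair_const * (b ^ p / real K ^ n)"
  proof -
    have "(real N ^ p)\<^sup>2 = real N ^ (2 * e + n) * real N ^ n"
      by (simp add: e power2_eq_square power_add mult_2)
    moreover have "b ^ p / real K ^ n = b ^ e / real N ^ n"
      using b_pos by (simp add: e real_K power_add power_mult_distrib)
    ultimately show ?thesis using Np by simp
  qed
  also have "\<dots> \<le> pair_const * (a ^ n / real K ^ n)"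
  proof -
    have "0 \<le> pair_const" using \<kappa> aN by (simp add: pair_const_def)
    then show ?thesis using p by (intro mult_left_mono divide_right_mono) auto
  qed
  finally show ?thesis by (simp add: power_divide)
qed

text \<open>The term \<open>M\<close> comes from the ratio of \<open>a ^ n\<close> to the width of a cell, and \<open>1 / (b - a)\<close>, once for
each of two points, from the slope of a strip.\<close>

definition near_const :: nat where
  "near_const = nat \<lceil>5 + real M + 2 / (b - a)\<rceil>"

text \<open>A point of the cylinder of \<open>w\<close> is within a bounded number of cells of the cell of \<open>w\<close>: over a column of
width \<open>b ^ p \<le> a ^ n\<close> the lower edge of the strip, whose slope is bounded, rises by at most a
multiple of \<open>a ^ n\<close>.\<close>

lemma cell_near_point:
  assumes w: "w \<in> words p" and p: "b ^ p \<le> a ^ n" "n \<le> p"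
    and q: "0 \<le> q1" "q1 \<le> 1" "0 \<le> q2" "q2 \<le> 1"
    and x: "x = left_end w + b ^ p * q1"
    and y: "y = elevation (take n w) (left_end (drop n w) + b ^ (p - n) * q1) + a ^ n * q2"
  shows "\<bar>x / b ^ p - fst (cell n w)\<bar> \<le> 1" "\<bar>y / a ^ n - snd (cell n w)\<bar> \<le> 2 + 1 / (b - a)"
proof -
  have len: "length w = p" and take: "set (take n w) \<subseteq> {1..N}" "length (take n w) = n"
    using w p by (auto simp: words_def dest: in_set_takeD)
  have "x / b ^ p = real (column_index w) + q1"
    using b_pos by (simp add: x left_end_def len add_divide_distrib)
  then show "\<bar>x / b ^ p - fst (cell n w)\<bar> \<le> 1" using q by (simp add: cell_def)
  let ?u = "take n w" and ?v = "drop n w"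
  let ?h = "elevation ?u (left_end ?v)"
  \<comment> \<open>The vertical distance from the reference height is the rise of the edge plus a part of the thickness.\<close>
  have "y - ?h = slope ?u * (b ^ (p - n) * q1) + a ^ n * q2"
    using elevation_affine[of ?u "left_end ?v"] elevation_affine[of ?u "left_end ?v + b ^ (p - n) * q1"]
    by (simp add: y algebra_simps)
  then have "\<bar>y - ?h\<bar> \<le> \<bar>slope ?u * (b ^ (p - n) * q1)\<bar> + \<bar>a ^ n * q2\<bar>" by linarith
  also have "\<dots> \<le> b ^ n / (b - a) * b ^ (p - n) + a ^ n"
  proof (rule add_mono)
    show "\<bar>slope ?u * (b ^ (p - n) * q1)\<bar> \<le> b ^ n / (b - a) * b ^ (p - n)"
      unfolding abs_mult using slope_bound[OF take(1)] take(2) q b_pos ab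
      by (intro mult_mono) (auto simp: mult_left_le)
    show "\<bar>a ^ n * q2\<bar> \<le> a ^ n" using q ab by (simp add: abs_mult mult_left_le)
  qed
  also have "b ^ n / (b - a) * b ^ (p - n) = b ^ p / (b - a)"
    using p(2) by (simp flip: power_add)
  also have "\<dots> \<le> a ^ n / (b - a)" using p ab by (intro divide_right_mono) auto
  finally have "\<bar>y - ?h\<bar> / a ^ n \<le> (a ^ n / (b - a) + a ^ n) / a ^ n"
    using ab by (intro divide_right_mono) auto
  also have "\<dots> = 1 / (b - a) + 1" using ab by (simp add: add_divide_distrib)
  finally have "\<bar>y / a ^ n - ?h / a ^ n\<bar> \<le> 1 / (b - a) + 1"
    using ab by (simp add: abs_divide flip: diff_divide_distrib)
  then show "\<bar>y / a ^ n - snd (cell n w)\<bar> \<le> 2 + 1 / (b - a)"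
    unfolding cell_def snd_conv by linarith
qed

text \<open>Here \<open>V\<close> is the planar projection of a set of diameter at most \<open>a ^ n\<close>. Two words with points in \<open>V\<close> have cells whose coordinates differ by at most
\<open>near_const\<close>, since in the units of the cells the points differ by at most \<open>M\<close> and 1.\<close>

lemma few_cells_near:
  assumes p: "b ^ p \<le> a ^ n" "a ^ n \<le> real M * b ^ p" "n \<le> p" and S: "S \<subseteq> words p"
    and pts: "\<And>w. w \<in> S \<Longrightarrow> \<exists>x y q1 q2. (x, y) \<in> V \<and> 0 \<le> q1 \<and> q1 \<le> 1 \<and> 0 \<le> q2 \<and> q2 \<le> 1 \<and>
       x = left_end w + b ^ p * q1 \<and>
       y = elevation (take n w) (left_end (drop n w) + b ^ (p - n) * q1) + a ^ n * q2"
    and V: "\<And>x y x' y'. (x, y) \<in> V \<Longrightarrow> (x', y') \<in> V \<Longrightarrow> \<bar>x - x'\<bar> \<le> a ^ n \<and> \<bar>y - y'\<bar> \<le> a ^ n"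
  shows "finite (cell n ` S) \<and> card (cell n ` S) \<le> (2 * near_const + 1)\<^sup>2"
proof (rule card_le_of_pairwise_near)
  fix c c' assume "c \<in> cell n ` S" "c' \<in> cell n ` S"
  then obtain w w' where w: "w \<in> S" "c = cell n w" "w' \<in> S" "c' = cell n w'" by auto
  obtain x y where xy: "(x, y) \<in> V" "\<bar>x / b ^ p - fst c\<bar> \<le> 1" "\<bar>y / a ^ n - snd c\<bar> \<le> 2 + 1 / (b - a)"
    using pts[OF w(1)] cell_near_point[OF _ p(1,3)] w S by blast
  obtain x' y' where xy': "(x', y') \<in> V" "\<bar>x' / b ^ p - fst c'\<bar> \<le> 1" "\<bar>y' / a ^ n - snd c'\<bar> \<le> 2 + 1 / (b - a)"
    using pts[OF w(3)] cell_near_point[OF _ p(1,3)] w S by blast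
  have an: "0 < a ^ n" "0 < b ^ p" using ab by auto
  have "\<bar>x - x'\<bar> / b ^ p \<le> real M"
    using V[OF xy(1) xy'(1)] p(2) an by (simp add: pos_divide_le_eq)
  then have dx: "\<bar>x / b ^ p - x' / b ^ p\<bar> \<le> real M"
    using an by (simp add: abs_divide flip: diff_divide_distrib)
  have "\<bar>y - y'\<bar> / a ^ n \<le> 1" using V[OF xy(1) xy'(1)] an by (simp add: pos_divide_le_eq)
  then have dy: "\<bar>y / a ^ n - y' / a ^ n\<bar> \<le> 1"
    using an by (simp add: abs_divide flip: diff_divide_distrib)
  have nc: "5 + real M + 2 * (1 / (b - a)) \<le> real near_const"
    unfolding near_const_def using real_nat_ceiling_ge[of "5 + real M + 2 / (b - a)"] by simp
  have pos: "0 \<le> 1 / (b - a)" using ab by simp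
  have "\<bar>real_of_int (fst c) - real_of_int (fst c')\<bar> \<le> real near_const"
    using xy(2) xy'(2) dx nc pos by linarith
  moreover have "\<bar>real_of_int (snd c) - real_of_int (snd c')\<bar> \<le> real near_const"
    using xy(3) xy'(3) dy nc pos by linarith
  ultimately show "\<bar>fst c - fst c'\<bar> \<le> int near_const \<and> \<bar>snd c - snd c'\<bar> \<le> int near_const" by linarith
qed

lemma depth_exists: "\<exists>p\<ge>n. b ^ p \<le> a ^ n \<and> a ^ n \<le> real M * b ^ p"
proof -
  obtain p0 where "b ^ p0 < a ^ n" using real_arch_pow_inv[of "a ^ n" b] ab by auto
  define p where "p = (LEAST p. b ^ p \<le> a ^ n)"
  have p: "b ^ p \<le> a ^ n" unfolding p_def by (rule LeastI[of _ p0]) (use \<open>b ^ p0 < a ^ n\<close> in simp)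
  have "n \<le> p"
  proof (rule ccontr)
    assume "\<not> n \<le> p"
    then have "p < n" by simp
    then have "b ^ n < b ^ p" using ab by (intro power_strict_decreasing) auto
    moreover have "a ^ n \<le> b ^ n" using ab by (intro power_mono) auto
    ultimately show False using p by linarith
  qed
  moreover have "a ^ n \<le> real M * b ^ p"
  proof (cases p)
    case 0
    then show ?thesis using M_pos ab power_le_one[of a n] by simp
  next
    case (Suc p')
    have "\<not> b ^ p' \<le> a ^ n" using not_less_Least[of p' "\<lambda>p. b ^ p \<le> a ^ n"] Suc by (simp add: p_def)
    moreover have "real M * b ^ p = b ^ p'" using Mb by (simp add: Suc flip: mult.assoc)
    ultimately show ?thesis by simp
  qed
  ultimately show ?thesis using p by blast
qed

end

section \<open>Word matrices of the skew system\<close>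

lemma space_map_nth:
  "space_map a b d u v l t1 t2 t3 i x $ 1 = b * x $ 1 + t1 i"
  "space_map a b d u v l t1 t2 t3 i x $ 2 = d i * x $ 1 + a * x $ 2 + t2 i"
  "space_map a b d u v l t1 t2 t3 i x $ 3 = u i * x $ 1 + v i * x $ 2 + l i * x $ 3 + t3 i"
  by (simp_all add: space_map_def space_mat_def matrix_vector_mult_def sum_3)

lemma foldr_comp_append: "foldr F (w @ w') x = foldr F w (foldr F w' x)"
  by simp

locale skew_system = transversal_columns +
  fixes t1 u v l t3 :: "nat \<Rightarrow> real" and A :: "nat \<Rightarrow> real^3^3" and F :: "nat \<Rightarrow> real^3 \<Rightarrow> real^3"
  assumes K_pos: "0 < K"
    and t1: "\<And>i. i \<in> {1..N} \<Longrightarrow> t1 i = b * real (col i)"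
    and A_def: "A = (\<lambda>i. space_mat a b (d i) (u i) (v i) (l i))"
    and F_def: "F = space_map a b d u v l t1 s t3"
    and l: "\<And>i. i \<in> {1..N} \<Longrightarrow> 0 < \<bar>l i\<bar> \<and> \<bar>l i\<bar> < a"
    and cube: "\<And>i. i \<in> {1..N} \<Longrightarrow> F i ` cbox 0 1 \<subseteq> cbox 0 1"
begin

text \<open>The last row of the matrix of a word (lemma \<open>matrix_word_eq\<close>).\<close>

fun shear31 :: "nat list \<Rightarrow> real" and shear32 :: "nat list \<Rightarrow> real" and scale33 :: "nat list \<Rightarrow> real" where
  "shear31 [] = 0"
| "shear31 (i # w) = u i * b ^ length w + v i * slope w + l i * shear31 w"
| "shear32 [] = 0"
| "shear32 (i # w) = v i * a ^ length w + l i * shear32 w"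
| "scale33 [] = 1"
| "scale33 (i # w) = l i * scale33 w"

lemma matrix_word_eq:
  "matrix_word A w = vector [vector [b ^ length w, 0, 0], vector [slope w, a ^ length w, 0],
     vector [shear31 w, shear32 w, scale33 w]]"
proof (induction w)
  case Nil
  show ?case by (simp add: matrix_word_def vec_eq_iff forall_3 mat_def)
next
  case (Cons i w)
  have "matrix_word A (i # w) = A i ** matrix_word A w" by (simp add: matrix_word_def)
  then show ?case unfolding Cons.IH
    by (simp add: A_def space_mat_def vec_eq_iff forall_3 matrix_matrix_mult_def sum_3 algebra_simps)
qed

lemma F_diff: "F i x - F i y = A i *v (x - y)"
  by (simp add: F_def space_map_def A_def matrix_vector_mult_diff_distrib)

lemma foldr_F_diff: "foldr F w x - foldr F w y = matrix_word A w *v (x - y)"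
proof (induction w)
  case (Cons i w)
  show ?case using Cons
    by (simp add: F_diff matrix_word_def matrix_vector_mul_assoc del: matrix_vector_mult_diff_distrib)
qed (simp add: matrix_word_def)

lemma N_gt_0: "0 < N" using N_pos K_pos by simp

text \<open>A common bound for the off-diagonal entries relative to the diagonal entry of their column, whose existence is part of
lemma \<open>shear_bounds\<close>.\<close>

definition shear_const :: real where
  "shear_const = (SOME C. 1 \<le> C \<and> (\<forall>w. set w \<subseteq> {1..N} \<longrightarrow>
      \<bar>slope w\<bar> \<le> C * b ^ length w \<and> \<bar>shear31 w\<bar> \<le> C * b ^ length w \<and>
      \<bar>shear32 w\<bar> \<le> C * a ^ length w))"

text \<open>Each off-diagonal entry satisfies a recursion in which it is multiplied by something smaller in absolute value than the
contraction of the column it stands in: \<open>l i\<close> against \<open>a\<close> in the second column, and \<open>a\<close> or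
\<open>l i\<close> against \<open>b\<close> in the first. The constants \<open>B / (a - \<Lambda>)\<close> and \<open>C\<^sub>U\<close> are the
fixed points of these recursions.\<close>

lemma shear_bounds:
  "1 \<le> shear_const"
  "set w \<subseteq> {1..N} \<Longrightarrow> \<bar>slope w\<bar> \<le> shear_const * b ^ length w"
  "set w \<subseteq> {1..N} \<Longrightarrow> \<bar>shear31 w\<bar> \<le> shear_const * b ^ length w"
  "set w \<subseteq> {1..N} \<Longrightarrow> \<bar>shear32 w\<bar> \<le> shear_const * a ^ length w"
proof -
  have absorb: "(k * (p - q) + q * k) * x = k * (p * x)" for k p q x :: real
    by (simp add: algebra_simps)
  define \<Lambda> where "\<Lambda> = Max ((\<lambda>i. \<bar>l i\<bar>) ` {1..N})"
  define B where "B = Max ((\<lambda>i. \<bar>u i\<bar> + \<bar>v i\<bar>) ` {1..N})"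
  have ne: "{1..N} \<noteq> {}" using N_gt_0 by auto
  have \<Lambda>: "\<bar>l i\<bar> \<le> \<Lambda>" if "i \<in> {1..N}" for i unfolding \<Lambda>_def using that by (intro Max_ge) auto
  have \<Lambda>a: "\<Lambda> < a" unfolding \<Lambda>_def using ne l by (subst Max_less_iff) auto
  have \<Lambda>0: "0 \<le> \<Lambda>" using \<Lambda>[of 1] N_gt_0 by (auto intro: order_trans[OF abs_ge_zero])
  have B: "\<bar>u i\<bar> + \<bar>v i\<bar> \<le> B" if "i \<in> {1..N}" for i unfolding B_def using that by (intro Max_ge) auto
  have uB: "\<bar>u i\<bar> \<le> B" and vB: "\<bar>v i\<bar> \<le> B" if "i \<in> {1..N}" for i using B[OF that] by auto
  have B0: "0 \<le> B" using uB[of 1] N_gt_0 by (auto intro: order_trans[OF abs_ge_zero])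
  have V: "\<bar>shear32 w\<bar> \<le> B / (a - \<Lambda>) * a ^ length w" if "set w \<subseteq> {1..N}" for w
    using that
  proof (induction w)
    case (Cons i w)
    let ?x = "a ^ length w" and ?C = "B / (a - \<Lambda>)"
    have "\<bar>shear32 (i # w)\<bar> \<le> \<bar>v i\<bar> * ?x + \<bar>l i\<bar> * \<bar>shear32 w\<bar>"
      using abs_triangle_ineq[of "v i * ?x" "l i * shear32 w"] ab by (simp add: abs_mult)
    also have "\<dots> \<le> B * ?x + \<Lambda> * (?C * ?x)"
      using Cons vB \<Lambda> \<Lambda>0 B0 ab by (intro add_mono mult_mono) auto
    also have "\<dots> = (B + \<Lambda> * ?C) * ?x" by (simp add: algebra_simps)
    also have "B + \<Lambda> * ?C = ?C * (a - \<Lambda>) + \<Lambda> * ?C" using \<Lambda>a by simp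
    also have "(?C * (a - \<Lambda>) + \<Lambda> * ?C) * ?x = ?C * (a * ?x)" by (rule absorb)
    finally show ?case by simp
  qed (use \<Lambda>a B0 in simp)
  define C\<^sub>U where "C\<^sub>U = (B + B / (b - a)) / (b - \<Lambda>)"
  have CU: "B + B / (b - a) = C\<^sub>U * (b - \<Lambda>)" using \<Lambda>a ab by (simp add: C\<^sub>U_def)
  have U: "\<bar>shear31 w\<bar> \<le> C\<^sub>U * b ^ length w" if "set w \<subseteq> {1..N}" for w
    using that
  proof (induction w)
    case (Cons i w)
    let ?x = "b ^ length w" and ?C = "C\<^sub>U"
    have "\<bar>slope w\<bar> \<le> ?x / (b - a)" using slope_bound Cons.prems by simp
    have "\<bar>shear31 (i # w)\<bar> \<le> \<bar>u i\<bar> * ?x + \<bar>v i\<bar> * \<bar>slope w\<bar> + \<bar>l i\<bar> * \<bar>shear31 w\<bar>"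
      using abs_triangle_ineq[of "u i * ?x + v i * slope w" "l i * shear31 w"]
        abs_triangle_ineq[of "u i * ?x" "v i * slope w"] b_pos by (simp add: abs_mult)
    also have "\<dots> \<le> B * ?x + B * (?x / (b - a)) + \<Lambda> * (?C * ?x)"
      using Cons uB vB \<Lambda> \<Lambda>0 B0 b_pos slope_bound[of w] by (intro add_mono mult_mono) auto
    also have "\<dots> = (B + B / (b - a) + \<Lambda> * ?C) * ?x" by (simp add: algebra_simps)
    also have "B + B / (b - a) = ?C * (b - \<Lambda>)" by (rule CU)
    also have "(?C * (b - \<Lambda>) + \<Lambda> * ?C) * ?x = ?C * (b * ?x)" by (rule absorb)
    finally show ?case by simp
  next
    case Nil
    have "0 \<le> C\<^sub>U" unfolding C\<^sub>U_def using \<Lambda>a B0 ab by (intro divide_nonneg_nonneg add_nonneg_nonneg) auto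
    then show ?case by simp
  qed
  define C where "C = Max {1, 1 / (b - a), C\<^sub>U, B / (a - \<Lambda>)}"
  have C: "1 \<le> C" "1 / (b - a) \<le> C" "C\<^sub>U \<le> C" "B / (a - \<Lambda>) \<le> C"
    unfolding C_def by (auto intro!: Max_ge)
  have "\<bar>slope w\<bar> \<le> C * b ^ length w \<and> \<bar>shear31 w\<bar> \<le> C * b ^ length w \<and> \<bar>shear32 w\<bar> \<le> C * a ^ length w"
    if "set w \<subseteq> {1..N}" for w
  proof (intro conjI)
    have "\<bar>slope w\<bar> \<le> 1 / (b - a) * b ^ length w" using slope_bound[OF that] by simp
    also have "\<dots> \<le> C * b ^ length w" using C b_pos by (intro mult_right_mono) auto
    finally show "\<bar>slope w\<bar> \<le> C * b ^ length w" .
    show "\<bar>shear31 w\<bar> \<le> C * b ^ length w"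
      by (rule order_trans[OF U[OF that] mult_right_mono]) (use C b_pos in auto)
    show "\<bar>shear32 w\<bar> \<le> C * a ^ length w"
      by (rule order_trans[OF V[OF that] mult_right_mono]) (use C ab in auto)
  qed
  then have "\<exists>C. 1 \<le> C \<and> (\<forall>w. set w \<subseteq> {1..N} \<longrightarrow>
      \<bar>slope w\<bar> \<le> C * b ^ length w \<and> \<bar>shear31 w\<bar> \<le> C * b ^ length w \<and>
      \<bar>shear32 w\<bar> \<le> C * a ^ length w)" using C(1) by blast
  note * = someI_ex[OF this, folded shear_const_def]
  show "1 \<le> shear_const" using * by blast
  show "set w \<subseteq> {1..N} \<Longrightarrow> \<bar>slope w\<bar> \<le> shear_const * b ^ length w"
    "set w \<subseteq> {1..N} \<Longrightarrow> \<bar>shear31 w\<bar> \<le> shear_const * b ^ length w"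
    "set w \<subseteq> {1..N} \<Longrightarrow> \<bar>shear32 w\<bar> \<le> shear_const * a ^ length w" using * by blast+
qed

lemma scale33_bound: "set w \<subseteq> {1..N} \<Longrightarrow> \<bar>scale33 w\<bar> \<le> a ^ length w"
proof (induction w)
  case (Cons i w)
  then show ?case using l[of i] by (auto simp: abs_mult intro!: mult_mono)
qed simp

lemma matrix_word_vec:
  "(matrix_word A w *v x) $ 1 = b ^ length w * x $ 1"
  "(matrix_word A w *v x) $ 2 = slope w * x $ 1 + a ^ length w * x $ 2"
  "(matrix_word A w *v x) $ 3 = shear31 w * x $ 1 + shear32 w * x $ 2 + scale33 w * x $ 3"
  by (simp_all add: matrix_word_eq matrix_vector_mult_def sum_3)

lemma a_pow_le_b_pow: "a ^ n \<le> b ^ n"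
  using ab by (intro power_mono) auto

text \<open>The image of a box of width \<open>h / b ^ n\<close> and height and depth \<open>r / a ^ n\<close> has diameter of the order
\<open>h + r\<close>.\<close>

lemma norm_matrix_word:
  assumes w: "set w \<subseteq> {1..N}"
    and h: "b ^ length w * \<bar>x $ 1\<bar> \<le> h" and r: "a ^ length w * \<bar>x $ 2\<bar> \<le> r" "a ^ length w * \<bar>x $ 3\<bar> \<le> r"
  shows "norm (matrix_word A w *v x) \<le> 3 * shear_const * (h + r)"
proof -
  let ?n = "length w" and ?C = shear_const
  note C = shear_bounds(1)
  have h0: "0 \<le> h" "0 \<le> r" using h r(1) b_pos ab by (smt (verit) abs_ge_zero mult_nonneg_nonneg zero_le_power)+
  have s: "\<bar>slope w * x $ 1\<bar> \<le> ?C * h"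
  proof -
    have "\<bar>slope w\<bar> * \<bar>x $ 1\<bar> \<le> (?C * b ^ ?n) * \<bar>x $ 1\<bar>" using shear_bounds(2)[OF w] by (intro mult_right_mono) auto
    also have "\<dots> \<le> ?C * h" using C mult_left_mono[OF h, of ?C] by (simp add: mult.assoc)
    finally show ?thesis by (simp add: abs_mult)
  qed
  have U: "\<bar>shear31 w * x $ 1\<bar> \<le> ?C * h"
  proof -
    have "\<bar>shear31 w\<bar> * \<bar>x $ 1\<bar> \<le> (?C * b ^ ?n) * \<bar>x $ 1\<bar>" using shear_bounds(3)[OF w] by (intro mult_right_mono) auto
    also have "\<dots> \<le> ?C * h" using C mult_left_mono[OF h, of ?C] by (simp add: mult.assoc)
    finally show ?thesis by (simp add: abs_mult)
  qed
  have V: "\<bar>shear32 w * x $ 2\<bar> \<le> ?C * r"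
  proof -
    have "\<bar>shear32 w\<bar> * \<bar>x $ 2\<bar> \<le> (?C * a ^ ?n) * \<bar>x $ 2\<bar>" using shear_bounds(4)[OF w] by (intro mult_right_mono) auto
    also have "\<dots> \<le> ?C * r" using C mult_left_mono[OF r(1), of ?C] by (simp add: mult.assoc)
    finally show ?thesis by (simp add: abs_mult)
  qed
  have L: "\<bar>scale33 w * x $ 3\<bar> \<le> r"
  proof -
    have "\<bar>scale33 w\<bar> * \<bar>x $ 3\<bar> \<le> a ^ ?n * \<bar>x $ 3\<bar>" using scale33_bound[OF w] by (intro mult_right_mono) auto
    then show ?thesis using r(2) by (simp add: abs_mult)
  qed
  have c: "h \<le> ?C * h" "r \<le> ?C * r" using C h0 mult_right_mono[of 1 ?C] by auto
  have "\<bar>b ^ ?n * x $ 1\<bar> \<le> h" "\<bar>a ^ ?n * x $ 2\<bar> \<le> r" using h r ab by (auto simp: abs_mult)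
  then have "(\<Sum>i\<in>UNIV. \<bar>(matrix_word A w *v x) $ i\<bar>) \<le> 3 * (?C * h) + 3 * (?C * r)"
    unfolding sum_3 matrix_word_vec using s U V L c by linarith
  moreover have "norm (matrix_word A w *v x) \<le> (\<Sum>i\<in>UNIV. \<bar>(matrix_word A w *v x) $ i\<bar>)"
    by (rule norm_le_l1_cart)
  ultimately show ?thesis by (simp add: algebra_simps)
qed

lemma norm_matrix_word_contract:
  assumes w: "set w \<subseteq> {1..N}"
  shows "norm (matrix_word A w *v x) \<le> 6 * shear_const * b ^ length w * norm x"
proof -
  have "b ^ length w * \<bar>x $ 1\<bar> \<le> b ^ length w * norm x"
    using b_pos component_le_norm_cart[of x 1] by (intro mult_left_mono) auto
  moreover have "a ^ length w * \<bar>x $ i\<bar> \<le> b ^ length w * norm x" for i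
    using ab a_pow_le_b_pow component_le_norm_cart[of x i] by (intro mult_mono) auto
  ultimately have "norm (matrix_word A w *v x)
      \<le> 3 * shear_const * (b ^ length w * norm x + b ^ length w * norm x)"
    using norm_matrix_word[OF w] by blast
  then show ?thesis by (simp add: algebra_simps)
qed

text \<open>Of the entries, all are at most of the order \<open>b ^ n\<close> and one attains it; of the minors of order 2, all
are at most of the order \<open>(b * a) ^ n\<close>, since two different columns contribute to each, and the upper left one attains it.\<close>

lemma singular_values_matrix_word:
  assumes w: "set w \<subseteq> {1..N}" and sv: "singular_values (matrix_word A w) = (\<alpha>1, \<alpha>2, \<alpha>3)"
  shows "1 / 2 * b ^ length w \<le> \<alpha>1 \<and> \<alpha>1 \<le> 5 * shear_const\<^sup>2 * b ^ length w \<and>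
    1 / 2 * (b * a) ^ length w \<le> \<alpha>1 * \<alpha>2 \<and> \<alpha>1 * \<alpha>2 \<le> 5 * shear_const\<^sup>2 * (b * a) ^ length w"
proof -
  let ?C = shear_const and ?b = "b ^ length w" and ?a = "a ^ length w"
  let ?s = "slope w" and ?U = "shear31 w" and ?V = "shear32 w" and ?L = "scale33 w"
  note C = shear_bounds(1)
  note svb = singular_values_bounds[OF sv]
  have pos: "0 < ?b" "0 < ?a" using ab by auto
  have C2: "?C \<le> ?C\<^sup>2" using C by (simp add: power2_eq_square)
  have bd: "\<bar>?s\<bar> \<le> ?C * ?b" "\<bar>?U\<bar> \<le> ?C * ?b" "\<bar>?V\<bar> \<le> ?C * ?a" "\<bar>?L\<bar> \<le> ?a"
    using shear_bounds(2-4)[OF w] scale33_bound[OF w] by auto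
  have La: "\<bar>?L\<bar> \<le> ?C * ?a" using bd(4) C pos mult_right_mono[of 1 ?C ?a] by linarith
  have le: "?a \<le> ?b" by (rule a_pow_le_b_pow)
  have Cab: "?C * ?a \<le> ?C * ?b" using le C by (intro mult_left_mono) auto
  have sq: "x\<^sup>2 \<le> y\<^sup>2" if "\<bar>x\<bar> \<le> y" for x y :: real using that by (metis abs_ge_zero abs_le_square_iff abs_of_nonneg order_trans)
  have e1: "sum_sq_entries (matrix_word A w) = ?b\<^sup>2 + ?s\<^sup>2 + ?a\<^sup>2 + ?U\<^sup>2 + ?V\<^sup>2 + ?L\<^sup>2"
    by (simp add: sum_sq_entries_def matrix_word_eq sum_3)
  have e2: "sum_sq_minors (matrix_word A w) = (?b * ?a)\<^sup>2 + (?b * ?V)\<^sup>2 + (?b * ?L)\<^sup>2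
     + (?s * ?V - ?a * ?U)\<^sup>2 + (?s * ?L)\<^sup>2 + (?a * ?L)\<^sup>2"
    by (simp add: sum_sq_minors_def minor2_def matrix_word_eq)
  have bC: "?b \<le> ?C * ?b" "?a \<le> ?C * ?a" using C pos mult_right_mono[of 1 ?C] by auto
  have e1u: "sum_sq_entries (matrix_word A w) \<le> 6 * (?C * ?b)\<^sup>2"
  proof -
    have "\<bar>?b\<bar> \<le> ?C * ?b" "\<bar>?a\<bar> \<le> ?C * ?b" "\<bar>?V\<bar> \<le> ?C * ?b" "\<bar>?L\<bar> \<le> ?C * ?b"
      using bd La Cab bC pos by linarith+
    from sq[OF this(1)] sq[OF this(2)] sq[OF this(3)] sq[OF this(4)] sq[OF bd(1)] sq[OF bd(2)]
    show ?thesis unfolding e1 by linarith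
  qed
  have m: "\<bar>x * y\<bar> \<le> ?C\<^sup>2 * (?b * ?a)" if "\<bar>x\<bar> \<le> ?C * ?b" "\<bar>y\<bar> \<le> ?C * ?a" for x y
  proof -
    have "\<bar>x\<bar> * \<bar>y\<bar> \<le> (?C * ?b) * (?C * ?a)" using that C pos by (intro mult_mono) auto
    then show ?thesis by (simp add: abs_mult power2_eq_square ac_simps)
  qed
  let ?Q = "2 * ?C\<^sup>2 * (?b * ?a)"
  have Q0: "0 \<le> ?C\<^sup>2 * (?b * ?a)" using pos by simp
  have e2u: "sum_sq_minors (matrix_word A w) \<le> 6 * ?Q\<^sup>2"
  proof -
    have b': "\<bar>?b\<bar> \<le> ?C * ?b" "\<bar>?a\<bar> \<le> ?C * ?a" "\<bar>?a\<bar> \<le> ?C * ?b" using bC Cab pos by linarith+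
    have "\<bar>?b * ?a\<bar> \<le> ?Q" "\<bar>?b * ?V\<bar> \<le> ?Q" "\<bar>?b * ?L\<bar> \<le> ?Q" "\<bar>?s * ?L\<bar> \<le> ?Q" "\<bar>?a * ?L\<bar> \<le> ?Q"
      using m[OF b'(1,2)] m[OF b'(1) bd(3)] m[OF b'(1) La] m[OF bd(1) La] m[OF b'(3) La] Q0 by linarith+
    moreover have "\<bar>?s * ?V - ?a * ?U\<bar> \<le> ?Q"
      using m[OF bd(1,3)] m[OF bd(2) b'(2)] by (simp add: mult.commute[of ?a])
    ultimately show ?thesis unfolding e2 by (smt (verit) sq)
  qed
  have root: "x \<le> y" if "x\<^sup>2 \<le> y\<^sup>2" "0 \<le> y" for x y :: real using that by (rule power2_le_imp_le)
  have "1 / 2 * ?b \<le> \<alpha>1"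
  proof (rule root)
    have "?b\<^sup>2 \<le> 3 * \<alpha>1\<^sup>2" using svb(4) unfolding e1 by (smt (verit) zero_le_power2)
    then have "?b\<^sup>2 \<le> 4 * \<alpha>1\<^sup>2" by (smt (verit) zero_le_power2)
    then show "(1 / 2 * ?b)\<^sup>2 \<le> \<alpha>1\<^sup>2" by (simp add: power_mult_distrib power_divide)
  qed (use svb in simp)
  moreover have "\<alpha>1 \<le> 5 * ?C\<^sup>2 * ?b"
  proof -
    have "\<alpha>1 \<le> 5 * ?C * ?b"
    proof (rule root)
      have "(5 * ?C * ?b)\<^sup>2 = 25 * (?C * ?b)\<^sup>2" by (simp add: power_mult_distrib)
      then show "\<alpha>1\<^sup>2 \<le> (5 * ?C * ?b)\<^sup>2" using svb(3) e1u by (smt (verit) zero_le_power2)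
    qed (use C pos in simp)
    also have "\<dots> \<le> 5 * ?C\<^sup>2 * ?b" using C2 pos by simp
    finally show ?thesis .
  qed
  moreover have "1 / 2 * (?b * ?a) \<le> \<alpha>1 * \<alpha>2"
  proof (rule root)
    have "(?b * ?a)\<^sup>2 \<le> 3 * (\<alpha>1 * \<alpha>2)\<^sup>2" using svb(6) unfolding e2 by (smt (verit) zero_le_power2)
    then have "(?b * ?a)\<^sup>2 \<le> 4 * (\<alpha>1 * \<alpha>2)\<^sup>2" by (smt (verit) zero_le_power2)
    then show "(1 / 2 * (?b * ?a))\<^sup>2 \<le> (\<alpha>1 * \<alpha>2)\<^sup>2" by (simp add: power_mult_distrib power_divide)
  qed (use svb in simp)
  moreover have "\<alpha>1 * \<alpha>2 \<le> 5 * ?C\<^sup>2 * (?b * ?a)"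
  proof (rule root)
    let ?X = "?C\<^sup>2 * (?b * ?a)"
    have "?Q = 2 * ?X" "5 * ?C\<^sup>2 * (?b * ?a) = 5 * ?X" by simp_all
    then have "?Q\<^sup>2 = 4 * ?X\<^sup>2" "(5 * ?C\<^sup>2 * (?b * ?a))\<^sup>2 = 25 * ?X\<^sup>2" by (simp_all add: power_mult_distrib)
    then show "(\<alpha>1 * \<alpha>2)\<^sup>2 \<le> (5 * ?C\<^sup>2 * (?b * ?a))\<^sup>2" using svb(5) e2u by (smt (verit) zero_le_power2)
  qed (use pos in simp)
  ultimately show ?thesis by (simp only: power_mult_distrib)
qed

abbreviation dimension :: real where "dimension \<equiv> 1 + ln (real N * b) / (- ln a)"

lemma Nb_ge_1: "1 \<le> real N * b" using K_pos real_K by linarith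

theorem affinity_dim_eq: "affinity_dim {1..N} A = ereal dimension"
  by (rule affinity_dim_eq_of_singular_value_bounds[where c = "1/2" and C = "5 * shear_const\<^sup>2"])
     (use ab aN Nb_ge_1 singular_values_matrix_word in \<open>auto simp: mult.commute\<close>)

end

section \<open>Covering the attractor\<close>

context skew_system
begin

lemma attractor_eq_words:
  assumes X: "X = (\<Union>i\<in>{1..N}. F i ` X)"
  shows "X = (\<Union>w\<in>words n. foldr F w ` X)"
proof (induction n)
  case (Suc n)
  have "(\<Union>w\<in>words (Suc n). foldr F w ` X) = (\<Union>i\<in>{1..N}. F i ` (\<Union>w\<in>words n. foldr F w ` X))"
  proof -
    have "(\<Union>w\<in>words (Suc n). foldr F w ` X) = (\<Union>i\<in>{1..N}. \<Union>w\<in>words n. F i ` foldr F w ` X)"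
      by (force simp: words_Suc)
    then show ?thesis by (simp only: image_UN)
  qed
  also have "\<dots> = X" using X Suc.IH by simp
  finally show ?case by simp
qed simp

text \<open>Every cylinder of level \<open>n\<close> is cut into slabs that had width \<open>h = (a / b) ^ n\<close> before the map was
applied; their images have diameter of the order \<open>a ^ n\<close>. There are of the order \<open>1 / h\<close> slabs.\<close>

lemma attractor_covers:
  assumes attr: "is_attractor {1..N} F X"
  shows "\<exists>c>0. \<exists>B\<ge>1. \<forall>n. \<exists>C. finite C \<and> real (card C) \<le> B * (real N * b / a) ^ n \<and> X \<subseteq> \<Union>C \<and>
           (\<forall>U\<in>C. bounded U \<and> diameter U \<le> c * a ^ n)"
proof -
  have cpt: "compact X" and inv: "X = (\<Union>i\<in>{1..N}. F i ` X)" using attr by (auto simp: is_attractor_def)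
  obtain R where R: "0 < R" "\<And>p. p \<in> X \<Longrightarrow> norm p \<le> R"
    using compact_imp_bounded[OF cpt] by (auto simp: bounded_pos)
  define c where "c = 3 * shear_const * (1 + 2 * R)"
  have c: "0 < c" using shear_bounds(1) R by (simp add: c_def)
  have "\<exists>C. finite C \<and> real (card C) \<le> (2 * R + 1) * (real N * b / a) ^ n \<and> X \<subseteq> \<Union>C \<and>
           (\<forall>U\<in>C. bounded U \<and> diameter U \<le> c * a ^ n)" for n
  proof -
    define h where "h = (a / b) ^ n"
    have h: "0 < h" "b ^ n * h = a ^ n" using ab by (auto simp: h_def power_divide)
    have h1: "h \<le> 1" unfolding h_def using ab by (intro power_le_one) auto
    define J where "J = nat \<lfloor>2 * R / h\<rfloor>"
    define slab where "slab j = {p \<in> X. nat \<lfloor>(p $ 1 + R) / h\<rfloor> = j}" for j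
    define C where "C = (\<lambda>(w, j). foldr F w ` slab j) ` (words n \<times> {..J})"
    have slabX: "slab j \<subseteq> X" for j by (auto simp: slab_def)
    have fin: "finite C" by (simp add: C_def finite_words)
    have "card C \<le> card (words n \<times> {..J})" unfolding C_def by (intro card_image_le) (simp add: finite_words)
    then have "real (card C) \<le> real N ^ n * (real J + 1)"
      using of_nat_mono[of "card C" "card (words n \<times> {..J})"] by (simp add: card_cartesian_product card_words algebra_simps)
    also have "real J \<le> 2 * R / h" using R h by (simp add: J_def)
    also have "2 * R / h + 1 \<le> 2 * R / h + 1 / h" using h h1 by simp
    also have "\<dots> = (2 * R + 1) * (1 / h)" by (simp add: add_divide_distrib)
    also have "1 / h = (b / a) ^ n" by (simp add: h_def power_divide)
    finally have card: "real (card C) \<le> (2 * R + 1) * (real N * b / a) ^ n"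
      using N_gt_0 by (simp add: power_mult_distrib power_divide algebra_simps)
    have range: "\<bar>p $ 1\<bar> \<le> R" if "p \<in> X" for p
      using R(2)[OF that] component_le_norm_cart[of p 1] by linarith
    have cover: "X \<subseteq> \<Union>C"
    proof
      fix x assume "x \<in> X"
      then obtain w p where w: "w \<in> words n" "p \<in> X" "x = foldr F w p"
        using attractor_eq_words[OF inv, of n] by blast
      have "(p $ 1 + R) / h \<le> 2 * R / h" using range[OF w(2)] h by (intro divide_right_mono) auto
      then have "nat \<lfloor>(p $ 1 + R) / h\<rfloor> \<le> J" unfolding J_def by (intro nat_mono floor_mono)
      then show "x \<in> \<Union>C" using w by (force simp: C_def slab_def)
    qed
    have "bounded U \<and> diameter U \<le> c * a ^ n" if UC: "U \<in> C" for U
    proof -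
      obtain w j where U: "U = foldr F w ` slab j" "w \<in> words n" using UC by (auto simp: C_def)
      have "U \<subseteq> X" using U attractor_eq_words[OF inv, of n] slabX[of j] by blast
      then have bd: "bounded U" using compact_imp_bounded[OF cpt] bounded_subset by blast
      have "norm (x - y) \<le> c * a ^ n" if xy: "x \<in> U" "y \<in> U" for x y
      proof -
        obtain p q where pq: "p \<in> slab j" "q \<in> slab j" "x = foldr F w p" "y = foldr F w q" using xy U by auto
        have pX: "p \<in> X" "q \<in> X" using pq slabX by auto
        have nn: "0 \<le> (p $ 1 + R) / h" "0 \<le> (q $ 1 + R) / h"
          using range[OF pX(1)] range[OF pX(2)] h by (auto intro!: divide_nonneg_pos)
        have "nat \<lfloor>(p $ 1 + R) / h\<rfloor> = nat \<lfloor>(q $ 1 + R) / h\<rfloor>" using pq by (simp add: slab_def)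
        then have "\<lfloor>(p $ 1 + R) / h\<rfloor> = \<lfloor>(q $ 1 + R) / h\<rfloor>" using nn by (simp add: eq_nat_nat_iff)
        then have "\<bar>(p $ 1 + R) / h - (q $ 1 + R) / h\<bar> \<le> 1" by linarith
        then have "\<bar>p $ 1 - q $ 1\<bar> / h \<le> 1" using h by (simp add: abs_divide flip: diff_divide_distrib)
        then have dh: "\<bar>p $ 1 - q $ 1\<bar> \<le> h" using h by simp
        have "norm (p - q) \<le> 2 * R" using R(2)[OF pX(1)] R(2)[OF pX(2)] norm_triangle_ineq4[of p q] by linarith
        then have comp: "\<bar>(p - q) $ i\<bar> \<le> 2 * R" for i using component_le_norm_cart[of "p - q" i] by linarith
        have len: "set w \<subseteq> {1..N}" "length w = n" using U by (auto simp: words_def)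
        have "norm (matrix_word A w *v (p - q)) \<le> 3 * shear_const * (a ^ n + a ^ n * (2 * R))"
        proof (rule norm_matrix_word[OF len(1)])
          show "b ^ length w * \<bar>(p - q) $ 1\<bar> \<le> a ^ n"
            using dh b_pos mult_left_mono[of "\<bar>(p - q) $ 1\<bar>" h "b ^ n"] h(2) len by simp
          show "a ^ length w * \<bar>(p - q) $ 2\<bar> \<le> a ^ n * (2 * R)" "a ^ length w * \<bar>(p - q) $ 3\<bar> \<le> a ^ n * (2 * R)"
            using comp ab len(2) by (auto intro!: mult_left_mono)
        qed
        then show ?thesis by (simp add: pq foldr_F_diff c_def algebra_simps)
      qed
      then have "diameter U \<le> c * a ^ n" using c ab by (intro diameter_le) auto
      then show ?thesis using bd by blast
    qed
    then show ?thesis using fin card cover by blast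
  qed
  then show ?thesis using c R by (intro exI[of _ c] conjI exI[of _ "2 * R + 1"]) auto
qed

lemma upper_box_dim_attractor:
  assumes attr: "is_attractor {1..N} F X"
  shows "upper_box_dim X \<le> ereal dimension"
proof -
  obtain c B where cB: "c > 0" "B \<ge> 1" and cov: "\<And>n. \<exists>C. finite C \<and> real (card C) \<le> B * (real N * b / a) ^ n \<and> X \<subseteq> \<Union>C \<and>
           (\<forall>U\<in>C. bounded U \<and> diameter U \<le> c * a ^ n)"
    using attractor_covers[OF attr] by blast
  have "1 \<le> real N * b / a" using Nb_ge_1 ab by simp
  then have "upper_box_dim X \<le> ereal (ln (real N * b / a) / (- ln a))"
    using upper_box_dim_le_covers[OF _ _ _ cB(2,1) cov] ab by auto
  also have "ln (real N * b / a) / (- ln a) = dimension"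
  proof -
    have "ln a < 0" using ab by simp
    moreover have "ln (real N * b / a) = ln (real N * b) - ln a"
      using N_gt_0 ab by (simp add: ln_div)
    ultimately show ?thesis by (simp add: diff_divide_distrib)
  qed
  finally show ?thesis .
qed

lemma hausdorff_dim_attractor_le_lower_box_dim:
  assumes attr: "is_attractor {1..N} F X"
  shows "hausdorff_dim X \<le> lower_box_dim X"
proof (rule hausdorff_dim_le_lower_box_dim)
  fix \<delta> :: real assume \<delta>: "0 < \<delta>"
  obtain c B where cB: "c > 0" and cov: "\<And>n. \<exists>C. finite C \<and> real (card C) \<le> B * (real N * b / a) ^ n \<and> X \<subseteq> \<Union>C \<and>
           (\<forall>U\<in>C. bounded U \<and> diameter U \<le> c * a ^ n)"
    using attractor_covers[OF attr] by blast
  obtain n where "a ^ n < \<delta> / c" using real_arch_pow_inv[of "\<delta> / c" a] ab \<delta> cB by auto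
  then have "c * a ^ n \<le> \<delta>" using cB by (simp add: field_simps)
  then show "\<exists>C. finite C \<and> X \<subseteq> \<Union>C \<and> (\<forall>U\<in>C. bounded U \<and> diameter U \<le> \<delta>)"
    using cov[of n] by (meson order_trans)
qed

section \<open>The uniform coding measure\<close>

definition coding_measure :: "(nat \<Rightarrow> nat) measure" where
  "coding_measure = bernoulli_measure N (\<lambda>i. 1 / real N)"

definition initial_word :: "nat \<Rightarrow> (nat \<Rightarrow> nat) \<Rightarrow> nat list" where
  "initial_word p \<omega> = map \<omega> [0..<p]"

abbreviation letter_measure :: "nat measure" where
  "letter_measure \<equiv> point_measure {1..N} (\<lambda>i. ennreal (1 / real N))"

lemma emeasure_letter: "i \<in> {1..N} \<Longrightarrow> emeasure letter_measure {i} = ennreal (1 / real N)"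
  by (subst emeasure_point_measure_finite) auto

lemma prob_space_letter: "prob_space letter_measure"
proof
  have "emeasure letter_measure {1..N} = (\<Sum>i\<in>{1..N}. ennreal (1 / real N))"
    by (rule emeasure_point_measure_finite) auto
  also have "\<dots> = 1" using N_gt_0 by (simp add: ennreal_of_nat_eq_real_of_nat flip: ennreal_mult)
  finally show "emeasure letter_measure (space letter_measure) = 1" by (simp add: space_point_measure)
qed

lemma prob_space_coding: "prob_space coding_measure"
  unfolding coding_measure_def bernoulli_measure_def by (intro prob_space_PiM prob_space_letter)

lemma space_coding: "\<omega> \<in> space coding_measure \<longleftrightarrow> (\<forall>n. \<omega> n \<in> {1..N})"
  by (auto simp: coding_measure_def bernoulli_measure_def space_PiM space_point_measure PiE_def Pi_def)

lemma initial_word_in_words: "\<omega> \<in> space coding_measure \<Longrightarrow> initial_word p \<omega> \<in> words p"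
  by (auto simp: space_coding words_def initial_word_def)

text \<open>Codes with a given initial word form a set in the product algebra fixing finitely many coordinates.\<close>

lemma cylinder:
  assumes "w \<in> words p"
  shows "initial_word p -` {w} \<inter> space coding_measure \<in> sets coding_measure"
    "emeasure coding_measure (initial_word p -` {w} \<inter> space coding_measure) = ennreal ((1 / real N) ^ p)"
proof -
  let ?M = "\<lambda>_::nat. letter_measure"
  let ?E = "prod_emb UNIV ?M {..<p} (PiE {..<p} (\<lambda>i. {w ! i}))"
  have len: "length w = p" and "set w \<subseteq> {1..N}" using assms by (auto simp: words_def)
  then have letters: "w ! i \<in> {1..N}" if "i < p" for i using nth_mem that by blast
  have eq: "initial_word p -` {w} \<inter> space coding_measure = ?E"
  proof (intro set_eqI iffI)
    fix \<omega> assume "\<omega> \<in> initial_word p -` {w} \<inter> space coding_measure"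
    then show "\<omega> \<in> ?E"
      by (auto simp: prod_emb_iff space_coding initial_word_def space_point_measure PiE_def restrict_def extensional_def)
  next
    fix \<omega> assume w: "\<omega> \<in> ?E"
    then have "\<omega> i = w ! i" if "i < p" for i
      using that by (auto simp: prod_emb_iff restrict_def PiE_def Pi_def split: if_splits)
    then have "initial_word p \<omega> = w" using assms by (auto simp: initial_word_def words_def list_eq_iff_nth_eq)
    moreover have "\<omega> \<in> space coding_measure" using w by (auto simp: prod_emb_iff space_coding space_point_measure)
    ultimately show "\<omega> \<in> initial_word p -` {w} \<inter> space coding_measure" by simp
  qed
  show "initial_word p -` {w} \<inter> space coding_measure \<in> sets coding_measure"
    unfolding eq unfolding coding_measure_def bernoulli_measure_def using letters
    by (intro sets_PiM_I) (auto simp: sets_point_measure)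
  have "emeasure coding_measure ?E = (\<Prod>i<p. emeasure letter_measure {w ! i})"
    unfolding coding_measure_def bernoulli_measure_def using letters
    by (intro emeasure_PiM_emb prob_space_letter) (auto simp: sets_point_measure)
  also have "\<dots> = (\<Prod>i<p. ennreal (1 / real N))" using letters emeasure_letter by (intro prod.cong) auto
  also have "\<dots> = ennreal ((1 / real N) ^ p)" by (simp add: ennreal_power)
  finally show "emeasure coding_measure (initial_word p -` {w} \<inter> space coding_measure) = ennreal ((1 / real N) ^ p)"
    unfolding eq .
qed

lemma measurable_initial_word [measurable]: "initial_word p \<in> measurable coding_measure (count_space UNIV)"
proof (subst measurable_count_space_eq_countable, simp, safe)
  fix w
  show "initial_word p -` {w} \<inter> space coding_measure \<in> sets coding_measure"
  proof (cases "w \<in> words p")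
    case False
    then have "initial_word p -` {w} \<inter> space coding_measure = {}" using initial_word_in_words by auto
    then show ?thesis by simp
  qed (rule cylinder)
qed simp

lemma words_ne: "words p \<noteq> {}"
proof -
  have "replicate p 1 \<in> words p" using N_gt_0 by (auto simp: words_def)
  then show ?thesis by blast
qed

text \<open>Initial words are uniformly distributed, so probabilities of events that depend on finitely many letters are counts.\<close>

lemma distr_initial_word: "distr coding_measure (count_space UNIV) (initial_word p) = measure_pmf (pmf_of_set (words p))"
proof (rule measure_eqI_countable[of _ UNIV])
  fix w :: "nat list"
  have "emeasure (distr coding_measure (count_space UNIV) (initial_word p)) {w}
      = emeasure coding_measure (initial_word p -` {w} \<inter> space coding_measure)"
    by (simp add: emeasure_distr)
  also have "\<dots> = ennreal (pmf (pmf_of_set (words p)) w)"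
  proof (cases "w \<in> words p")
    case True
    then show ?thesis using cylinder(2)[OF True] finite_words[of p] words_ne[of p]
      by (simp add: pmf_of_set card_words power_divide)
  next
    case False
    then have "initial_word p -` {w} \<inter> space coding_measure = {}" using initial_word_in_words by auto
    then show ?thesis using False finite_words[of p] words_ne[of p] by (simp add: pmf_of_set)
  qed
  finally show "emeasure (distr coding_measure (count_space UNIV) (initial_word p)) {w} = emeasure (measure_pmf (pmf_of_set (words p))) {w}"
    by (simp add: emeasure_pmf_single)
qed auto

lemma prob_initial_word:
  "measure coding_measure {\<omega> \<in> space coding_measure. Q (initial_word p \<omega>)} = real (card {w \<in> words p. Q w}) / real N ^ p"
proof -
  have "measure coding_measure {\<omega> \<in> space coding_measure. Q (initial_word p \<omega>)}
      = measure (distr coding_measure (count_space UNIV) (initial_word p)) {w. Q w}"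
    by (subst measure_distr) (auto intro!: arg_cong[where f = "measure coding_measure"])
  also have "\<dots> = real (card (words p \<inter> {w. Q w})) / real (card (words p))"
    unfolding distr_initial_word using measure_pmf_of_set[OF words_ne finite_words] by blast
  finally show ?thesis by (simp add: card_words Collect_conj_eq)
qed

lemma expectation_initial_word:
  fixes \<phi> :: "nat list \<Rightarrow> real"
  shows "(\<integral>\<omega>. \<phi> (initial_word p \<omega>) \<partial>coding_measure) = (\<Sum>w\<in>words p. \<phi> w) / real N ^ p"
proof -
  have "(\<integral>\<omega>. \<phi> (initial_word p \<omega>) \<partial>coding_measure) = (\<integral>w. \<phi> w \<partial>distr coding_measure (count_space UNIV) (initial_word p))"
    by (rule integral_distr[symmetric]) auto
  also have "\<dots> = (\<Sum>w\<in>words p. \<phi> w) / real N ^ p"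
    unfolding distr_initial_word using integral_pmf_of_set[OF words_ne finite_words] by (simp add: card_words)
  finally show ?thesis .
qed

section \<open>The natural projection and the dimensions of the attractor\<close>

lemma foldr_F_cube: "set w \<subseteq> {1..N} \<Longrightarrow> x \<in> cbox 0 1 \<Longrightarrow> foldr F w x \<in> cbox 0 1"
proof (induction w)
  case (Cons i w)
  then show ?case using cube[of i] by auto
qed simp

lemma foldr_F_nth:
  assumes "set w \<subseteq> {1..N}"
  shows "foldr F w x $ 1 = left_end w + b ^ length w * x $ 1"
    "foldr F w x $ 2 = elevation w (x $ 1) + a ^ length w * x $ 2"
proof -
  have 1: "foldr F w x $ 1 = left_end w + b ^ length w * x $ 1" if "set w \<subseteq> {1..N}" for w
    using that
    by (induction w) (auto simp: F_def space_map_nth t1 left_end_Cons algebra_simps)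
  then show "foldr F w x $ 1 = left_end w + b ^ length w * x $ 1" using assms .
  show "foldr F w x $ 2 = elevation w (x $ 1) + a ^ length w * x $ 2"
    using assms
  proof (induction w)
    case (Cons i w)
    have "foldr F (i # w) x $ 2 = d i * foldr F w x $ 1 + a * foldr F w x $ 2 + s i"
      by (simp add: F_def space_map_nth)
    then show ?case using Cons 1[of w] by (simp add: algebra_simps)
  qed simp
qed

lemma continuous_foldr_F: "continuous_on S (foldr F w)"
proof -
  have "continuous_on S (\<lambda>x. foldr F w 0 + matrix_word A w *v x)"
    by (intro continuous_on_add continuous_on_const linear_continuous_on matrix_vector_mul_bounded_linear)
  moreover have "foldr F w 0 + matrix_word A w *v x = foldr F w x" for x
    using foldr_F_diff[of w x 0] by (simp add: diff_eq_eq add.commute)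
  ultimately show ?thesis by simp
qed

lemma initial_word_split:
  assumes "\<omega> \<in> space coding_measure" "n \<le> m"
  shows "\<exists>v. set v \<subseteq> {1..N} \<and> initial_word m \<omega> = initial_word n \<omega> @ v"
proof -
  have "[0..<m] = [0..<n] @ [n..<m]" using assms(2) upt_add_eq_append[of 0 n "m - n"] by simp
  then have "initial_word m \<omega> = initial_word n \<omega> @ map \<omega> [n..<m]" by (simp add: initial_word_def)
  then show ?thesis using assms(1) by (intro exI[of _ "map \<omega> [n..<m]"]) (auto simp: space_coding)
qed

text \<open>The approximations of a projected point lie in nested cylinders, whose diameters shrink; this gives convergence
and locates the limit.\<close>

lemma initial_word_point:
  assumes "\<omega> \<in> space coding_measure" "n \<le> m"
  shows "foldr F (initial_word m \<omega>) 0 \<in> foldr F (initial_word n \<omega>) ` cbox 0 1"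
proof -
  obtain v where v: "set v \<subseteq> {1..N}" "initial_word m \<omega> = initial_word n \<omega> @ v"
    using initial_word_split[OF assms] by blast
  have "foldr F v 0 \<in> cbox 0 1" using v by (intro foldr_F_cube) (auto simp: mem_box_cart)
  then show ?thesis using v by auto
qed

lemma dist_foldr_F:
  assumes "w \<in> words n"
  shows "dist (foldr F w x) (foldr F w y) \<le> 6 * shear_const * b ^ n * dist x y"
  using norm_matrix_word_contract[of w "x - y"] assms by (simp add: dist_norm foldr_F_diff words_def)

lemma geometric_small: "0 < e \<Longrightarrow> \<exists>n. 6 * shear_const * b ^ n * R < e"
proof -
  assume "0 < e"
  have "(\<lambda>n. 6 * shear_const * b ^ n * R) \<longlonglongrightarrow> 6 * shear_const * 0 * R"
    using ab by (intro tendsto_intros LIMSEQ_power_zero) auto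
  then have "\<forall>\<^sub>F n in sequentially. 6 * shear_const * b ^ n * R < e"
    using \<open>0 < e\<close> by (intro order_tendstoD(2)) auto
  then show ?thesis by (auto simp: eventually_sequentially)
qed

lemma natural_projection_LIMSEQ:
  assumes \<omega>: "\<omega> \<in> space coding_measure"
  shows "(\<lambda>n. foldr F (initial_word n \<omega>) 0) \<longlonglongrightarrow> natural_projection F \<omega>"
proof -
  let ?x = "\<lambda>n. foldr F (initial_word n \<omega>) 0"
  define R where "R = diameter (cbox 0 (1::real^3))"
  have R: "dist p q \<le> R" if "p \<in> cbox 0 (1::real^3)" "q \<in> cbox 0 1" for p q
    unfolding R_def using diameter_bounded_bound[OF bounded_cbox that] .
  have "Cauchy ?x"
  proof (rule metric_CauchyI)
    fix e :: real assume "0 < e"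
    then obtain n where n: "6 * shear_const * b ^ n * R < e" using geometric_small by blast
    have "dist (?x m) (?x m') < e" if mm: "n \<le> m" "n \<le> m'" for m m'
    proof -
      obtain p q where pq: "p \<in> cbox 0 1" "q \<in> cbox 0 1"
        "?x m = foldr F (initial_word n \<omega>) p" "?x m' = foldr F (initial_word n \<omega>) q"
        using initial_word_point[OF \<omega> mm(1)] initial_word_point[OF \<omega> mm(2)] by blast
      have "dist (?x m) (?x m') \<le> 6 * shear_const * b ^ n * dist p q"
        using dist_foldr_F[OF initial_word_in_words[OF \<omega>]] pq by simp
      also have "\<dots> \<le> 6 * shear_const * b ^ n * R"
        using R[OF pq(1,2)] shear_bounds(1) b_pos by (intro mult_left_mono) auto
      finally show ?thesis using n by simp
    qed
    then show "\<exists>n. \<forall>m\<ge>n. \<forall>m'\<ge>n. dist (?x m) (?x m') < e" by blast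
  qed
  then show ?thesis
    unfolding natural_projection_def initial_word_def[symmetric]
    by (simp add: Cauchy_convergent_iff convergent_LIMSEQ_iff)
qed

lemma natural_projection_in_cylinder:
  assumes \<omega>: "\<omega> \<in> space coding_measure"
  shows "natural_projection F \<omega> \<in> foldr F (initial_word n \<omega>) ` cbox 0 1"
proof (rule Lim_in_closed_set[OF _ _ _ natural_projection_LIMSEQ[OF \<omega>]])
  show "closed (foldr F (initial_word n \<omega>) ` cbox 0 1)"
    by (intro compact_imp_closed compact_continuous_image continuous_foldr_F compact_cbox)
  show "\<forall>\<^sub>F m in sequentially. foldr F (initial_word m \<omega>) 0 \<in> foldr F (initial_word n \<omega>) ` cbox 0 1"
    unfolding eventually_sequentially using initial_word_point[OF \<omega>] by blast
qed simp

lemma natural_projection_in_attractor: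
  assumes \<omega>: "\<omega> \<in> space coding_measure" and attr: "is_attractor {1..N} F X"
  shows "natural_projection F \<omega> \<in> X"
proof -
  have cpt: "compact X" and inv: "X = (\<Union>i\<in>{1..N}. F i ` X)" and "X \<noteq> {}"
    using attr by (auto simp: is_attractor_def)
  then obtain p where p: "p \<in> X" by blast
  let ?x = "\<lambda>n. foldr F (initial_word n \<omega>) 0" and ?y = "\<lambda>n. foldr F (initial_word n \<omega>) p"
  have yX: "?y n \<in> X" for n
    using attractor_eq_words[OF inv, of n] initial_word_in_words[OF \<omega>, of n] p by blast
  have "(\<lambda>n. ?y n - ?x n) \<longlonglongrightarrow> 0"
  proof (rule Lim_null_comparison)
    show "\<forall>\<^sub>F n in sequentially. norm (?y n - ?x n) \<le> 6 * shear_const * b ^ n * dist p 0"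
    proof (rule always_eventually, rule allI)
      show "norm (?y n - ?x n) \<le> 6 * shear_const * b ^ n * dist p 0" for n
        using dist_foldr_F[OF initial_word_in_words[OF \<omega>], of n p 0] by (simp add: dist_norm)
    qed
    have "(\<lambda>n. 6 * shear_const * b ^ n * dist p 0) \<longlonglongrightarrow> 6 * shear_const * 0 * dist p 0"
      using ab by (intro tendsto_intros LIMSEQ_power_zero) auto
    then show "(\<lambda>n. 6 * shear_const * b ^ n * dist p 0) \<longlonglongrightarrow> 0" by simp
  qed
  from tendsto_add[OF this natural_projection_LIMSEQ[OF \<omega>]] have "?y \<longlonglongrightarrow> natural_projection F \<omega>" by simp
  then show ?thesis by (rule closed_sequentially[OF compact_imp_closed[OF cpt] yX])
qed

lemma measurable_natural_projection: "natural_projection F \<in> borel_measurable coding_measure"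
proof -
  have "(\<lambda>\<omega>. foldr F (initial_word n \<omega>) 0) \<in> borel_measurable coding_measure" for n
    by (rule measurable_compose[OF measurable_initial_word]) simp
  then have "(\<lambda>\<omega>. lim (\<lambda>n. foldr F (initial_word n \<omega>) 0)) \<in> borel_measurable coding_measure"
    by (rule borel_measurable_lim_metric)
  then show ?thesis unfolding natural_projection_def initial_word_def .
qed

lemma self_affine_measure_eq:
  "self_affine_measure N (\<lambda>i. 1 / real N) F = distr coding_measure borel (natural_projection F)"
  by (simp add: self_affine_measure_def coding_measure_def)

lemma measure_hausdorff_dim_le_attractor:
  assumes attr: "is_attractor {1..N} F X"
  shows "measure_hausdorff_dim (self_affine_measure N (\<lambda>i. 1 / real N) F) \<le> hausdorff_dim X"
proof -
  interpret prob_space coding_measure by (rule prob_space_coding)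
  have X: "X \<in> sets borel" using attr by (auto simp: is_attractor_def intro: borel_compact)
  have "natural_projection F -` X \<inter> space coding_measure = space coding_measure"
    using natural_projection_in_attractor[OF _ attr] by blast
  then have "emeasure (distr coding_measure borel (natural_projection F)) X = 1"
    using X measurable_natural_projection by (simp add: emeasure_distr emeasure_space_1)
  then show ?thesis
    unfolding measure_hausdorff_dim_def self_affine_measure_eq using X by (intro INF_lower) simp
qed

text \<open>The rate in the correlation estimate \<open>same_cell_fraction\<close> matches the dimension.\<close>

lemma a_powr_dimension: "a powr dimension = a / real K"
proof -
  have "a powr dimension = exp (dimension * ln a)" using ab by (simp add: powr_def)
  also have "dimension * ln a = ln a - ln (real K)"
  proof -
    have "ln a < 0" using ab by simp
    then have "ln (real N * b) / (- ln a) * ln a = - ln (real N * b)" by simp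
    then show ?thesis unfolding distrib_right real_K by linarith
  qed
  also have "exp \<dots> = a / real K" using ab K_pos by (simp add: exp_diff)
  finally show ?thesis .
qed

text \<open>The correlation estimate for the uniform measure: at level \<open>n\<close> a code is observed up to a depth
\<open>p n\<close> at which the width \<open>b ^ p n\<close> of a column is comparable to \<open>a ^ n\<close>.\<close>

theorem measure_hausdorff_dim_ge:
  "ereal dimension \<le> measure_hausdorff_dim (self_affine_measure N (\<lambda>i. 1 / real N) F)"
proof -
  have "\<forall>n. \<exists>p. n \<le> p \<and> b ^ p \<le> a ^ n \<and> a ^ n \<le> real M * b ^ p" using depth_exists by blast
  then obtain p where p: "\<And>n. n \<le> p n" "\<And>n. b ^ p n \<le> a ^ n" "\<And>n. a ^ n \<le> real M * b ^ p n" by metis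
  define g where "g n \<omega> = cell n (initial_word (p n) \<omega>)" for n \<omega>
  show ?thesis
    unfolding self_affine_measure_eq
  proof (rule measure_hausdorff_dim_ge_correlation[where g = g and \<rho> = a and C = pair_const
        and B = "(2 * near_const + 1)\<^sup>2"])
    show "g n \<in> measurable coding_measure (count_space UNIV)" for n
      unfolding g_def[abs_def] by (rule measurable_compose[OF measurable_initial_word]) simp
    show "(\<integral>\<omega>. measure coding_measure {\<omega>' \<in> space coding_measure. g n \<omega>' = g n \<omega>} \<partial>coding_measure)
        \<le> pair_const * (a powr dimension) ^ n" for n
    proof -
      have "(\<integral>\<omega>. measure coding_measure {\<omega>' \<in> space coding_measure. g n \<omega>' = g n \<omega>} \<partial>coding_measure)
         = (\<Sum>w\<in>words (p n). real (card {w' \<in> words (p n). cell n w' = cell n w}) / real N ^ p n) / real N ^ p n"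
        unfolding g_def by (simp only: prob_initial_word[where Q = "\<lambda>w'. cell n w' = cell n _"]
            expectation_initial_word[where \<phi> = "\<lambda>w. real (card {w' \<in> words (p n). cell n w' = cell n w}) / real N ^ p n"])
      also have "\<dots> = real (\<Sum>w\<in>words (p n). card {w' \<in> words (p n). cell n w' = cell n w}) / (real N ^ p n)\<^sup>2"
        by (simp add: power2_eq_square flip: sum_divide_distrib)
      also have "(\<Sum>w\<in>words (p n). card {w' \<in> words (p n). cell n w' = cell n w})
          = card (SIGMA w:words (p n). {w' \<in> words (p n). cell n w' = cell n w})"
        using finite_words by simp
      also have "(SIGMA w:words (p n). {w' \<in> words (p n). cell n w' = cell n w})
          = {(w, w') \<in> words (p n) \<times> words (p n). cell n w = cell n w'}" by auto
      also have "real (card \<dots>) / (real N ^ p n)\<^sup>2 \<le> pair_const * (a / real K) ^ n"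
        using same_cell_fraction[OF p(2) p(1) K_pos] .
      finally show ?thesis unfolding a_powr_dimension .
    qed
    show "finite (g n ` (natural_projection F -` U \<inter> space coding_measure)) \<and>
        card (g n ` (natural_projection F -` U \<inter> space coding_measure)) \<le> (2 * near_const + 1)\<^sup>2"
      if U: "bounded U" "diameter U \<le> a ^ n" for n U
    proof -
      let ?S = "initial_word (p n) ` (natural_projection F -` U \<inter> space coding_measure)"
      have eq: "g n ` (natural_projection F -` U \<inter> space coding_measure) = cell n ` ?S"
        by (simp add: g_def image_image)
      show ?thesis unfolding eq
      proof (rule few_cells_near[OF p(2,3,1), where V = "(\<lambda>z. (z $ 1, z $ 2)) ` U"])
        show "?S \<subseteq> words (p n)" using initial_word_in_words by blast
        show "\<bar>x - x'\<bar> \<le> a ^ n \<and> \<bar>y - y'\<bar> \<le> a ^ n"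
          if V: "(x, y) \<in> (\<lambda>z. (z $ 1, z $ 2)) ` U" "(x', y') \<in> (\<lambda>z. (z $ 1, z $ 2)) ` U" for x y x' y'
        proof -
          obtain z z' where z: "z \<in> U" "z' \<in> U" "x = z $ 1" "y = z $ 2" "x' = z' $ 1" "y' = z' $ 2"
            using V by auto
          have "norm (z - z') \<le> a ^ n"
            using diameter_bounded_bound[OF U(1) z(1,2)] U(2) by (simp add: dist_norm)
          then show ?thesis
            using component_le_norm_cart[of "z - z'" 1] component_le_norm_cart[of "z - z'" 2] z by simp
        qed
        show "\<exists>x y q1 q2. (x, y) \<in> (\<lambda>z. (z $ 1, z $ 2)) ` U \<and> 0 \<le> q1 \<and> q1 \<le> 1 \<and> 0 \<le> q2 \<and> q2 \<le> 1 \<and>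
            x = left_end w + b ^ p n * q1 \<and>
            y = elevation (take n w) (left_end (drop n w) + b ^ (p n - n) * q1) + a ^ n * q2"
          if w: "w \<in> ?S" for w
        proof -
          obtain \<omega> where \<omega>: "\<omega> \<in> space coding_measure" "natural_projection F \<omega> \<in> U" "w = initial_word (p n) \<omega>"
            using w by auto
          have ww: "w \<in> words (p n)" using \<omega> initial_word_in_words by simp
          then have len: "length w = p n" "length (take n w) = n" "length (drop n w) = p n - n"
            and sets: "set w \<subseteq> {1..N}" "set (take n w) \<subseteq> {1..N}" "set (drop n w) \<subseteq> {1..N}"
            using p(1)[of n] by (auto simp: words_def dest: in_set_takeD in_set_dropD)
          obtain q where q: "q \<in> cbox 0 1" "natural_projection F \<omega> = foldr F w q"
            using natural_projection_in_cylinder[OF \<omega>(1), of "p n"] \<omega>(3) by blast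
          let ?q' = "foldr F (drop n w) q"
          have q': "?q' \<in> cbox 0 1" using foldr_F_cube[OF sets(3) q(1)] .
          have split: "foldr F w q = foldr F (take n w) ?q'" by (metis append_take_drop_id foldr_comp_append)
          have 1: "foldr F w q $ 1 = left_end w + b ^ p n * q $ 1" using foldr_F_nth(1)[OF sets(1)] len by simp
          have 2: "foldr F w q $ 2 = elevation (take n w) (left_end (drop n w) + b ^ (p n - n) * q $ 1) + a ^ n * ?q' $ 2"
            unfolding split using foldr_F_nth(2)[OF sets(2), of ?q'] foldr_F_nth(1)[OF sets(3), of q] len by simp
          have 3: "0 \<le> q $ 1" "q $ 1 \<le> 1" "0 \<le> ?q' $ 2" "?q' $ 2 \<le> 1"
            using q(1) q' by (auto simp: mem_box_cart)
          have 4: "(foldr F w q $ 1, foldr F w q $ 2) \<in> (\<lambda>z. (z $ 1, z $ 2)) ` U"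
            using \<omega>(2) unfolding q(2) by (rule imageI)
          show ?thesis
            by (rule exI[of _ "foldr F w q $ 1"], rule exI[of _ "foldr F w q $ 2"],
                rule exI[of _ "q $ 1"], rule exI[of _ "?q' $ 2"]) (intro conjI 4 3 1 2)
        qed
      qed
    qed
    show "prob_space coding_measure" "natural_projection F \<in> borel_measurable coding_measure"
      by (rule prob_space_coding measurable_natural_projection)+
    show "0 < a" "a < 1" using ab by auto
  qed
qed

text \<open>The four dimensions form an ascending chain from \<open>dimension\<close> to \<open>dimension\<close>.\<close>

theorem dimensions_of_attractor:
  assumes attr: "is_attractor {1..N} F X"
  shows "measure_hausdorff_dim (self_affine_measure N (\<lambda>i. 1 / real N) F) = ereal dimension"
    "hausdorff_dim X = ereal dimension" "lower_box_dim X = ereal dimension" "upper_box_dim X = ereal dimension"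
proof -
  note chain = measure_hausdorff_dim_ge measure_hausdorff_dim_le_attractor[OF attr]
    hausdorff_dim_attractor_le_lower_box_dim[OF attr] lower_box_dim_le_upper_box_dim[of X]
    upper_box_dim_attractor[OF attr]
  have D: "x = y" if "y \<le> x" "x \<le> y" for x y :: ereal
    by (rule antisym[OF that(2) that(1)])
  note up = order_trans[OF chain(4) chain(5)]
  note up2 = order_trans[OF chain(3) up]
  note low = order_trans[OF chain(1) chain(2)]
  note low2 = order_trans[OF low chain(3)]
  show "measure_hausdorff_dim (self_affine_measure N (\<lambda>i. 1 / real N) F) = ereal dimension"
    by (rule D[OF chain(1) order_trans[OF chain(2) up2]])
  show "hausdorff_dim X = ereal dimension" by (rule D[OF low up2])
  show "lower_box_dim X = ereal dimension" by (rule D[OF low2 up])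
  show "upper_box_dim X = ereal dimension" by (rule D[OF order_trans[OF low2 chain(4)] chain(5)])
qed

end

section \<open>Transversality in the plane\<close>

lemma plane_map_nth:
  "plane_map a b d t1 t2 i x $ 1 = b * x $ 1 + t1 i"
  "plane_map a b d t1 t2 i x $ 2 = d i * x $ 1 + a * x $ 2 + t2 i"
  by (simp_all add: plane_map_def plane_mat_def matrix_vector_mult_def sum_2)

lemma parallelogram_interior:
  fixes \<xi> y :: real
  assumes "0 < a" "0 < b" "0 < \<xi>" "\<xi> < 1" "d i * \<xi> + t2 i < y" "y < d i * \<xi> + t2 i + a"
  shows "(vector [b * \<xi> + t1 i, y] :: real^2) \<in> interior (plane_map a b d t1 t2 i ` cbox 0 1)"
proof -
  \<comment> \<open>The image of the open square, described by the inverse map.\<close>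
  define T where "T = {z :: real^2. 0 < (z $ 1 - t1 i) / b \<and> (z $ 1 - t1 i) / b < 1 \<and>
      d i * ((z $ 1 - t1 i) / b) + t2 i < z $ 2 \<and> z $ 2 < d i * ((z $ 1 - t1 i) / b) + t2 i + a}"
  have "open T" unfolding T_def using \<open>0 < b\<close>
    by (intro open_Collect_conj open_Collect_less continuous_intros) auto
  moreover have "T \<subseteq> plane_map a b d t1 t2 i ` cbox 0 1"
  proof
    fix z assume z: "z \<in> T"
    let ?x = "(z $ 1 - t1 i) / b"
    let ?q = "vector [?x, (z $ 2 - d i * ?x - t2 i) / a] :: real^2"
    have "plane_map a b d t1 t2 i ?q = z"
      using assms(1,2) by (simp add: vec_eq_iff forall_2 plane_map_nth)
    moreover have "?q \<in> cbox 0 1"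
      using z assms(1) by (auto simp: T_def mem_box_cart forall_2)
    ultimately show "z \<in> plane_map a b d t1 t2 i ` cbox 0 1" by (metis imageI)
  qed
  ultimately have "T \<subseteq> interior (plane_map a b d t1 t2 i ` cbox 0 1)" by (rule interior_maximal[rotated])
  moreover have "vector [b * \<xi> + t1 i, y] \<in> T" using assms by (simp add: T_def)
  ultimately show ?thesis by blast
qed

text \<open>The two parallelograms stand over the same base, and above the point with rescaled abscissa \<open>x\<close> their
vertical sections overlap. By continuity they do so above some interior point of the base as well, and there the midpoint of the
common part is interior to both.\<close>

lemma parallelogram_interiors_meet:
  fixes x :: real
  assumes ab: "0 < a" "0 < b" and x: "0 \<le> x" "x \<le> 1" and t1: "t1 k = t1 l"
    and near: "\<bar>(d k - d l) * x + (t2 k - t2 l)\<bar> < a"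
  shows "interior (plane_map a b d t1 t2 k ` cbox 0 1) \<inter> interior (plane_map a b d t1 t2 l ` cbox 0 1) \<noteq> {}"
proof -
  let ?T = "{y. \<bar>(d k - d l) * y + (t2 k - t2 l)\<bar> < a}"
  have "open ?T" by (intro open_Collect_less continuous_intros)
  moreover have "x \<in> ?T \<inter> closure {0<..<1}" using x near by simp
  ultimately have "?T \<inter> {0<..<1} \<noteq> {}" using open_Int_closure_eq_empty by blast
  then obtain \<xi> where \<xi>: "0 < \<xi>" "\<xi> < 1" "\<bar>(d k - d l) * \<xi> + (t2 k - t2 l)\<bar> < a" by auto
  let ?p = "d k * \<xi> + t2 k" and ?q = "d l * \<xi> + t2 l"
  define y where "y = (?p + ?q + a) / 2"
  have "(d k - d l) * \<xi> + (t2 k - t2 l) = ?p - ?q" by (simp add: algebra_simps)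
  then have "?p - ?q < a" "?q - ?p < a" using \<xi>(3) by auto
  then have y: "?p < y" "y < ?p + a" "?q < y" "y < ?q + a" by (simp_all add: y_def field_simps)
  show ?thesis
    using parallelogram_interior[of a b \<xi> d k t2 y t1, OF ab \<xi>(1,2) y(1,2)]
      parallelogram_interior[of a b \<xi> d l t2 y t1, OF ab \<xi>(1,2) y(3,4)] t1 by auto
qed

text \<open>Comparing lengths: \<open>M\<close> intervals of length \<open>b\<close> cover the unit interval without overlap inside it, so
\<open>M * b = 1\<close> and no gaps are left.\<close>

lemma columns_tile:
  fixes c :: "nat \<Rightarrow> real"
  assumes b: "0 < b" and M: "0 < M" and c1: "0 \<le> c 1"
    and sep: "\<And>m. m \<in> {1..<M} \<Longrightarrow> c m + b \<le> c (Suc m)" and last: "c M + b \<le> 1"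
    and cover: "{0..1} \<subseteq> (\<Union>m\<in>{1..M}. {c m..c m + b})"
  shows "real M * b = 1" "\<And>m. m < M \<Longrightarrow> c (Suc m) = b * real m"
proof -
  have low: "b * real m \<le> c (Suc m)" if "m < M" for m
    using that
  proof (induction m)
    case (Suc m)
    then show ?case using sep[of "Suc m"] by (simp add: algebra_simps)
  qed (use c1 in simp)
  have up: "c (M - k) + b * (real k + 1) \<le> 1" if "k < M" for k
    using that
  proof (induction k)
    case (Suc k)
    then have "c (M - Suc k) + b \<le> c (M - k)" using sep[of "M - Suc k"] by (simp add: Suc_diff_Suc)
    then show ?case using Suc by (simp add: algebra_simps)
  qed (use last in simp)
  have "emeasure lborel {0..1::real} \<le> emeasure lborel (\<Union>m\<in>{1..M}. {c m..c m + b})"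
    using cover by (intro emeasure_mono) auto
  also have "\<dots> \<le> (\<Sum>m\<in>{1..M}. emeasure lborel {c m..c m + b})"
    by (intro emeasure_subadditive_finite) auto
  also have "\<dots> = ennreal (real M * b)" using b by (simp add: ennreal_of_nat_eq_real_of_nat ennreal_mult)
  finally have "1 \<le> real M * b" using b by simp
  moreover have "real M * b \<le> 1"
  proof -
    have "b * real (M - 1) \<le> c M" using low[of "M - 1"] M by simp
    then show ?thesis using last M by (simp add: of_nat_diff algebra_simps)
  qed
  ultimately show Mb: "real M * b = 1" by simp
  show "c (Suc m) = b * real m" if "m < M" for m
  proof (rule antisym)
    have "c (M - (M - Suc m)) + b * (real (M - Suc m) + 1) \<le> 1" using that by (intro up) auto
    then show "c (Suc m) \<le> b * real m" using that Mb by (simp add: of_nat_diff algebra_simps)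
  qed (use low that in auto)
qed

text \<open>The hypothesis on \<open>d\<^sub>*\<close> solved for \<open>d\<^sub>*\<close>.\<close>

lemma transversality_gap:
  fixes a b D :: real
  assumes "0 < a" "a < b" "0 \<le> D" "a < b * D / (2 + D)"
  shows "2 * a / (b - a) < D"
proof -
  have "a * (2 + D) < b * D" using assms by (simp add: pos_less_divide_eq)
  then have "2 * a < D * (b - a)" by (simp add: algebra_simps)
  then show ?thesis using assms by (simp add: pos_divide_less_eq)
qed

text \<open>The planar hypotheses yield the data of \<open>transversal_columns\<close>: the columns tile because the projection is the
whole interval, \<open>a N < 1\<close> is the first bound on \<open>a\<close>, and the second bound leaves the gap
\<open>\<kappa> = d\<^sub>* - 2 a / (b - a)\<close> between shears of overlapping parallelograms.\<close>

theorem theorem9p3: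
  fixes N M :: nat and \<I> :: "nat \<Rightarrow> nat set" and c :: "nat \<Rightarrow> real"
    and a b :: real and d t1 t2 t3 u v lam :: "nat \<Rightarrow> real"
    and f :: "nat \<Rightarrow> real^2 \<Rightarrow> real^2" and \<Lambda> :: "(real^2) set"
    and A3 :: "nat \<Rightarrow> real^3^3" and F :: "nat \<Rightarrow> real^3 \<Rightarrow> real^3" and \<Lambda>3 :: "(real^3) set"
  assumes f_eq: "f = plane_map a b d t1 t2"
    and tgl: "diag_homogeneous_TGL N M \<I> c a b d t1 t2"
    and attr: "is_attractor {1..N} f \<Lambda>"
    and fibres: "uniform_vertical_fibres M \<I>"
    and proj: "(\<lambda>x. x $ 1) ` \<Lambda> = {0..1}"
    and a_small: "a < min (b powr (ln (real N) / ln (real M))) (overlap_bound b (d_star M \<I> f d))"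
    and A3_eq: "A3 = (\<lambda>i. space_mat a b (d i) (u i) (v i) (lam i))"
    and F_eq: "F = space_map a b d u v lam t1 t2 t3"
    and lam: "\<And>i. i \<in> {1..N} \<Longrightarrow> 0 < \<bar>lam i\<bar> \<and> \<bar>lam i\<bar> < a"
    and cube: "\<And>i. i \<in> {1..N} \<Longrightarrow> F i ` cbox 0 1 \<subseteq> cbox 0 1"
    and nonoverlap: "\<And>i j. i \<in> {1..N} \<Longrightarrow> j \<in> {1..N} \<Longrightarrow> i \<noteq> j \<Longrightarrow>
          interior (F i ` cbox 0 1 \<inter> F j ` cbox 0 1) = {}"
    and attr3: "is_attractor {1..N} F \<Lambda>3"
  shows "measure_hausdorff_dim (self_affine_measure N (\<lambda>i. 1 / real N) F) = hausdorff_dim \<Lambda>3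
    \<and> hausdorff_dim \<Lambda>3 = lower_box_dim \<Lambda>3
    \<and> lower_box_dim \<Lambda>3 = upper_box_dim \<Lambda>3
    \<and> upper_box_dim \<Lambda>3 = affinity_dim {1..N} A3
    \<and> affinity_dim {1..N} A3 = ereal (1 + ln (real N * b) / (- ln a))"
proof -
  interpret tgl: diag_homogeneous_TGL N M \<I> c a b d t1 t2 by (rule tgl)
  note ab = tgl.ab
  have \<I>N: "\<I> m \<subseteq> {1..N}" if "m \<in> {1..M}" for m using tgl.columns_cover that by blast
  have disj: "m = m'" if "m \<in> {1..M}" "m' \<in> {1..M}" "i \<in> \<I> m" "i \<in> \<I> m'" for m m' i
    using tgl.columns_consecutive[of m m' i i] tgl.columns_consecutive[of m' m i i] that
    by (metis less_irrefl linorder_neqE_nat)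
  \<comment> \<open>Columns are numbered from 0, as base \<open>M\<close> digits.\<close>
  define col where "col i = (THE m. m \<in> {1..M} \<and> i \<in> \<I> m) - 1" for i
  have col_eq: "col i = m - 1" if "m \<in> {1..M}" "i \<in> \<I> m" for i m
    unfolding col_def using that disj by (subst the_equality[of _ m]) auto
  have col_ex: "\<exists>m<M. i \<in> \<I> (Suc m) \<and> col i = m" if i: "i \<in> {1..N}" for i
  proof -
    obtain m where m: "m \<in> {1..M}" "i \<in> \<I> m" using i tgl.columns_cover by blast
    then show ?thesis using col_eq[OF m] by (intro exI[of _ "m - 1"]) auto
  qed
  define K where "K = card (\<I> 1)"
  have one: "1 \<in> {1..M}" using tgl.M_gt_1 by auto
  have finI: "finite (\<I> m)" if "m \<in> {1..M}" for m using \<I>N[OF that] finite_subset by blast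
  have cardI: "card (\<I> m) = K" if "m \<in> {1..M}" for m
    using fibres that one unfolding uniform_vertical_fibres_def K_def by blast
  have K_pos: "0 < K" unfolding K_def using finI[OF one] tgl.columns_nonempty[OF one] by (simp add: card_gt_0_iff)
  have N_eq: "N = M * K"
  proof -
    have "card (\<Union>m\<in>{1..M}. \<I> m) = (\<Sum>m\<in>{1..M}. card (\<I> m))"
      using finI disj by (intro card_UN_disjoint) auto
    also have "\<dots> = M * K" using cardI by simp
    finally show ?thesis unfolding tgl.columns_cover by simp
  qed
  have M_pos: "0 < M" and b_pos: "0 < b" using tgl.M_gt_1 ab by auto
  have c1: "0 \<le> c 1"
  proof -
    obtain i where "i \<in> \<I> 1" using tgl.columns_nonempty[OF one] by blast
    then show ?thesis using tgl.column_translation[OF one, of i] tgl.translations_nonneg[of i] \<I>N[OF one] by auto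
  qed
  have f_nth: "f i x $ 1 = b * x $ 1 + t1 i" "f i x $ 2 = d i * x $ 1 + a * x $ 2 + t2 i" for i x
    by (simp_all add: f_eq plane_map_nth)
  have cover: "{0..1} \<subseteq> (\<Union>m\<in>{1..M}. {c m..c m + b})"
  proof
    fix x :: real assume "x \<in> {0..1}"
    then obtain p where p: "p \<in> \<Lambda>" "x = p $ 1" using proj by (metis imageE)
    have "\<Lambda> = (\<Union>i\<in>{1..N}. f i ` \<Lambda>)" using attr unfolding is_attractor_def by blast
    then obtain i q where iq: "i \<in> {1..N}" "q \<in> \<Lambda>" "p = f i q" using p(1) by blast
    obtain m where m: "m \<in> {1..M}" "i \<in> \<I> m" using iq(1) tgl.columns_cover by blast
    have q1: "q $ 1 \<in> {0..1}" using proj iq(2) by blast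
    have x: "x = b * q $ 1 + c m" using p iq tgl.column_translation[OF m] by (simp add: f_nth)
    have "0 \<le> b * q $ 1" "b * q $ 1 \<le> b" using q1 b_pos by (auto simp: mult_left_le)
    then show "x \<in> (\<Union>m\<in>{1..M}. {c m..c m + b})" using m(1) unfolding x by (intro UN_I[of m]) auto
  qed
  have Mb: "real M * b = 1" and c_eq: "\<And>m. m < M \<Longrightarrow> c (Suc m) = b * real m"
    using columns_tile[OF b_pos M_pos c1 tgl.columns_nonoverlapping tgl.last_column cover] by auto
  have t1_eq: "t1 i = b * real (col i)" if i: "i \<in> {1..N}" for i
  proof -
    obtain m where "m < M" "i \<in> \<I> (Suc m)" "col i = m" using col_ex[OF i] by blast
    then show ?thesis using tgl.column_translation[of "Suc m" i] c_eq by auto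
  qed
  have aN: "a * real N < 1"
  proof -
    have N0: "0 < real N" using N_eq M_pos K_pos by simp
    \<comment> \<open>As \<open>b = 1 / M\<close>, the first bound in the hypothesis is \<open>1 / N\<close>.\<close>
    have "b = 1 / real M" using Mb M_pos by (simp add: field_simps)
    then have "ln b = - ln (real M)" using M_pos by (simp add: ln_div)
    moreover have "ln (real M) > 0" using tgl.M_gt_1 by simp
    ultimately have "ln (real N) / ln (real M) * ln b = - ln (real N)" by simp
    then have "b powr (ln (real N) / ln (real M)) = 1 / real N"
      using b_pos N0 by (simp add: powr_def exp_minus inverse_eq_divide)
    then have "a < 1 / real N" using a_small by simp
    then show ?thesis using N0 by (simp add: pos_less_divide_eq)
  qed
  have strip: "0 \<le> d i * x + t2 i \<and> d i * x + t2 i + a \<le> 1"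
    if i: "i \<in> {1..N}" and x: "0 \<le> x" "x \<le> 1" for i x
  proof -
    have in_square: "f i (vector [x, y]) \<in> cbox 0 1" if "0 \<le> y" "y \<le> 1" for y
    proof -
      have "vector [x, y] \<in> cbox 0 (1::real^2)" using x that by (auto simp: mem_box_cart forall_2)
      then show ?thesis using tgl.square_invariant[OF i] unfolding f_eq by blast
    qed
    have "0 \<le> f i (vector [x, 0]) $ 2" using in_square[of 0] by (simp add: mem_box_cart)
    moreover have "f i (vector [x, 1]) $ 2 \<le> 1" using in_square[of 1] by (simp add: mem_box_cart)
    ultimately show ?thesis by (simp add: f_nth algebra_simps)
  qed
  define D where "D = d_star M \<I> f d"
  have D_nonneg: "0 \<le> D" unfolding D_def d_star_def by (intro INF_greatest) auto
  have D_le: "D \<le> ereal \<bar>d k - d j\<bar>" if m: "m \<in> {1..M}" "(k, j) \<in> overlap_pairs f (\<I> m)" for m k j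
  proof -
    have "D \<le> (INF (k, j)\<in>overlap_pairs f (\<I> m). ereal \<bar>d k - d j\<bar>)"
      unfolding D_def d_star_def using m by (intro INF_lower) auto
    also have "\<dots> \<le> (case (k, j) of (k, j) \<Rightarrow> ereal \<bar>d k - d j\<bar>)" by (rule INF_lower[OF m(2)])
    finally show ?thesis by simp
  qed
  \<comment> \<open>If no two parallelograms overlap, then the first alternative always holds and any positive value will do.\<close>
  define \<kappa> where "\<kappa> = (if D = \<infinity> then 1 else real_of_ereal D - 2 * a / (b - a))"
  have D_real: "ereal (real_of_ereal D) = D" if "D \<noteq> \<infinity>" using that D_nonneg by (auto simp: ereal_real)
  have \<kappa>: "0 < \<kappa>"
  proof (cases "D = \<infinity>")
    case False
    have "0 \<le> real_of_ereal D" using D_nonneg by (rule real_of_ereal_pos)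
    moreover have "a < b * real_of_ereal D / (2 + real_of_ereal D)"
      using a_small False by (simp add: overlap_bound_def D_def)
    ultimately show ?thesis using transversality_gap[OF ab(1,2)] False by (simp add: \<kappa>_def)
  qed (simp add: \<kappa>_def)
  have transversal: "(\<forall>x. 0 \<le> x \<longrightarrow> x \<le> 1 \<longrightarrow> a \<le> \<bar>(d i - d j) * x + (t2 i - t2 j)\<bar>) \<or>
       2 * a / (b - a) + \<kappa> \<le> \<bar>d i - d j\<bar>"
    if ij: "i \<in> {1..N}" "j \<in> {1..N}" "i \<noteq> j" "col i = col j" for i j
  proof (rule disjCI)
    assume not_tr: "\<not> 2 * a / (b - a) + \<kappa> \<le> \<bar>d i - d j\<bar>"
    obtain m where m: "m < M" "i \<in> \<I> (Suc m)" "col i = m" using col_ex[OF ij(1)] by blast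
    obtain m' where m': "m' < M" "j \<in> \<I> (Suc m')" "col j = m'" using col_ex[OF ij(2)] by blast
    have jm: "j \<in> \<I> (Suc m)" using m m' ij(4) by simp
    have mM: "Suc m \<in> {1..M}" using m(1) by simp
    have "(i, j) \<notin> overlap_pairs f (\<I> (Suc m))"
    proof
      assume "(i, j) \<in> overlap_pairs f (\<I> (Suc m))"
      from D_le[OF mM this] have le: "D \<le> ereal \<bar>d i - d j\<bar>" .
      then have fin: "D \<noteq> \<infinity>" by auto
      then have "real_of_ereal D \<le> \<bar>d i - d j\<bar>" using le D_real by (metis ereal_less_eq(3))
      then show False using not_tr fin by (simp add: \<kappa>_def)
    qed
    then have empty: "interior (f i ` cbox 0 1) \<inter> interior (f j ` cbox 0 1) = {}"
      using m jm ij by (simp add: overlap_pairs_def)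
    have "t1 i = t1 j" using t1_eq ij by simp
    then show "\<forall>x. 0 \<le> x \<longrightarrow> x \<le> 1 \<longrightarrow> a \<le> \<bar>(d i - d j) * x + (t2 i - t2 j)\<bar>"
      using parallelogram_interiors_meet[of a b _ t1 i j d t2] empty ab(1) b_pos
      unfolding f_eq by (meson not_le)
  qed
  have fibre: "card {i \<in> {1..N}. col i = m} = K" if "m < M" for m
  proof -
    have mM: "Suc m \<in> {1..M}" using that by simp
    have "{i \<in> {1..N}. col i = m} = \<I> (Suc m)"
    proof (intro set_eqI iffI)
      fix i assume "i \<in> {i \<in> {1..N}. col i = m}"
      then show "i \<in> \<I> (Suc m)" using col_ex[of i] by auto
    next
      fix i assume i: "i \<in> \<I> (Suc m)"
      then show "i \<in> {i \<in> {1..N}. col i = m}" using \<I>N[OF mM] col_eq[OF mM i] by auto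
    qed
    then show ?thesis using cardI[OF mM] by simp
  qed
  interpret skew_system N M K col a b \<kappa> d t2 t1 u v lam t3 A3 F
  proof
    show "0 < a" "a < b" "b < 1" by (rule ab)+
    show "col i < M" if "i \<in> {1..N}" for i using col_ex[OF that] by auto
  qed (fact Mb N_eq fibre aN strip \<kappa> transversal K_pos t1_eq A3_eq F_eq lam cube)+
  show ?thesis
    using dimensions_of_attractor[OF attr3] affinity_dim_eq by simp
qed

end
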